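(* For every space-constructible function $t:\mathbb{N}\to\mathbb{N}$, we have $\mathrm{NTIME}(2^{t(n)}) \subseteq \mathrm{NST}(3,O(t(n)),2)$.
   Context: A function $f:\mathbb{N}\to\mathbb{N}$ is space-constructible if there is a deterministic Turing machine that, given $n$ in unary on its read-only input tape, writes $f(n)$ in unary on its output tape using $O(f(n))$ space on its work tapes. Machine model: multi-tape Turing machines with $t'+u$ tapes; the first $t'$ tapes are external memory tapes (the first is the read/write input tape), the other $u$ are internal memory tapes. For a finite run $\rho$ and tape $i$, $\mathrm{rev}(\rho,i)$ is the number of head direction changes on tape $i$ and $\mathrm{space}(\rho,i)$ the number of cells of tape $i$ used. For $r,s:\mathbb{N}\to\mathbb{N}$ and $t'\in\mathbb{N}$, a nondeterministic Turing machine is $(r,s,t')$-bounded if every run $\rho$ on an input of length $n$ is finite, $1+\sum_{i=1}^{t'}\mathrm{rev}(\rho,i)\le r(n)$ and $\sum_{i>t'}\mathrm{space}(\rho,i)\le s(n)$. $\mathrm{NST}(r,s,t')$ is the class of decision problems decided by a nondeterministic $(r,s,t')$-bounded Turing machine, and for a class $S$ of functions $\mathrm{NST}(r,S,t')=\bigcup_{s\in S}\mathrm{NST}(r,s,t')$. *)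

theory Defs
  imports Complex_Main "HOL-Library.Landau_Symbols"
begin

section \<open>Nondeterministic multi-tape Turing machines\<close>

text \<open>
  \<open>'a\<close> is the input alphabet; \<open>Aux\<close> provides an unlimited supply of further work symbols, of
  which a machine uses only finitely many.
\<close>

datatype 'a sym = Blank | Inp 'a | Aux nat

text \<open>
  A transition \<open>(q, xs, q', ys, ds)\<close> is applicable in state \<open>q\<close> if head \<open>i\<close> reads \<open>xs ! i\<close>; it
  writes \<open>ys ! i\<close>, moves head \<open>i\<close> by \<open>ds ! i\<close> and goes to state \<open>q'\<close>.
\<close>

type_synonym 'a transition = "nat \<times> 'a sym list \<times> nat \<times> 'a sym list \<times> int list"

record 'a ntm =
  ntapes :: nat
  states :: "nat set"
  alphabet :: "'a sym set"
  start :: nat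
  accepting :: "nat set"
  delta :: "'a transition set"

definition wf_ntm :: "'a ntm \<Rightarrow> bool" where
  "wf_ntm M \<longleftrightarrow>
     1 \<le> ntapes M \<and>
     finite (states M) \<and> start M \<in> states M \<and> accepting M \<subseteq> states M \<and>
     finite (alphabet M) \<and> insert Blank (range Inp) \<subseteq> alphabet M \<and>
     (\<forall>(q, xs, q', ys, ds) \<in> delta M.
        q \<in> states M \<and> q' \<in> states M \<and>
        length xs = ntapes M \<and> set xs \<subseteq> alphabet M \<and>
        length ys = ntapes M \<and> set ys \<subseteq> alphabet M \<and>
        length ds = ntapes M \<and> set ds \<subseteq> {- 1, 0, 1})"

definition deterministic :: "'a ntm \<Rightarrow> bool" where
  "deterministic M \<longleftrightarrow>
     (\<forall>q xs q1 ys1 ds1 q2 ys2 ds2.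
        (q, xs, q1, ys1, ds1) \<in> delta M \<longrightarrow> (q, xs, q2, ys2, ds2) \<in> delta M \<longrightarrow>
        q1 = q2 \<and> ys1 = ys2 \<and> ds1 = ds2)"

text \<open>Tapes are infinite in both directions; indices \<open>i \<ge> ntapes M\<close> are irrelevant.\<close>

record 'a config =
  cstate :: nat
  chead :: "nat \<Rightarrow> int"
  ctape :: "nat \<Rightarrow> int \<Rightarrow> 'a sym"

definition word_tape :: "'a list \<Rightarrow> int \<Rightarrow> 'a sym" where
  "word_tape w p = (if 0 \<le> p \<and> p < int (length w) then Inp (w ! nat p) else Blank)"

definition init_config :: "'a ntm \<Rightarrow> 'a list \<Rightarrow> 'a config" where
  "init_config M w =
     \<lparr>cstate = start M,
      chead = (\<lambda>_. 0),
      ctape = (\<lambda>i. if i = 0 then word_tape w else (\<lambda>_. Blank))\<rparr>"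

definition step :: "'a ntm \<Rightarrow> 'a config \<Rightarrow> 'a config \<Rightarrow> bool" where
  "step M c c' \<longleftrightarrow>
     (\<exists>q' ys ds.
        (cstate c, map (\<lambda>i. ctape c i (chead c i)) [0..<ntapes M], q', ys, ds) \<in> delta M \<and>
        c' = \<lparr>cstate = q',
              chead = (\<lambda>i. if i < ntapes M then chead c i + ds ! i else chead c i),
              ctape = (\<lambda>i. if i < ntapes M then (ctape c i)(chead c i := ys ! i) else ctape c i)\<rparr>)"

definition final_config :: "'a ntm \<Rightarrow> 'a config \<Rightarrow> bool" where
  "final_config M c \<longleftrightarrow> (\<nexists>c'. step M c c')"

definition finite_run :: "'a ntm \<Rightarrow> 'a list \<Rightarrow> 'a config list \<Rightarrow> bool" where
  "finite_run M w \<rho> \<longleftrightarrow>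
     \<rho> \<noteq> [] \<and> hd \<rho> = init_config M w \<and> successively (step M) \<rho> \<and> final_config M (last \<rho>)"

definition infinite_run :: "'a ntm \<Rightarrow> 'a list \<Rightarrow> (nat \<Rightarrow> 'a config) \<Rightarrow> bool" where
  "infinite_run M w \<rho> \<longleftrightarrow> \<rho> 0 = init_config M w \<and> (\<forall>j. step M (\<rho> j) (\<rho> (Suc j)))"

text \<open>A run that gets stuck outside \<open>accepting M\<close> is rejecting.\<close>

definition decides :: "'a ntm \<Rightarrow> 'a list set \<Rightarrow> bool" where
  "decides M L \<longleftrightarrow>
     (\<forall>w. \<nexists>\<rho>. infinite_run M w \<rho>) \<and>
     (\<forall>w. w \<in> L \<longleftrightarrow> (\<exists>\<rho>. finite_run M w \<rho> \<and> cstate (last \<rho>) \<in> accepting M))"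

section \<open>Resources of a run\<close>

definition time :: "'a config list \<Rightarrow> nat" where
  "time \<rho> = length \<rho> - 1"

text \<open>
  The nonzero moves (\<open>1\<close> or \<open>- 1\<close>) of head \<open>i\<close> in their order: steps in which the head stays
  put neither are nor hide a change of direction.
\<close>

definition moves :: "'a config list \<Rightarrow> nat \<Rightarrow> int list" where
  "moves \<rho> i =
     filter (\<lambda>d. d \<noteq> 0)
       (map (\<lambda>j. chead (\<rho> ! Suc j) i - chead (\<rho> ! j) i) [0..<length \<rho> - 1])"

definition rev_count :: "'a config list \<Rightarrow> nat \<Rightarrow> nat" where
  "rev_count \<rho> i =
     card {j. Suc j < length (moves \<rho> i) \<and> moves \<rho> i ! j \<noteq> moves \<rho> i ! Suc j}"

text \<open>Only cells under the head are read or written, so the used cells are the visited ones.\<close>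

definition space :: "'a config list \<Rightarrow> nat \<Rightarrow> nat" where
  "space \<rho> i = card ((\<lambda>c. chead c i) ` set \<rho>)"

section \<open>Complexity classes\<close>

definition nat_bigo :: "(nat \<Rightarrow> nat) \<Rightarrow> (nat \<Rightarrow> nat) set" where
  "nat_bigo f = {g. (\<lambda>n. real (g n)) \<in> O(\<lambda>n. real (f n))}"

definition NTIME :: "(nat \<Rightarrow> nat) \<Rightarrow> 'a list set set" where
  "NTIME f =
     {L. \<exists>M T. wf_ntm M \<and> decides M L \<and> T \<in> nat_bigo f \<and>
           (\<forall>w \<rho>. finite_run M w \<rho> \<longrightarrow> time \<rho> \<le> T (length w))}"

definition rst_bounded :: "(nat \<Rightarrow> nat) \<Rightarrow> (nat \<Rightarrow> nat) \<Rightarrow> nat \<Rightarrow> 'a ntm \<Rightarrow> bool" where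
  "rst_bounded r s t' M \<longleftrightarrow>
     t' \<le> ntapes M \<and>
     (\<forall>w. (\<nexists>\<rho>. infinite_run M w \<rho>) \<and>
          (\<forall>\<rho>. finite_run M w \<rho> \<longrightarrow>
             1 + (\<Sum>i<t'. rev_count \<rho> i) \<le> r (length w) \<and>
             (\<Sum>i=t'..<ntapes M. space \<rho> i) \<le> s (length w)))"

definition NST :: "(nat \<Rightarrow> nat) \<Rightarrow> (nat \<Rightarrow> nat) \<Rightarrow> nat \<Rightarrow> 'a list set set" where
  "NST r s t' = {L. \<exists>M. wf_ntm M \<and> rst_bounded r s t' M \<and> decides M L}"

definition NST_class :: "(nat \<Rightarrow> nat) \<Rightarrow> (nat \<Rightarrow> nat) set \<Rightarrow> nat \<Rightarrow> 'a list set set" where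
  "NST_class r S t' = (\<Union>s\<in>S. NST r s t')"

section \<open>Space-constructible functions\<close>

definition read_only :: "'a ntm \<Rightarrow> nat \<Rightarrow> bool" where
  "read_only M i \<longleftrightarrow> (\<forall>(q, xs, q', ys, ds) \<in> delta M. ys ! i = xs ! i)"

text \<open>Write-only, with a head that never moves to the left.\<close>

definition output_tape :: "'a ntm \<Rightarrow> nat \<Rightarrow> bool" where
  "output_tape M i \<longleftrightarrow>
     (\<forall>(q, xs, q', ys, ds) \<in> delta M.
        0 \<le> ds ! i \<and> (\<forall>a \<in> alphabet M. (q, xs[i := a], q', ys, ds) \<in> delta M))"

text \<open>
  Tape 0 is the input tape, tape 1 the output tape, all others are work tapes. The input head
  stays on the input word and the two adjacent blank cells, which act as end markers; otherwise
  its position could serve as an unbounded counter that is not charged for.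
\<close>

definition space_constructible :: "(nat \<Rightarrow> nat) \<Rightarrow> bool" where
  "space_constructible f \<longleftrightarrow>
     (\<exists>(M :: unit ntm) S.
        wf_ntm M \<and> deterministic M \<and> 2 \<le> ntapes M \<and> read_only M 0 \<and> output_tape M 1 \<and>
        S \<in> nat_bigo f \<and>
        (\<forall>n. \<exists>\<rho>. finite_run M (replicate n ()) \<rho> \<and>
               (\<forall>c \<in> set \<rho>. chead c 0 \<in> {- 1..int n}) \<and>
               ctape (last \<rho>) 1 = word_tape (replicate (f n) ()) \<and>
               (\<Sum>i=2..<ntapes M. space \<rho> i) \<le> S n))"

end

theory Submission
  imports Defs "HOL-Library.Countable"
begin

text \<open>
  Let \<open>M\<close> decide \<open>L\<close> in time \<open>T n \<le> C * 2 ^ t n\<close>. If \<open>T n < n\<close> for some \<open>n\<close>, then on inputs with at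
  least \<open>n\<close> letters \<open>M\<close> halts before it sees more than the first \<open>n\<close> of them, so membership depends
  on a prefix of bounded length and a finite automaton suffices. Otherwise \<open>n \<le> C * 2 ^ t n\<close>, so that
  numbers up to \<open>n\<close> fit into space \<open>O(t n)\<close>.

  In this case the simulating machine counts the input letters on an internal counter tape while it
  copies the initial configuration of \<open>M\<close> as a first row to the second external tape. With the length
  of the input at hand it runs the space constructor on internal tapes, keeping the position
  of the input head as a second number on the counter tape, and lengthens the counter tape by one cell
  per output symbol. Then it guesses the remaining configurations of a run of \<open>M\<close>, row by row, writing
  the same symbols on both external tapes; the counter is incremented with every symbol and the
  machine gets stuck on overflow, which makes all runs finite. Finally both heads turn around, the
  only reversals: tape 1 skips the last row, and from then on row \<open>j + 1\<close> on tape 0 meets row \<open>j\<close> on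
  tape 1, so that the two can be compared cell by cell with finite memory.
\<close>

section \<open>Runs of Turing machines\<close>

text \<open>The obstacle is the single turn of each external head: after it, every cell is seen
  once, and from the right. The transition between two rows must therefore be known before their
  cells are met. This is why the state and the scanned symbols are guessed in a delimiter at the
  right end of each row and confirmed later, at the cells with a head flag. Likewise the constructor
  cannot move on the real input, so it works on a virtual one of which only the length and the head
  position are stored. Row \<open>j\<close> covers the cells \<open>- j\<close> to
  \<open>n + j\<close>. No head and no written symbol gets further in \<open>j\<close> steps, so no
  alignment of rows has to be guessed, at the price of a quadratic total length. With
  \<open>X = C * 2 ^ t n\<close> bounding both \<open>n\<close> and the running time, this length is
  at most \<open>8 * X ^ 2\<close>, which explains the base \<open>8 * C ^ 2 + 1\<close> and the
  \<open>t n + 1\<close> digits. The first row exists on tape 1 only, since the input occupies its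
  place on tape 0.\<close>

definition reads :: "'a config \<Rightarrow> nat \<Rightarrow> 'a sym" where
  "reads c i = ctape c i (chead c i)"

text \<open>Symbols and moves are functions of the tape index, of which only the values below
  \<open>N\<close> matter; this avoids list bookkeeping.\<close>

definition upd :: "nat \<Rightarrow> nat \<Rightarrow> (nat \<Rightarrow> 'a sym) \<Rightarrow> (nat \<Rightarrow> int) \<Rightarrow> 'a config \<Rightarrow> 'a config" where
  "upd N q y d c = \<lparr>cstate = q,
     chead = (\<lambda>i. if i < N then chead c i + d i else chead c i),
     ctape = (\<lambda>i. if i < N then (ctape c i)(chead c i := y i) else ctape c i)\<rparr>"

lemma upd_simps [simp]:
  "cstate (upd N q y d c) = q"
  "chead (upd N q y d c) i = (if i < N then chead c i + d i else chead c i)"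
  "ctape (upd N q y d c) i = (if i < N then (ctape c i)(chead c i := y i) else ctape c i)"
  by (auto simp: upd_def)

lemma upd_cong:
  "(\<And>i. i < N \<Longrightarrow> y i = y' i) \<Longrightarrow> (\<And>i. i < N \<Longrightarrow> d i = d' i) \<Longrightarrow> upd N q y d c = upd N q y' d' c"
  unfolding upd_def by (auto simp: fun_eq_iff)

lemma step_upd:
  "step M c c' \<longleftrightarrow> (\<exists>q' ys ds. (cstate c, map (reads c) [0..<ntapes M], q', ys, ds) \<in> delta M \<and>
     c' = upd (ntapes M) q' ((!) ys) ((!) ds) c)"
  unfolding step_def upd_def reads_def[abs_def] by blast

lemma wf_deltaD:
  assumes "wf_ntm M" "(q, xs, q', ys, ds) \<in> delta M"
  shows "q \<in> states M" "q' \<in> states M" "length xs = ntapes M" "set xs \<subseteq> alphabet M"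
    "length ys = ntapes M" "set ys \<subseteq> alphabet M" "length ds = ntapes M" "set ds \<subseteq> {-1, 0, 1}"
  using assms unfolding wf_ntm_def by (fast, fast, fast, fast, fast, fast, fast, fast)

lemma step_state: "wf_ntm M \<Longrightarrow> step M c c' \<Longrightarrow> cstate c' \<in> states M"
  unfolding step_upd by (auto dest: wf_deltaD)

lemma step_alphabet:
  assumes "wf_ntm M" "step M c c'" "i < ntapes M" "\<And>p. ctape c i p \<in> alphabet M"
  shows "ctape c' i p \<in> alphabet M"
proof -
  obtain q' ys ds where *: "(cstate c, map (reads c) [0..<ntapes M], q', ys, ds) \<in> delta M"
    "c' = upd (ntapes M) q' ((!) ys) ((!) ds) c" using assms(2) unfolding step_upd by blast
  have "ys ! i \<in> alphabet M"
    using wf_deltaD(5,6)[OF assms(1) *(1)] assms(3) by (metis nth_mem subsetD)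
  with *(2) assms(4) show ?thesis by auto
qed

lemma init_alphabet: "wf_ntm M \<Longrightarrow> ctape (init_config M w) i p \<in> alphabet M"
  by (auto simp: wf_ntm_def init_config_def word_tape_def)

lemma steps_alphabet:
  assumes "wf_ntm M" "(step M)\<^sup>*\<^sup>* c c'" "\<And>i p. i < ntapes M \<Longrightarrow> ctape c i p \<in> alphabet M" "i < ntapes M"
  shows "ctape c' i p \<in> alphabet M"
  using assms(2,1,3,4)
proof (induction arbitrary: p)
  case (step y z)
  show ?case by (rule step_alphabet[OF step.prems(1) step.hyps(2) step.prems(3)]) (use step in blast)
qed auto

lemma step_head:
  assumes "wf_ntm M" "step M c c'"
  shows "chead c' i - chead c i \<in> {-1, 0, 1}"
proof -
  obtain q' ys ds where *: "(cstate c, map (reads c) [0..<ntapes M], q', ys, ds) \<in> delta M"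
    "c' = upd (ntapes M) q' ((!) ys) ((!) ds) c" using assms(2) unfolding step_upd by blast
  have "i < ntapes M \<Longrightarrow> ds ! i \<in> {-1, 0, 1}"
    using wf_deltaD(7,8)[OF assms(1) *(1)] by (metis nth_mem subsetD)
  with *(2) show ?thesis by auto
qed

lemma successively_nth:
  "successively P xs \<longleftrightarrow> (\<forall>j. Suc j < length xs \<longrightarrow> P (xs ! j) (xs ! Suc j))"
  using successively_conv_nth by blast

section \<open>Partial runs and reachability\<close>

lemma partial_run_nth:
  assumes "successively (step M) \<rho>" "\<rho> \<noteq> []" "j < length \<rho>"
  shows "(step M)\<^sup>*\<^sup>* (hd \<rho>) (\<rho> ! j)"
  using assms(3)
proof (induction j)
  case 0 thus ?case using assms by (simp add: hd_conv_nth)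
next
  case (Suc j)
  hence "step M (\<rho> ! j) (\<rho> ! Suc j)" using assms(1) by (simp add: successively_nth)
  thus ?case using Suc by (meson Suc_lessD rtranclp.rtrancl_into_rtrancl)
qed

lemma steps_partial_run:
  assumes "(step M)\<^sup>*\<^sup>* c c'"
  shows "\<exists>\<rho>. successively (step M) \<rho> \<and> \<rho> \<noteq> [] \<and> hd \<rho> = c \<and> last \<rho> = c'"
  using assms
proof induction
  case base
  show ?case by (rule exI[of _ "[c]"]) auto
next
  case (step y z)
  then obtain \<rho> where "successively (step M) \<rho> \<and> \<rho> \<noteq> [] \<and> hd \<rho> = c \<and> last \<rho> = y" by blast
  thus ?case using step(2) by (intro exI[of _ "\<rho> @ [z]"]) (auto simp: successively_append_iff)
qed

lemma finite_run_reach: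
  "(\<exists>\<rho>. finite_run M w \<rho> \<and> P (last \<rho>)) \<longleftrightarrow>
   (\<exists>c. (step M)\<^sup>*\<^sup>* (init_config M w) c \<and> final_config M c \<and> P c)"
proof
  assume "\<exists>\<rho>. finite_run M w \<rho> \<and> P (last \<rho>)"
  then obtain \<rho> where "finite_run M w \<rho>" "P (last \<rho>)" by blast
  thus "\<exists>c. (step M)\<^sup>*\<^sup>* (init_config M w) c \<and> final_config M c \<and> P c"
    using partial_run_nth[of M \<rho> "length \<rho> - 1"]
    by (intro exI[of _ "last \<rho>"]) (auto simp: finite_run_def last_conv_nth)
next
  assume "\<exists>c. (step M)\<^sup>*\<^sup>* (init_config M w) c \<and> final_config M c \<and> P c"
  then obtain c where "(step M)\<^sup>*\<^sup>* (init_config M w) c" "final_config M c" "P c" by blast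
  thus "\<exists>\<rho>. finite_run M w \<rho> \<and> P (last \<rho>)"
    using steps_partial_run[of M "init_config M w" c] unfolding finite_run_def by blast
qed

text \<open>If no extension of \<open>\<rho>\<close> is complete, then every extension ends in a
  configuration that is not final and can be prolonged; the limit of these prolongations is an
  infinite run.\<close>

lemma partial_run_extend:
  assumes noinf: "\<nexists>\<rho>. infinite_run M w \<rho>"
    and "successively (step M) \<rho>" "\<rho> \<noteq> []" "hd \<rho> = init_config M w"
  shows "\<exists>\<sigma>. finite_run M w (\<rho> @ \<sigma>)"
proof (rule ccontr)
  assume H: "\<not> ?thesis"
  define good where "good \<tau> \<longleftrightarrow> successively (step M) \<tau> \<and> (\<exists>\<sigma>. \<tau> = \<rho> @ \<sigma>)" for \<tau>
  have ext: "\<exists>c. good (\<tau> @ [c])" if "good \<tau>" for \<tau>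
  proof -
    have "\<tau> \<noteq> []" "hd \<tau> = init_config M w" using that assms by (auto simp: good_def)
    hence "\<not> final_config M (last \<tau>)" using that H unfolding good_def finite_run_def by blast
    then obtain c where "step M (last \<tau>) c" unfolding final_config_def by blast
    thus ?thesis using that \<open>\<tau> \<noteq> []\<close> unfolding good_def
      by (intro exI[of _ c]) (auto simp: successively_append_iff)
  qed
  define nx where "nx \<tau> = \<tau> @ [SOME c. good (\<tau> @ [c])]" for \<tau>
  define R where "R j = (nx ^^ j) \<rho>" for j
  have good: "good (R j)" for j
  proof (induction j)
    case 0 thus ?case using assms by (auto simp: R_def good_def)
  next
    case (Suc j) thus ?case using someI_ex[OF ext[OF Suc]] by (simp add: R_def nx_def)
  qed
  have RS: "\<exists>c. R (Suc j) = R j @ [c]" for j by (auto simp: R_def nx_def)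
  have len: "length (R j) = length \<rho> + j" for j
    by (induction j) (auto simp: R_def nx_def)
  have mono: "i < length (R j) \<Longrightarrow> R (j + k) ! i = R j ! i" for i j k
  proof (induction k)
    case (Suc k)
    obtain c where "R (Suc (j + k)) = R (j + k) @ [c]" using RS by blast
    thus ?case using Suc len by (simp add: nth_append)
  qed auto
  \<comment> \<open>The limit is read off the diagonal: \<open>R j\<close> is longer than
    \<open>j\<close> because \<open>\<rho>\<close> is nonempty, and later lists only append.\<close>
  define f where "f j = R j ! j" for j
  have f: "f j = R (j + k) ! j" for j k using mono[of j j k] len[of j] assms(3) by (auto simp: f_def)
  have st: "step M (f j) (f (Suc j))" for j
  proof -
    have "Suc j < length (R (Suc j))" using len assms(3) by auto
    moreover have "successively (step M) (R (Suc j))" using good good_def by blast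
    ultimately show ?thesis using f[of j 1] f_def successively_nth by fastforce
  qed
  have f0: "f 0 = init_config M w" using assms by (simp add: f_def R_def hd_conv_nth)
  have "infinite_run M w f" unfolding infinite_run_def using st f0 by blast
  thus False using noinf by blast
qed

text \<open>Machines with control states of an arbitrary countable type; states and symbols outside
  the given finite sets are cut off, which makes well-formedness automatic.\<close>

definition make_ntm :: "nat \<Rightarrow> 'q::countable set \<Rightarrow> 'a sym set \<Rightarrow> 'q \<Rightarrow> 'q set \<Rightarrow>
    ('q \<Rightarrow> (nat \<Rightarrow> 'a sym) \<Rightarrow> 'q \<Rightarrow> (nat \<Rightarrow> 'a sym) \<Rightarrow> (nat \<Rightarrow> int) \<Rightarrow> bool) \<Rightarrow> 'a ntm" where
  "make_ntm N Q \<Sigma> q0 F tr = \<lparr>ntapes = N, states = to_nat ` Q, alphabet = \<Sigma>, start = to_nat q0,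
     accepting = to_nat ` F,
     delta = {(to_nat q, xs, to_nat q', map y [0..<N], map d [0..<N]) | q xs q' y d.
        length xs = N \<and> set xs \<subseteq> \<Sigma> \<and> q \<in> Q \<and> q' \<in> Q \<and> (\<forall>i<N. y i \<in> \<Sigma> \<and> d i \<in> {-1, 0, 1}) \<and>
        tr q (\<lambda>i. if i < N then xs ! i else Blank) q' y d}\<rparr>"

lemma make_ntm_simps [simp]:
  "ntapes (make_ntm N Q \<Sigma> q0 F tr) = N" "start (make_ntm N Q \<Sigma> q0 F tr) = to_nat q0"
  "accepting (make_ntm N Q \<Sigma> q0 F tr) = to_nat ` F" "states (make_ntm N Q \<Sigma> q0 F tr) = to_nat ` Q"
  "alphabet (make_ntm N Q \<Sigma> q0 F tr) = \<Sigma>"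
  by (auto simp: make_ntm_def)

lemma wf_make_ntm:
  assumes "1 \<le> N" "finite Q" "finite \<Sigma>" "insert Blank (range Inp) \<subseteq> \<Sigma>" "q0 \<in> Q" "F \<subseteq> Q"
  shows "wf_ntm (make_ntm N Q \<Sigma> q0 F tr)"
  using assms unfolding wf_ntm_def make_ntm_def by (auto simp: image_subset_iff) blast

text \<open>\<open>tr\<close> receives a function, a transition only a list of length
  \<open>N\<close>; the default \<open>Blank\<close> makes the function depend on that list
  alone.\<close>

definition rd :: "nat \<Rightarrow> 'a config \<Rightarrow> nat \<Rightarrow> 'a sym" where
  "rd N c i = (if i < N then reads c i else Blank)"

lemma step_make_ntm:
  "step (make_ntm N Q \<Sigma> q0 F tr) c c' \<longleftrightarrow>
   (\<exists>q q' y d. cstate c = to_nat q \<and> (\<forall>i<N. reads c i \<in> \<Sigma>) \<and> q \<in> Q \<and> q' \<in> Q \<and>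
      (\<forall>i<N. y i \<in> \<Sigma> \<and> d i \<in> {-1, 0, 1}) \<and> tr q (rd N c) q' y d \<and> c' = upd N (to_nat q') y d c)"
    (is "?L \<longleftrightarrow> ?R")
proof -
  have rd: "(\<lambda>i. if i < N then map (reads c) [0..<N] ! i else Blank) = rd N c"
    by (auto simp: rd_def fun_eq_iff)
  have sub: "set (map (reads c) [0..<N]) \<subseteq> \<Sigma> \<longleftrightarrow> (\<forall>i<N. reads c i \<in> \<Sigma>)" by auto
  have u: "upd N q ((!) (map y [0..<N])) ((!) (map d [0..<N])) c = upd N q y d c" for q y d
    by (rule upd_cong) auto
  have "?L \<longleftrightarrow> (\<exists>q' ys ds. (cstate c, map (reads c) [0..<N], q', ys, ds) \<in> delta (make_ntm N Q \<Sigma> q0 F tr) \<and>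
     c' = upd N q' ((!) ys) ((!) ds) c)" by (simp add: step_upd)
  also have "\<dots> \<longleftrightarrow> (\<exists>q q' y d. cstate c = to_nat q \<and> set (map (reads c) [0..<N]) \<subseteq> \<Sigma> \<and> q \<in> Q \<and> q' \<in> Q \<and>
      (\<forall>i<N. y i \<in> \<Sigma> \<and> d i \<in> {-1, 0, 1}) \<and>
      tr q (\<lambda>i. if i < N then map (reads c) [0..<N] ! i else Blank) q' y d \<and>
      c' = upd N (to_nat q') ((!) (map y [0..<N])) ((!) (map d [0..<N])) c)"
    unfolding make_ntm_def by (simp del: set_map) blast
  also have "\<dots> \<longleftrightarrow> ?R" unfolding rd sub u ..
  finally show ?thesis .
qed

lemma step_make_ntmE:
  assumes "step (make_ntm N Q \<Sigma> q0 F tr) c c'" "cstate c = to_nat q"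
  obtains q' y d where "q \<in> Q" "q' \<in> Q" "\<forall>i<N. y i \<in> \<Sigma>" "\<forall>i<N. d i \<in> {-1, 0, 1}"
    "tr q (rd N c) q' y d" "c' = upd N (to_nat q') y d c"
proof -
  obtain q1 q' y d where *: "cstate c = to_nat q1" "q1 \<in> Q" "q' \<in> Q"
    "\<forall>i<N. y i \<in> \<Sigma> \<and> d i \<in> {-1, 0, 1}" "tr q1 (rd N c) q' y d" "c' = upd N (to_nat q') y d c"
    using assms(1) unfolding step_make_ntm by blast
  moreover have "q1 = q" using *(1) assms(2) by simp
  ultimately show ?thesis using that[of q' y d] by simp
qed

lemma step_make_ntmI:
  assumes "cstate c = to_nat q" "\<forall>i<N. reads c i \<in> \<Sigma>" "q \<in> Q" "q' \<in> Q"
    "\<forall>i<N. y i \<in> \<Sigma> \<and> d i \<in> {-1, 0, 1}" "tr q (rd N c) q' y d" "c' = upd N (to_nat q') y d c"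
  shows "step (make_ntm N Q \<Sigma> q0 F tr) c c'"
  unfolding step_make_ntm using assms by blast

section \<open>Time bounds, ranks and reversals\<close>

lemma relpowp_partial_run:
  assumes "(step M ^^ j) c c'"
  shows "\<exists>\<rho>. successively (step M) \<rho> \<and> length \<rho> = Suc j \<and> hd \<rho> = c \<and> last \<rho> = c'"
  using assms
proof (induction j arbitrary: c')
  case 0
  thus ?case by (intro exI[of _ "[c]"]) auto
next
  case (Suc j)
  then obtain y where "(step M ^^ j) c y" "step M y c'" by auto
  with Suc.IH obtain \<rho> where "successively (step M) \<rho> \<and> length \<rho> = Suc j \<and> hd \<rho> = c \<and> last \<rho> = y"
    by blast
  moreover from this have "\<rho> \<noteq> []" by auto
  ultimately show ?case using \<open>step M y c'\<close>
    by (intro exI[of _ "\<rho> @ [c']"]) (auto simp: successively_append_iff)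
qed

text \<open>Bounds on complete runs carry over to all computations, because each of them extends to
  a complete run.\<close>

lemma relpowp_time:
  assumes "\<nexists>\<rho>. infinite_run M w \<rho>" "\<And>\<rho>. finite_run M w \<rho> \<Longrightarrow> time \<rho> \<le> m"
    and "(step M ^^ j) (init_config M w) c"
  shows "j \<le> m"
proof -
  obtain \<rho> where \<rho>: "successively (step M) \<rho>" "length \<rho> = Suc j" "hd \<rho> = init_config M w"
    using relpowp_partial_run[OF assms(3)] by blast
  then obtain \<sigma> where "finite_run M w (\<rho> @ \<sigma>)"
    using partial_run_extend[OF assms(1), of \<rho>] by fastforce
  from assms(2)[OF this] show ?thesis using \<rho>(2) by (simp add: time_def)
qed

lemma decides_relpowp:
  assumes "decides M L"
  shows "w \<in> L \<longleftrightarrow> (\<exists>j c. (step M ^^ j) (init_config M w) c \<and> final_config M c \<and> cstate c \<in> accepting M)"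
proof -
  have "w \<in> L \<longleftrightarrow> (\<exists>\<rho>. finite_run M w \<rho> \<and> cstate (last \<rho>) \<in> accepting M)"
    using assms unfolding decides_def by blast
  also have "\<dots> \<longleftrightarrow> (\<exists>c. (step M)\<^sup>*\<^sup>* (init_config M w) c \<and> final_config M c \<and> cstate c \<in> accepting M)"
    by (rule finite_run_reach[of M w "\<lambda>c. cstate c \<in> accepting M"])
  finally show ?thesis unfolding rtranclp_power by blast
qed

text \<open>The rank \<open>m\<close> is tied to \<open>c\<close> by a relation instead of being a
  function of the configuration. The same \<open>Inv\<close> then serves in
  \<open>finite_run_inv\<close>, so that one case analysis yields termination, the space bound and
  soundness.\<close>

lemma no_infinite_run:
  assumes "wf r" "Inv m0 (init_config M w)"
    "\<And>m c c'. Inv m c \<Longrightarrow> step M c c' \<Longrightarrow> \<exists>m'. Inv m' c' \<and> (m', m) \<in> r"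
  shows "\<not> infinite_run M w \<rho>"
proof
  assume \<rho>: "infinite_run M w \<rho>"
  have "\<forall>j. \<not> Inv m (\<rho> j)" for m
    using assms(1)
  proof (induction m rule: wf_induct_rule)
    case (less m)
    show ?case using less assms(3) \<rho> unfolding infinite_run_def by metis
  qed
  thus False using assms(2) \<rho> unfolding infinite_run_def by metis
qed

lemma finite_run_inv:
  assumes "finite_run M w \<rho>" "Inv m0 (init_config M w)"
    "\<And>m c c'. Inv m c \<Longrightarrow> step M c c' \<Longrightarrow> \<exists>m'. Inv m' c'" "c \<in> set \<rho>"
  shows "\<exists>m. Inv m c"
proof -
  obtain j where "j < length \<rho>" "c = \<rho> ! j" using assms(4) by (metis in_set_conv_nth)
  hence "(step M)\<^sup>*\<^sup>* (init_config M w) c"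
    using assms(1) partial_run_nth[of M \<rho> j] by (auto simp: finite_run_def)
  thus ?thesis
    by induction (use assms(2,3) in blast)+
qed

text \<open>\<open>G j\<close> says that step \<open>j\<close> belongs to the outward part. The
  moves are a block of \<open>1\<close> followed by a block of \<open>- 1\<close>, in which at most
  one neighbouring pair differs.\<close>

lemma rev_count_le_1:
  assumes "\<And>j. Suc j < length \<rho> \<Longrightarrow> G j \<Longrightarrow> chead (\<rho> ! Suc j) i - chead (\<rho> ! j) i \<in> {0, 1}"
    and "\<And>j. Suc j < length \<rho> \<Longrightarrow> \<not> G j \<Longrightarrow>
       chead (\<rho> ! Suc j) i - chead (\<rho> ! j) i \<in> {0, -1} \<and> \<not> G (Suc j)"
  shows "rev_count \<rho> i \<le> 1"
proof -
  define f where "f j = chead (\<rho> ! Suc j) i - chead (\<rho> ! j) i" for j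
  define m where "m = length \<rho> - 1"
  \<comment> \<open>The first step of the return, or the number of steps if there is no
    return.\<close>
  define j0 where "j0 = (if \<exists>j<m. \<not> G j then LEAST j. j < m \<and> \<not> G j else m)"
  have j0: "j0 \<le> m" "\<And>j. j < j0 \<Longrightarrow> G j"
  proof -
    show "j0 \<le> m" unfolding j0_def by (smt (verit, best) LeastI le_eq_less_or_eq)
    show "G j" if "j < j0" for j
      using that \<open>j0 \<le> m\<close> not_less_Least[of j "\<lambda>j. j < m \<and> \<not> G j"]
      unfolding j0_def by (auto split: if_splits)
  qed
  have late: "\<not> G j" if "j0 \<le> j" "j < m" for j
    using that
  proof (induction j rule: dec_induct)
    case base
    hence "\<exists>j<m. \<not> G j" unfolding j0_def by (auto split: if_splits)
    hence "\<exists>j. j < m \<and> \<not> G j" by blast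
    from LeastI_ex[OF this] \<open>\<exists>j<m. _\<close> show ?case unfolding j0_def by simp
  next
    case (step j)
    thus ?case using assms(2)[of j] m_def by auto
  qed
  define a where "a = length (filter (\<lambda>d. d \<noteq> 0) (map f [0..<j0]))"
  define b where "b = length (filter (\<lambda>d. d \<noteq> 0) (map f [j0..<m]))"
  have 1: "filter (\<lambda>d. d \<noteq> 0) (map f [0..<j0]) = replicate a 1"
    unfolding a_def
  proof (rule replicate_eqI)
    fix y assume "y \<in> set (filter (\<lambda>d. d \<noteq> 0) (map f [0..<j0]))"
    then obtain j where "j < j0" "y = f j" "f j \<noteq> 0" by auto
    thus "y = 1" using assms(1)[of j] j0 m_def by (auto simp: f_def)
  qed simp
  have 2: "filter (\<lambda>d. d \<noteq> 0) (map f [j0..<m]) = replicate b (-1)"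
    unfolding b_def
  proof (rule replicate_eqI)
    fix y assume "y \<in> set (filter (\<lambda>d. d \<noteq> 0) (map f [j0..<m]))"
    then obtain j where "j0 \<le> j" "j < m" "y = f j" "f j \<noteq> 0" by auto
    thus "y = -1" using assms(2)[of j] late m_def by (auto simp: f_def)
  qed simp
  have "[0..<m] = [0..<j0] @ [j0..<m]" using upt_add_eq_append[of 0 j0 "m - j0"] j0(1) by simp
  hence "moves \<rho> i = replicate a 1 @ replicate b (-1)"
    unfolding moves_def m_def[symmetric] f_def[symmetric, abs_def] using 1 2 by simp
  hence mv: "moves \<rho> i ! j = (if j < a then 1 else -1)" "length (moves \<rho> i) = a + b"
    if "j < length (moves \<rho> i)" for j using that by (simp_all add: nth_append)
  \<comment> \<open>For \<open>a = 0\<close> the set on the left is empty, so the truncated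
    \<open>a - 1\<close> does no harm.\<close>
  have "{j. Suc j < length (moves \<rho> i) \<and> moves \<rho> i ! j \<noteq> moves \<rho> i ! Suc j} \<subseteq> {a - 1}"
  proof
    fix j assume "j \<in> {j. Suc j < length (moves \<rho> i) \<and> moves \<rho> i ! j \<noteq> moves \<rho> i ! Suc j}"
    hence "Suc j < length (moves \<rho> i)" "moves \<rho> i ! j \<noteq> moves \<rho> i ! Suc j" by auto
    with mv(1)[of j] mv(1)[of "Suc j"] have "j < a" "\<not> Suc j < a"
      by (auto split: if_splits)
    thus "j \<in> {a - 1}" by simp
  qed
  hence "card {j. Suc j < length (moves \<rho> i) \<and> moves \<rho> i ! j \<noteq> moves \<rho> i ! Suc j} \<le> card {a - 1}"
    by (rule card_mono[rotated]) simp
  thus ?thesis unfolding rev_count_def by simp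
qed

section \<open>Machines that read only a bounded prefix\<close>

text \<open>As long as head 0 stays left of \<open>K\<close>, the machine cannot tell two such
  configurations apart.\<close>

definition agree :: "int \<Rightarrow> 'a config \<Rightarrow> 'a config \<Rightarrow> bool" where
  "agree K c c' \<longleftrightarrow> cstate c = cstate c' \<and> chead c = chead c' \<and>
     (\<forall>i p. i \<noteq> 0 \<or> p < K \<longrightarrow> ctape c i p = ctape c' i p)"

lemma agree_sym: "agree K c c' \<Longrightarrow> agree K c' c"
  by (auto simp: agree_def)

lemma agree_reads: "agree K c c' \<Longrightarrow> chead c 0 < K \<Longrightarrow> reads c = reads c'"
  by (auto simp: agree_def reads_def fun_eq_iff) (metis neq0_conv)

lemma agree_step:
  assumes "agree K c c'" "chead c 0 < K" "step M c d"
  shows "\<exists>d'. step M c' d' \<and> agree K d d'"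
proof -
  obtain q' ys ds where *: "(cstate c, map (reads c) [0..<ntapes M], q', ys, ds) \<in> delta M"
    "d = upd (ntapes M) q' ((!) ys) ((!) ds) c" using assms(3) unfolding step_upd by blast
  have "step M c' (upd (ntapes M) q' ((!) ys) ((!) ds) c')"
    using *(1) agree_reads[OF assms(1,2)] assms(1) unfolding step_upd agree_def by auto
  moreover have "agree K d (upd (ntapes M) q' ((!) ys) ((!) ds) c')"
    using assms(1) unfolding *(2) agree_def by (auto simp: upd_def)
  ultimately show ?thesis by blast
qed

lemma agree_final:
  assumes "agree K c c'" "chead c 0 < K"
  shows "final_config M c \<longleftrightarrow> final_config M c'"
  using agree_step[OF assms] agree_step[OF agree_sym[OF assms(1)], of M] assms
  unfolding final_config_def agree_def by metis

lemma relpowp_head: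
  assumes "wf_ntm M" "(step M ^^ j) c d"
  shows "chead d i \<le> chead c i + int j \<and> chead d i \<ge> chead c i - int j"
  using assms(2)
proof (induction j arbitrary: d)
  case (Suc j)
  then obtain y where "(step M ^^ j) c y" "step M y d" by auto
  thus ?case using Suc.IH[of y] step_head[OF assms(1), of y d i] by auto
qed auto

lemma agree_relpowp:
  assumes "wf_ntm M" "(step M ^^ j) c d" "agree K c c'" "chead c 0 + int j \<le> K"
  shows "\<exists>d'. (step M ^^ j) c' d' \<and> agree K d d'"
  using assms(2,4)
proof (induction j arbitrary: d)
  case 0
  thus ?case using assms(3) by auto
next
  case (Suc j)
  then obtain y where y: "(step M ^^ j) c y" "step M y d" by auto
  with Suc obtain y' where "(step M ^^ j) c' y'" "agree K y y'" by fastforce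
  moreover have "chead y 0 < K" using relpowp_head[OF assms(1) y(1), of 0] Suc(3) by simp
  ultimately show ?case using agree_step[of K y y' M d] y(2) by auto
qed

text \<open>A run on an input of length \<open>n\<close> stops before head 0 reaches cell
  \<open>n\<close>, so it does not notice whether the word goes on.\<close>

lemma short_time_prefix:
  assumes wf: "wf_ntm M" and dec: "decides M L"
    and T: "\<And>w \<rho>. finite_run M w \<rho> \<Longrightarrow> time \<rho> \<le> T (length w)" and n: "T n < n"
  shows "w \<in> L \<longleftrightarrow> take n w \<in> L"
proof (cases "length w < n")
  case False
  let ?v = "take n w"
  have ag: "agree (int n) (init_config M w) (init_config M ?v)"
    unfolding agree_def init_config_def word_tape_def using False by (auto simp: nat_less_iff)
  have noinf: "\<nexists>\<rho>. infinite_run M u \<rho>" for u using dec by (auto simp: decides_def)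
  have bound: "j \<le> T n" if "(step M ^^ j) (init_config M ?v) c" for j c
    by (rule relpowp_time[OF noinf _ that]) (use T[of ?v] False in auto)
  have hd0: "chead (init_config M u) i = 0" for u i by (simp add: init_config_def)
  show ?thesis
  proof
    assume "w \<in> L"
    then obtain j c where c: "(step M ^^ j) (init_config M w) c" "final_config M c" "cstate c \<in> accepting M"
      using decides_relpowp[OF dec] by blast
    \<comment> \<open>The time bound for \<open>w\<close> itself may exceed \<open>n\<close>.
      Instead, the first \<open>n\<close> steps of a longer run are copied to the prefix, whose runs
      have at most \<open>T n\<close> steps.\<close>
    have jn: "j < n"
    proof (rule ccontr)
      assume "\<not> j < n"
      then obtain k where "j = n + k" using le_Suc_ex by (metis not_le_imp_less)
      then obtain c1 where "(step M ^^ n) (init_config M w) c1"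
        using c(1) by (auto simp: relpowp_add)
      from agree_relpowp[OF wf this ag] bound n show False by (force simp: hd0)
    qed
    then obtain c' where c': "(step M ^^ j) (init_config M ?v) c'" "agree (int n) c c'"
      using agree_relpowp[OF wf c(1) ag] by (auto simp: hd0)
    moreover have "chead c 0 < int n" using relpowp_head[OF wf c(1), of 0] jn by (simp add: hd0)
    ultimately have "final_config M c'" "cstate c' \<in> accepting M"
      using agree_final[of "int n" c c' M] c by (auto simp: agree_def)
    thus "?v \<in> L" using decides_relpowp[OF dec] c'(1) by blast
  next
    assume "?v \<in> L"
    then obtain j c where c: "(step M ^^ j) (init_config M ?v) c" "final_config M c" "cstate c \<in> accepting M"
      using decides_relpowp[OF dec] by blast
    have jn: "j < n" using bound[OF c(1)] n by simp
    then obtain c' where c': "(step M ^^ j) (init_config M w) c'" "agree (int n) c c'"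
      using agree_relpowp[OF wf c(1) agree_sym[OF ag]] by (auto simp: hd0)
    moreover have "chead c 0 < int n" using relpowp_head[OF wf c(1), of 0] jn by (simp add: hd0)
    ultimately have "final_config M c'" "cstate c' \<in> accepting M"
      using agree_final[of "int n" c c' M] c by (auto simp: agree_def)
    thus "w \<in> L" using decides_relpowp[OF dec] c'(1) by blast
  qed
qed auto

text \<open>Membership of the finitely many words of length at most \<open>n\<close> is wired into
  the transition table. The flag marks acceptance; on a prefix outside \<open>L\<close> the machine
  gets stuck, which rejects.\<close>

definition prefix_tr :: "nat \<Rightarrow> 'a list set \<Rightarrow> 'a list \<times> bool \<Rightarrow> (nat \<Rightarrow> 'a sym) \<Rightarrow> 'a list \<times> bool \<Rightarrow>
    (nat \<Rightarrow> 'a sym) \<Rightarrow> (nat \<Rightarrow> int) \<Rightarrow> bool" where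
  "prefix_tr n L q x q' y d \<longleftrightarrow> y = x \<and> \<not> snd q \<and>
     ((\<exists>a. x 0 = Inp a \<and> length (fst q) < n \<and> q' = (fst q @ [a], False) \<and> d = (\<lambda>i. if i = 0 then 1 else 0)) \<or>
      ((x 0 = Blank \<or> length (fst q) = n) \<and> fst q \<in> L \<and> q' = (fst q, True) \<and> d = (\<lambda>_. 0)))"

text \<open>Both tapes are external, the second only because the class asks for two; hence the
  internal space is 0.\<close>

definition prefix_ntm :: "nat \<Rightarrow> 'a::finite list set \<Rightarrow> 'a ntm" where
  "prefix_ntm n L = make_ntm 2 ({u. length u \<le> n} \<times> UNIV) (insert Blank (range Inp)) ([], False)
     ({u. length u \<le> n} \<times> {True}) (prefix_tr n L)"

lemma finite_lists_le: "finite {u :: 'a::finite list. length u \<le> n}"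
  using finite_lists_length_le[of "UNIV :: 'a set" n] by simp

lemma wf_prefix_ntm: "wf_ntm (prefix_ntm n L)"
  unfolding prefix_ntm_def by (rule wf_make_ntm) (auto simp: finite_lists_le)

definition prefix_cfg :: "'a::finite list \<Rightarrow> nat \<Rightarrow> bool \<Rightarrow> 'a config" where
  "prefix_cfg w j b = \<lparr>cstate = to_nat (take j w, b), chead = (\<lambda>i. if i = 0 then int j else 0),
     ctape = (\<lambda>i. if i = 0 then word_tape w else (\<lambda>_. Blank))\<rparr>"

lemma prefix_step:
  assumes "j \<le> length w" "j \<le> n"
  shows "step (prefix_ntm n L) (prefix_cfg w j b) c' \<longleftrightarrow>
    \<not> b \<and> (j < length w \<and> j < n \<and> c' = prefix_cfg w (Suc j) False \<or>
           (j = length w \<or> j = n) \<and> take j w \<in> L \<and> c' = prefix_cfg w j True)"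
proof -
  have rd0: "reads (prefix_cfg w j b) 0 = (if j < length w then Inp (w ! j) else Blank)"
    by (simp add: reads_def prefix_cfg_def word_tape_def)
  have rd: "reads (prefix_cfg w j b) i \<in> insert Blank (range Inp)" for i
    by (auto simp: reads_def prefix_cfg_def word_tape_def)
  have mv: "upd 2 (to_nat (take (Suc j) w, False)) (rd 2 (prefix_cfg w j b)) (\<lambda>i. if i = 0 then 1 else 0)
     (prefix_cfg w j b) = prefix_cfg w (Suc j) False"
    by (auto simp: upd_def prefix_cfg_def rd_def reads_def fun_eq_iff)
  have st: "upd 2 (to_nat (take j w, True)) (rd 2 (prefix_cfg w j b)) (\<lambda>_. 0)
     (prefix_cfg w j b) = prefix_cfg w j True"
    by (auto simp: upd_def prefix_cfg_def rd_def reads_def fun_eq_iff)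
  have cs: "cstate (prefix_cfg w j b) = to_nat (take j w, b)" by (simp add: prefix_cfg_def)
  show ?thesis
  proof
    assume "step (prefix_ntm n L) (prefix_cfg w j b) c'"
    from step_make_ntmE[OF this[unfolded prefix_ntm_def] cs] obtain q' y d where
      "prefix_tr n L (take j w, b) (rd 2 (prefix_cfg w j b)) q' y d"
      "c' = upd 2 (to_nat q') y d (prefix_cfg w j b)" by metis
    thus "\<not> b \<and> (j < length w \<and> j < n \<and> c' = prefix_cfg w (Suc j) False \<or>
           (j = length w \<or> j = n) \<and> take j w \<in> L \<and> c' = prefix_cfg w j True)"
      using assms unfolding prefix_tr_def
      by (auto simp: mv[symmetric] st[symmetric] rd_def[of 2 _ 0] rd0 take_Suc_conv_app_nth split: if_splits)
  next
    assume R: "\<not> b \<and> (j < length w \<and> j < n \<and> c' = prefix_cfg w (Suc j) False \<or>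
           (j = length w \<or> j = n) \<and> take j w \<in> L \<and> c' = prefix_cfg w j True)"
    have rdS: "\<forall>i<2. rd 2 (prefix_cfg w j b) i \<in> insert Blank (range Inp)" using rd by (auto simp: rd_def)
    from R consider "j < length w" "j < n" "\<not> b" "c' = prefix_cfg w (Suc j) False" |
      "j = length w \<or> j = n" "take j w \<in> L" "c' = prefix_cfg w j True" "\<not> b" by blast
    thus "step (prefix_ntm n L) (prefix_cfg w j b) c'"
    proof cases
      case 1
      have tr: "prefix_tr n L (take j w, b) (rd 2 (prefix_cfg w j b)) (take (Suc j) w, False)
          (rd 2 (prefix_cfg w j b)) (\<lambda>i. if i = 0 then 1 else 0)"
        using 1 rd0 unfolding prefix_tr_def by (simp add: rd_def take_Suc_conv_app_nth)
      show ?thesis unfolding prefix_ntm_def 1(4)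
        by (rule step_make_ntmI[where tr = "prefix_tr n L", OF cs _ _ _ _ tr mv[symmetric]]) (use assms 1 rdS rd in auto)
    next
      case 2
      have tr: "prefix_tr n L (take j w, b) (rd 2 (prefix_cfg w j b)) (take j w, True)
          (rd 2 (prefix_cfg w j b)) (\<lambda>_. 0)"
        using 2 assms rd0 unfolding prefix_tr_def by (auto simp: rd_def)
      show ?thesis unfolding prefix_ntm_def 2(3)
        by (rule step_make_ntmI[where tr = "prefix_tr n L", OF cs _ _ _ _ tr st[symmetric]]) (use assms rdS rd in auto)
    qed
  qed
qed

lemma prefix_init: "init_config (prefix_ntm n L) w = prefix_cfg w 0 False"
  by (simp add: init_config_def prefix_cfg_def prefix_ntm_def) (rule ext, simp)

lemma prefix_in_NST:
  fixes L :: "'a::finite list set"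
  assumes L: "\<And>w. w \<in> L \<longleftrightarrow> take n w \<in> L"
  shows "L \<in> NST (\<lambda>_. 3) (\<lambda>_. 0) 2"
proof -
  let ?M = "prefix_ntm n L"
  \<comment> \<open>The rank drops by 2 with each letter and by 1 with the accepting step. The last
    conjunct carries soundness.\<close>
  define Inv where "Inv w m c \<longleftrightarrow> (\<exists>j b. j \<le> length w \<and> j \<le> n \<and> c = prefix_cfg w j b \<and>
     m = 2 * n - 2 * j + (if b then 0 else 1) \<and> (b \<longrightarrow> take n w \<in> L))" for w :: "'a list" and m :: nat and c
  have I0: "Inv w (2 * n + 1) (init_config ?M w)" for w
    unfolding Inv_def prefix_init by (rule exI[of _ 0], rule exI[of _ False]) auto
  have IS: "\<exists>m'. Inv w m' c' \<and> (m', m) \<in> less_than" if "Inv w m c" "step ?M c c'" for w m c c'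
  proof -
    from that(1) obtain j b where jb: "j \<le> length w" "j \<le> n" "c = prefix_cfg w j b"
      "m = 2 * n - 2 * j + (if b then 0 else 1)" unfolding Inv_def by blast
    have "\<not> b \<and> (j < length w \<and> j < n \<and> c' = prefix_cfg w (Suc j) False \<or>
           (j = length w \<or> j = n) \<and> take j w \<in> L \<and> c' = prefix_cfg w j True)"
      using that(2) prefix_step[OF jb(1,2), of L b c'] unfolding jb(3) by blast
    then consider "\<not> b" "j < length w" "j < n" "c' = prefix_cfg w (Suc j) False" |
      "\<not> b" "j = length w \<or> j = n" "take j w \<in> L" "c' = prefix_cfg w j True" by blast
    thus ?thesis
    proof cases
      case 1
      hence "Inv w (2 * n - 2 * Suc j + 1) c'"
        unfolding Inv_def by (intro exI[of _ "Suc j"] exI[of _ False]) auto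
      thus ?thesis using 1 jb by (intro exI[of _ "2 * n - 2 * Suc j + 1"]) auto
    next
      case 2
      hence "take n w = take j w" using jb(2) by auto
      hence "Inv w (2 * n - 2 * j) c'" using 2 jb(1,2)
        unfolding Inv_def by (intro exI[of _ j] exI[of _ True]) auto
      thus ?thesis using 2 jb by (intro exI[of _ "2 * n - 2 * j"]) auto
    qed
  qed
  have noinf: "\<not> infinite_run ?M w \<rho>" for w \<rho>
    by (rule no_infinite_run[OF wf_less_than, where Inv = "Inv w"]) (use I0 IS in blast)+
  have inv: "\<exists>m. Inv w m c" if "finite_run ?M w \<rho>" "c \<in> set \<rho>" for w \<rho> c
    by (rule finite_run_inv[OF that(1) _ _ that(2), where Inv = "Inv w"]) (use I0 IS in blast)+
  have rev: "rev_count \<rho> i \<le> 1" if r: "finite_run ?M w \<rho>" for w \<rho> i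
  proof (rule rev_count_le_1[where G = "\<lambda>_. True"])
    fix j assume j: "Suc j < length \<rho>"
    have "step ?M (\<rho> ! j) (\<rho> ! Suc j)" using r j unfolding finite_run_def successively_nth by blast
    moreover obtain m where "Inv w m (\<rho> ! j)" using inv[OF r] j by (meson Suc_lessD nth_mem)
    ultimately show "chead (\<rho> ! Suc j) i - chead (\<rho> ! j) i \<in> {0, 1}"
      unfolding Inv_def using prefix_step[of _ w n L] by (auto simp: prefix_cfg_def)
  qed auto
  have reach: "(step ?M)\<^sup>*\<^sup>* (init_config ?M w) (prefix_cfg w j False)" if "j \<le> length w" "j \<le> n" for w j
    using that
  proof (induction j)
    case (Suc j)
    hence "step ?M (prefix_cfg w j False) (prefix_cfg w (Suc j) False)" by (subst prefix_step) auto
    thus ?case using Suc by (meson Suc_leD rtranclp.rtrancl_into_rtrancl)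
  qed (simp add: prefix_init)
  have acc: "w \<in> L \<longleftrightarrow> (\<exists>\<rho>. finite_run ?M w \<rho> \<and> cstate (last \<rho>) \<in> accepting ?M)" for w
  proof
    assume "w \<in> L"
    let ?j = "min (length w) n"
    have w: "take ?j w \<in> L" using L[of w] \<open>w \<in> L\<close> by (simp add: min_def)
    have j: "?j \<le> length w" "?j \<le> n" by auto
    have "step ?M (prefix_cfg w ?j False) (prefix_cfg w ?j True)"
      using w by (subst prefix_step[OF j]) (auto simp: min_def)
    hence "(step ?M)\<^sup>*\<^sup>* (init_config ?M w) (prefix_cfg w ?j True)" using reach[OF j] by auto
    moreover have "final_config ?M (prefix_cfg w ?j True)"
      unfolding final_config_def prefix_step[OF j] by simp
    moreover have "cstate (prefix_cfg w ?j True) \<in> accepting ?M"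
      by (auto simp: prefix_cfg_def prefix_ntm_def)
    ultimately show "\<exists>\<rho>. finite_run ?M w \<rho> \<and> cstate (last \<rho>) \<in> accepting ?M"
      using finite_run_reach[of ?M w "\<lambda>c. cstate c \<in> accepting ?M"] by blast
  next
    assume "\<exists>\<rho>. finite_run ?M w \<rho> \<and> cstate (last \<rho>) \<in> accepting ?M"
    then obtain \<rho> where \<rho>: "finite_run ?M w \<rho>" "cstate (last \<rho>) \<in> accepting ?M" by blast
    then obtain m where "Inv w m (last \<rho>)" using inv[OF \<rho>(1), of "last \<rho>"] by (auto simp: finite_run_def)
    then obtain j b where "last \<rho> = prefix_cfg w j b" "b \<longrightarrow> take n w \<in> L" unfolding Inv_def by blast
    with \<rho>(2) have "take n w \<in> L" by (auto simp: prefix_cfg_def prefix_ntm_def)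
    thus "w \<in> L" using L[of w] by blast
  qed
  have "rst_bounded (\<lambda>_. 3) (\<lambda>_. 0) 2 ?M"
    unfolding rst_bounded_def
  proof (intro conjI allI impI)
    show "2 \<le> ntapes ?M" by (simp add: prefix_ntm_def)
    show "\<nexists>\<rho>. infinite_run ?M w \<rho>" for w using noinf by blast
    fix w \<rho> assume r: "finite_run ?M w \<rho>"
    show "1 + (\<Sum>i<2. rev_count \<rho> i) \<le> 3" using rev[OF r, of 0] rev[OF r, of 1]
      by (simp add: numeral_2_eq_2)
    show "(\<Sum>i=2..<ntapes ?M. space \<rho> i) \<le> 0" by (simp add: prefix_ntm_def)
  qed
  moreover have "decides ?M L" using noinf acc unfolding decides_def by blast
  ultimately show ?thesis using wf_prefix_ntm unfolding NST_def by blast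
qed

section \<open>The simulating machine\<close>

instance sym :: (countable) countable by countable_datatype

text \<open>
  \<open>Col\<close> is a cell of a row: the symbols of all tapes of \<open>M\<close> at one position, each with a flag
  for the presence of the head. \<open>Del\<close> ends a row with the state and the scanned symbols. \<open>Dig\<close> holds
  one digit of each of the two numbers \<open>A\<close> and \<open>B\<close> on the counter tape, least significant
  digit in cell 0.
\<close>

datatype 'a work_sym = Col "('a sym \<times> bool) list" | Del nat "'a sym list" | Dig int int | Wrk "unit sym"
instance work_sym :: (countable) countable by countable_datatype

datatype phase = P1 bool | P2 nat | P3
instance phase :: countable by countable_datatype

text \<open>
  \<open>Swp p ca cb app z e\<close> runs to the right over the counter tape and adds the carries \<open>ca\<close> and \<open>cb\<close>
  (possibly \<open>- 1\<close>) to the two numbers; \<open>app\<close> requests a new cell at the end, \<open>z\<close> and \<open>e\<close> tell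
  whether the digits of \<open>B\<close> seen so far are 0, respectively equal to those of \<open>A\<close>. \<open>Ret\<close> goes back to
  cell 0, where \<open>Main\<close> performs the next step of the phase.
  In phase \<open>P2\<close>, \<open>A\<close> is \<open>n + 1\<close> and \<open>B\<close> is the position of the virtual input head plus 1, so
  that \<open>z\<close> and \<open>e\<close> recognise the two end markers.
\<close>

datatype 'a st = Main phase bool bool | Swp phase int int bool bool bool | Ret phase bool bool
  | Skip0 | Skip "'a sym list" | Cmp0
  | Cmp "'a sym list" "'a sym list" "int list" "('a sym \<times> bool) list" "('a sym \<times> bool) list"
  | Cmp1 "'a sym list" "int list" "('a sym \<times> bool) list" | Acc
instance st :: (countable) countable by countable_datatype

definition W :: "'a::countable work_sym \<Rightarrow> 'a sym" where "W x = Aux (to_nat x)"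

lemma W_simps [simp]: "W x = W y \<longleftrightarrow> x = y" "W x \<noteq> Blank" "Blank \<noteq> W x" "W x \<noteq> Inp a" "Inp a \<noteq> W x"
  by (auto simp: W_def)

text \<open>\<open>Blank\<close> has to stay \<open>Blank\<close>, since the fresh cells of the
  constructor's work tapes are blank cells of the simulator too. The constructor's
  \<open>Inp ()\<close> becomes an ordinary work symbol.\<close>

definition emb :: "unit sym \<Rightarrow> 'a::countable sym" where
  "emb s = (if s = Blank then Blank else W (Wrk s))"

lemma emb_inj [simp]: "emb s = emb s' \<longleftrightarrow> s = s'"
  by (auto simp: emb_def)

lemma emb_Blank [simp]: "emb Blank = Blank" by (simp add: emb_def)

section \<open>Positional notation, least significant digit first\<close>

fun val :: "int \<Rightarrow> int list \<Rightarrow> int" where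
  "val B [] = 0" | "val B (d # ds) = d + B * val B ds"

lemma val_update: "i < length ds \<Longrightarrow> val B (ds[i := d]) = val B ds + (d - ds ! i) * B ^ i"
proof (induction ds arbitrary: i)
  case (Cons a ds)
  show ?case
  proof (cases i)
    case (Suc j)
    hence "val B (ds[j := d]) = val B ds + (d - ds ! j) * B ^ j" using Cons by simp
    thus ?thesis by (simp only: Suc list_update_code val.simps nth_Cons_Suc power_Suc) (simp only: algebra_simps)
  qed (simp add: algebra_simps)
qed simp

lemma val_append: "val B (ds @ [d]) = val B ds + d * B ^ length ds"
  by (induction ds) (auto simp: algebra_simps)

lemma val_bounds:
  assumes "set ds \<subseteq> {0..<B}"
  shows "0 \<le> val B ds \<and> val B ds < B ^ length ds"
  using assms
proof (induction ds)
  case (Cons a ds)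
  have "B * (val B ds + 1) \<le> B * B ^ length ds" using Cons by (intro mult_left_mono) auto
  thus ?case using Cons by (auto simp: algebra_simps)
qed simp

text \<open>Reduction modulo \<open>B\<close> recovers the lowest digit. Uniqueness of the digits is
  what allows numbers to be compared digit by digit.\<close>

lemma val_inj:
  assumes "length ds = length es" "set ds \<subseteq> {0..<B}" "set es \<subseteq> {0..<B}" "val B ds = val B es"
  shows "ds = es"
  using assms
proof (induction ds es rule: list_induct2)
  case (Cons x xs y ys)
  have "x = (x + B * val B xs) mod B" "y = (y + B * val B ys) mod B" using Cons.prems(1,2) by auto
  hence "x = y" using Cons.prems(3) by (metis val.simps(2))
  thus ?case using Cons by auto
qed simp

lemma val_replicate_0: "val B (replicate k 0) = 0" by (induction k) auto

definition digit_tape :: "(int \<times> int) list \<Rightarrow> int \<Rightarrow> 'a::countable sym" where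
  "digit_tape u p = (if 0 \<le> p \<and> p < int (length u) then W (Dig (fst (u ! nat p)) (snd (u ! nat p))) else Blank)"

lemma digit_tape_update:
  assumes "k < length u"
  shows "(digit_tape u)(int k := W (Dig a b)) = digit_tape (u[k := (a, b)])"
  using assms by (auto simp: digit_tape_def fun_eq_iff nth_list_update)

lemma digit_tape_append: "(digit_tape u)(int (length u) := W (Dig a b)) = digit_tape (u @ [(a, b)])"
  by (auto simp: digit_tape_def fun_eq_iff nth_append)

lemma digit_tape_Nil: "digit_tape [] = (\<lambda>_. Blank)" by (auto simp: digit_tape_def)

locale sim =
  fixes M :: "'a::finite ntm" and Mt :: "unit ntm" and B :: int
  assumes wfM: "wf_ntm M" and wfT: "wf_ntm Mt" and detT: "deterministic Mt"
    and kt: "2 \<le> ntapes Mt" and ro: "read_only Mt 0" and out: "output_tape Mt 1" and B: "2 \<le> B"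
begin

abbreviation kM where "kM \<equiv> ntapes M"
abbreviation kT where "kT \<equiv> ntapes Mt"
abbreviation N where "N \<equiv> Suc kT"

definition bl :: "('a sym \<times> bool) list" where "bl = replicate kM (Blank, False)"

text \<open>Locality of a step: the new cell at \<open>p\<close> depends on the cells at
  \<open>p + 1\<close>, \<open>p\<close> and \<open>p - 1\<close>, called \<open>a\<close>,
  \<open>b\<close> and \<open>c\<close> in the order in which a head going left meets them. Hence a
  head arriving from \<open>a\<close> has moved by \<open>- 1\<close>.\<close>

definition nxt :: "'a sym list \<Rightarrow> int list \<Rightarrow> ('a sym \<times> bool) list \<Rightarrow> ('a sym \<times> bool) list \<Rightarrow>
    ('a sym \<times> bool) list \<Rightarrow> ('a sym \<times> bool) list" where
  "nxt ys ds a b c = map (\<lambda>i. (if snd (b ! i) then ys ! i else fst (b ! i),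
     snd (a ! i) \<and> ds ! i = -1 \<or> snd (b ! i) \<and> ds ! i = 0 \<or> snd (c ! i) \<and> ds ! i = 1)) [0..<kM]"

text \<open>Confirms the guess \<open>xs\<close> of the scanned symbols at a cell that carries
  heads.\<close>

definition okc :: "'a sym list \<Rightarrow> ('a sym \<times> bool) list \<Rightarrow> bool" where
  "okc xs c \<longleftrightarrow> (\<forall>i<kM. snd (c ! i) \<longrightarrow> fst (c ! i) = xs ! i)"

text \<open>All heads start in cell 0, so one flag serves all tapes.\<close>

definition col0 :: "bool \<Rightarrow> 'a sym \<Rightarrow> ('a sym \<times> bool) list" where
  "col0 f s = map (\<lambda>i. (if i = 0 then s else Blank, f)) [0..<kM]"

definition isCol :: "'a sym \<Rightarrow> bool" where "isCol x \<longleftrightarrow> (\<exists>c. x = W (Col c))"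
definition isDel :: "'a sym \<Rightarrow> bool" where "isDel x \<longleftrightarrow> (\<exists>q xs. x = W (Del q xs))"

text \<open>What the constructor reads. The input symbol follows from the two end marker tests. The
  output tape is not kept and is taken to be blank, since by \<open>output_tape\<close> its content
  has no influence. Work tape \<open>i\<close> of the constructor is tape \<open>Suc i\<close> here,
  because tape 2 is the counter.\<close>

definition rdt :: "bool \<Rightarrow> bool \<Rightarrow> (nat \<Rightarrow> 'a sym) \<Rightarrow> unit sym list \<Rightarrow> bool" where
  "rdt z e x xs \<longleftrightarrow> length xs = kT \<and> xs ! 0 = (if z \<or> e then Blank else Inp ()) \<and> xs ! 1 = Blank \<and>
     (\<forall>i. 2 \<le> i \<and> i < kT \<longrightarrow> x (Suc i) = emb (xs ! i))"

definition mv2 :: "int \<Rightarrow> nat \<Rightarrow> int" where "mv2 d i = (if i < 2 then d else 0)"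
definition mv :: "nat \<Rightarrow> int \<Rightarrow> nat \<Rightarrow> int" where "mv j d i = (if i = j then d else 0)"

text \<open>\<open>P1_end\<close> adds a column for the blank cell \<open>n\<close>, so that the
  first row is nonempty even for the empty word. The scanned symbols in its delimiter are guessed in
  \<open>P2_end\<close>. \<open>P3_end\<close> is available at any time, whereas
  \<open>Swp_end\<close> refuses a carry of \<open>A\<close> in phase \<open>P3\<close> unless a new
  cell was requested: this is the overflow that stops the guessing. \<open>Cmp_e1\<close> and
  \<open>Cmp_e2\<close> check the two columns by which the later row exceeds the earlier one, when
  the latter is used up. Outside \<open>Acc\<close>, a missing rule means rejection.\<close>

inductive tr :: "'a st \<Rightarrow> (nat \<Rightarrow> 'a sym) \<Rightarrow> 'a st \<Rightarrow> (nat \<Rightarrow> 'a sym) \<Rightarrow> (nat \<Rightarrow> int) \<Rightarrow> bool" where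
  P1_inp: "x 0 = Inp a \<Longrightarrow>
    tr (Main (P1 f) z e) x (Swp (P1 False) 1 0 False True True) (x(1 := W (Col (col0 f (Inp a))))) (mv2 1)"
| P1_end: "x 0 = Blank \<Longrightarrow>
    tr (Main (P1 f) z e) x (Swp (P2 (start Mt)) 1 1 True True True) (x(1 := W (Col (col0 f Blank)))) (mv2 1)"
| P2_step: "rdt z e x xs \<Longrightarrow> (q, xs, q', ys, ds) \<in> delta Mt \<Longrightarrow>
    tr (Main (P2 q) z e) x (Swp (P2 q') 0 (ds ! 0) (ys ! 1 = Inp () \<and> ds ! 1 = 1) True True)
      (\<lambda>i. if 3 \<le> i then emb (ys ! (i - 1)) else x i) (\<lambda>i. if 3 \<le> i then ds ! (i - 1) else 0)"
| P2_end: "\<nexists>xs q' ys ds. rdt z e x xs \<and> (q, xs, q', ys, ds) \<in> delta Mt \<Longrightarrow>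
    tr (Main (P2 q) z e) x (Swp P3 0 0 True True True)
      (x(0 := W (Del (start M) xs), 1 := W (Del (start M) xs))) (mv2 1)"
| P3_guess: "isCol s \<or> isDel s \<Longrightarrow>
    tr (Main P3 z e) x (Swp P3 1 0 False True True) (x(0 := s, 1 := s)) (mv2 1)"
| P3_end: "tr (Main P3 z e) x Skip0 x (mv2 (-1))"
| Swp_dig: "x 2 = W (Dig a b) \<Longrightarrow>
    tr (Swp p ca cb app z e) x
       (Swp p ((a + ca) div B) ((b + cb) div B) app (z \<and> (b + cb) mod B = 0) (e \<and> (a + ca) mod B = (b + cb) mod B))
       (x(2 := W (Dig ((a + ca) mod B) ((b + cb) mod B)))) (mv 2 1)"
| Swp_end: "x 2 = Blank \<Longrightarrow> \<not> (p = P3 \<and> ca \<noteq> 0 \<and> \<not> app) \<Longrightarrow>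
    tr (Swp p ca cb app z e) x (Ret p (z \<and> cb = 0) (e \<and> ca = cb))
       (x(2 := if ca \<noteq> 0 \<or> app then W (Dig ca cb) else Blank)) (mv 2 (-1))"
| Ret_dig: "x 2 \<noteq> Blank \<Longrightarrow> tr (Ret p z e) x (Ret p z e) x (mv 2 (-1))"
| Ret_end: "x 2 = Blank \<Longrightarrow> tr (Ret p z e) x (Main p z e) x (mv 2 1)"
| Skip0: "x 1 = W (Del q xs) \<Longrightarrow> length xs = kM \<Longrightarrow> q \<in> accepting M \<Longrightarrow> \<nexists>q' ys ds. (q, xs, q', ys, ds) \<in> delta M \<Longrightarrow>
    tr Skip0 x (Skip xs) x (mv 1 (-1))"
| Skip_col: "x 1 = W (Col c) \<Longrightarrow> okc xs c \<Longrightarrow> tr (Skip xs) x (Skip xs) x (mv 1 (-1))"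
| Skip_end: "\<not> isCol (x 1) \<Longrightarrow> tr (Skip xs) x Cmp0 x (\<lambda>_. 0)"
| Cmp_start: "x 0 = W (Del q' xs') \<Longrightarrow> x 1 = W (Del q xs) \<Longrightarrow> (q, xs, q', ys, ds) \<in> delta M \<Longrightarrow>
    tr Cmp0 x (Cmp xs ys ds bl bl) x (mv2 (-1))"
| Cmp_acc: "isDel (x 0) \<Longrightarrow> x 1 = Blank \<Longrightarrow> tr Cmp0 x Acc x (\<lambda>_. 0)"
| Cmp_col: "x 0 = W (Col (nxt ys ds a b c)) \<Longrightarrow> x 1 = W (Col c) \<Longrightarrow> okc xs c \<Longrightarrow>
    tr (Cmp xs ys ds a b) x (Cmp xs ys ds b c) x (mv2 (-1))"
| Cmp_e1: "x 0 = W (Col (nxt ys ds a b bl)) \<Longrightarrow> \<not> isCol (x 1) \<Longrightarrow>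
    tr (Cmp xs ys ds a b) x (Cmp1 ys ds b) x (mv 0 (-1))"
| Cmp_e2: "x 0 = W (Col (nxt ys ds b bl bl)) \<Longrightarrow> tr (Cmp1 ys ds b) x Cmp0 x (mv 0 (-1))"

inductive_cases MainP1E [consumes 1, case_names Inp End]: "tr (Main (P1 f) z e) x q y d"
inductive_cases MainP2E [consumes 1, case_names Step End]: "tr (Main (P2 q0) z e) x q y d"
inductive_cases MainP3E [consumes 1, case_names Guess End]: "tr (Main P3 z e) x q y d"
inductive_cases SwpE [consumes 1, case_names Dig End]: "tr (Swp p ca cb app z e) x q y d"
inductive_cases RetE [consumes 1, case_names Dig End]: "tr (Ret p z e) x q y d"
inductive_cases Skip0E [consumes 1, case_names Del]: "tr Skip0 x q y d"
inductive_cases SkipE [consumes 1, case_names Col End]: "tr (Skip xs) x q y d"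
inductive_cases Cmp0E [consumes 1, case_names Start Acc]: "tr Cmp0 x q y d"
inductive_cases CmpE [consumes 1, case_names Col End]: "tr (Cmp xs ys ds a b) x q y d"
inductive_cases Cmp1E [consumes 1, case_names Col]: "tr (Cmp1 ys ds b) x q y d"
inductive_cases AccE: "tr Acc x q y d"

definition Cols where "Cols = {c :: ('a sym \<times> bool) list. set c \<subseteq> alphabet M \<times> UNIV \<and> length c = kM}"
definition Rds where "Rds = {xs. set xs \<subseteq> alphabet M \<and> length xs = kM}"
definition Dirs where "Dirs = {ds :: int list. set ds \<subseteq> {-1, 0, 1} \<and> length ds = kM}"
definition phases where "phases = insert (P1 True) (insert (P1 False) (insert P3 (P2 ` states Mt)))"

definition Q :: "'a st set" where
  "Q = (\<lambda>(p, z, e). Main p z e) ` (phases \<times> UNIV \<times> UNIV)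
    \<union> (\<lambda>(p, ca, cb, app, z, e). Swp p ca cb app z e) ` (phases \<times> {-1, 0, 1} \<times> {-1, 0, 1} \<times> UNIV \<times> UNIV \<times> UNIV)
    \<union> (\<lambda>(p, z, e). Ret p z e) ` (phases \<times> UNIV \<times> UNIV)
    \<union> {Skip0, Cmp0, Acc} \<union> Skip ` Rds
    \<union> (\<lambda>(xs, ys, ds, a, b). Cmp xs ys ds a b) ` (Rds \<times> Rds \<times> Dirs \<times> Cols \<times> Cols)
    \<union> (\<lambda>(ys, ds, b). Cmp1 ys ds b) ` (Rds \<times> Dirs \<times> Cols)"

definition \<Sigma> :: "'a sym set" where
  "\<Sigma> = insert Blank (range Inp) \<union> (\<lambda>c. W (Col c)) ` Cols \<union> (\<lambda>(q, xs). W (Del q xs)) ` (states M \<times> Rds)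
    \<union> (\<lambda>(a, b). W (Dig a b)) ` ({0..<B} \<times> {0..<B}) \<union> emb ` alphabet Mt"

definition sim_ntm :: "'a ntm" where "sim_ntm = make_ntm N Q \<Sigma> (Main (P1 True) True True) {Acc} tr"

lemma finite_wf: "finite (alphabet M)" "finite (states M)" "finite (alphabet Mt)" "finite (states Mt)"
  using wfM wfT by (auto simp: wf_ntm_def)

lemma finite_parts: "finite Cols" "finite Rds" "finite Dirs" "finite phases"
  unfolding Cols_def Rds_def Dirs_def phases_def
  by (intro finite_lists_length_eq finite_cartesian_product finite_insert[THEN iffD2] finite_imageI
      finite_wf finite finite.emptyI)+

lemma finite_Q: "finite Q" and finite_\<Sigma>: "finite \<Sigma>"
  unfolding Q_def \<Sigma>_def
  by (intro finite_UnI finite_imageI finite_cartesian_product finite_parts finite_wf finite_insert[THEN iffD2]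
     finite finite.emptyI finite_atLeastLessThan_int)+

lemma wf_sim_ntm: "wf_ntm sim_ntm"
  unfolding sim_ntm_def by (rule wf_make_ntm) (use finite_Q finite_\<Sigma> in \<open>auto simp: Q_def \<Sigma>_def phases_def image_iff\<close>)

lemma sim_ntm_simps [simp]: "ntapes sim_ntm = N" "accepting sim_ntm = {to_nat (Acc :: 'a st)}"
  "start sim_ntm = to_nat (Main (P1 True) True True :: 'a st)"
  by (auto simp: sim_ntm_def)

lemma stepE:
  assumes "step sim_ntm c c'" "cstate c = to_nat (q :: 'a st)"
  obtains q' y d where "q' \<in> Q" "tr q (rd N c) q' y d" "c' = upd N (to_nat q') y d c"
  using step_make_ntmE[OF assms(1)[unfolded sim_ntm_def] assms(2)] by metis

lemma stepI:
  assumes "cstate c = to_nat q" "\<forall>i<N. reads c i \<in> \<Sigma>" "q \<in> Q" "q' \<in> Q"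
    "\<forall>i<N. y i \<in> \<Sigma> \<and> d i \<in> {-1, 0, 1}" "tr q (rd N c) q' y d"
  shows "step sim_ntm c (upd N (to_nat q') y d c)"
  unfolding sim_ntm_def by (rule step_make_ntmI[where tr = tr, OF assms refl])

lemma rd_less [simp]: "i < N \<Longrightarrow> rd N c i = ctape c i (chead c i)"
  by (simp add: rd_def reads_def)

lemma kT_gt [simp]: "Suc 0 < kT" "0 < kT" "2 \<le> kT" using kt by auto

section \<open>Sweeps of the counter tape\<close>

definition same_rest :: "'a config \<Rightarrow> 'a config \<Rightarrow> bool" where
  "same_rest c c' \<longleftrightarrow> (\<forall>i. i \<noteq> 2 \<longrightarrow> chead c' i = chead c i \<and> ctape c' i = ctape c i)"

lemma same_rest_refl [simp]: "same_rest c c" by (simp add: same_rest_def)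

lemma same_rest_trans: "same_rest c c' \<Longrightarrow> same_rest c' c'' \<Longrightarrow> same_rest c c''" by (simp add: same_rest_def)

definition digits :: "(int \<times> int) list \<Rightarrow> bool" where "digits u \<longleftrightarrow> set u \<subseteq> {0..<B} \<times> {0..<B}"
definition valA :: "(int \<times> int) list \<Rightarrow> int" where "valA u = val B (map fst u)"
definition valB :: "(int \<times> int) list \<Rightarrow> int" where "valB u = val B (map snd u)"

lemma digitsD: "digits u \<Longrightarrow> set (map fst u) \<subseteq> {0..<B}" "digits u \<Longrightarrow> set (map snd u) \<subseteq> {0..<B}"
  by (auto simp: digits_def)

lemma valA_bounds: "digits u \<Longrightarrow> 0 \<le> valA u" "digits u \<Longrightarrow> valA u < B ^ length u"
  using val_bounds[OF digitsD(1), of u] by (auto simp: valA_def)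

lemma valB_bounds: "digits u \<Longrightarrow> 0 \<le> valB u" "digits u \<Longrightarrow> valB u < B ^ length u"
  using val_bounds[OF digitsD(2), of u] by (auto simp: valB_def)

text \<open>Uniqueness of the digits turns the test for 0 into a conjunction that a sweep can
  evaluate with one bit; the next lemma does the same for equality.\<close>

lemma valB_0_iff: assumes "digits u" shows "valB u = 0 \<longleftrightarrow> (\<forall>i<length u. snd (u ! i) = 0)"
proof
  assume "valB u = 0"
  hence "map snd u = replicate (length u) 0" using digitsD(2)[OF assms] B
    by (intro val_inj[of _ _ B]) (auto simp: valB_def val_replicate_0)
  thus "\<forall>i<length u. snd (u ! i) = 0" by (metis nth_map nth_replicate)
next
  assume "\<forall>i<length u. snd (u ! i) = 0"
  hence "map snd u = replicate (length u) 0" by (intro nth_equalityI) auto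
  thus "valB u = 0" by (simp add: valB_def val_replicate_0)
qed

lemma valA_eq_valB_iff: assumes "digits u" shows "valA u = valB u \<longleftrightarrow> (\<forall>i<length u. fst (u ! i) = snd (u ! i))"
proof
  assume "valA u = valB u"
  hence "map fst u = map snd u" using digitsD[OF assms] by (intro val_inj[of _ _ B]) (auto simp: valA_def valB_def)
  thus "\<forall>i<length u. fst (u ! i) = snd (u ! i)" by (metis nth_map)
next
  assume "\<forall>i<length u. fst (u ! i) = snd (u ! i)"
  hence "map fst u = map snd u" by (intro nth_equalityI) auto
  thus "valA u = valB u" unfolding valA_def valB_def by (simp only:)
qed

definition mainI :: "phase \<Rightarrow> bool \<Rightarrow> bool \<Rightarrow> int \<Rightarrow> int \<Rightarrow> nat \<Rightarrow> 'a config \<Rightarrow> bool" where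
  "mainI p z e VA VB len c \<longleftrightarrow> cstate c = to_nat (Main p z e :: 'a st) \<and> z = (VB = 0) \<and> e = (VA = VB) \<and>
     (\<exists>u. ctape c 2 = digit_tape u \<and> chead c 2 = 0 \<and> digits u \<and> length u = len \<and> valA u = VA \<and> valB u = VB)"

text \<open>The head is at \<open>k - 1\<close>, so that \<open>k = 0\<close> is the blank cell left
  of the number, where the return ends.\<close>

definition retI :: "phase \<Rightarrow> bool \<Rightarrow> bool \<Rightarrow> int \<Rightarrow> int \<Rightarrow> nat \<Rightarrow> nat \<Rightarrow> 'a config \<Rightarrow> bool" where
  "retI p z e VA VB len k c \<longleftrightarrow> cstate c = to_nat (Ret p z e :: 'a st) \<and> z = (VB = 0) \<and> e = (VA = VB) \<and>
     (\<exists>u. ctape c 2 = digit_tape u \<and> chead c 2 = int k - 1 \<and> k \<le> len \<and> digits u \<and> length u = len \<and> valA u = VA \<and> valB u = VB)"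

text \<open>Loop invariant of written addition: the digits on the tape together with the pending
  carries, which have weight \<open>B ^ k\<close>, represent the target values. \<open>len\<close>
  anticipates the cell requested by \<open>app\<close>.\<close>

definition swpI :: "phase \<Rightarrow> int \<Rightarrow> int \<Rightarrow> nat \<Rightarrow> nat \<Rightarrow> 'a config \<Rightarrow> bool" where
  "swpI p VA VB len k c \<longleftrightarrow> (\<exists>ca cb app z e u. cstate c = to_nat (Swp p ca cb app z e :: 'a st) \<and>
     ctape c 2 = digit_tape u \<and> chead c 2 = int k \<and> k \<le> length u \<and> digits u \<and> length u + of_bool app = len \<and>
     valA u + ca * B ^ k = VA \<and> valB u + cb * B ^ k = VB \<and> ca \<in> {-1, 0, 1} \<and> cb \<in> {-1, 0, 1} \<and>
     z = (\<forall>i<k. snd (u ! i) = 0) \<and> e = (\<forall>i<k. fst (u ! i) = snd (u ! i)))"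

lemma same_rest_upd:
  assumes "\<And>i. i < N \<Longrightarrow> i \<noteq> 2 \<Longrightarrow> y i = rd N c i \<and> d i = 0"
  shows "same_rest c (upd N q y d c)"
  using assms by (auto simp: same_rest_def)

text \<open>Digit plus carry is \<open>- 1\<close>, a digit or \<open>B\<close>, so carries never
  leave their range.\<close>

lemma carry_div: assumes "0 \<le> a" "a < B" "ca \<in> {-1, 0, 1}" shows "(a + ca) div B \<in> {-1, 0, 1}"
proof -
  have "a + ca = -1 \<or> 0 \<le> a + ca \<and> a + ca < B \<or> a + ca = B" using assms by auto
  moreover have "(-1) div B = -1" using B by (simp add: div_eq_minus1)
  ultimately show ?thesis using B by auto
qed

text \<open>The alternative \<open>Suc len\<close> is an unplanned overflow, possible only when
  \<open>VA\<close> has outgrown \<open>len\<close> digits.\<close>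

lemma swp_step:
  assumes S: "swpI p VA VB len k c" and V: "0 \<le> VB" "VB \<le> VA" and st: "step sim_ntm c c'"
  shows "same_rest c c'"
    and "k < len \<and> swpI p VA VB len (Suc k) c' \<or>
      (\<exists>z e len' kk. retI p z e VA VB len' kk c' \<and> (len' = len \<or> len' = Suc len \<and> p \<noteq> P3 \<and> B ^ len \<le> VA))"
proof -
  obtain ca cb app z e u where cs: "cstate c = to_nat (Swp p ca cb app z e :: 'a st)" and t: "ctape c 2 = digit_tape u"
    and h: "chead c 2 = int k" and ku: "k \<le> length u" and dg: "digits u" and len: "length u + of_bool app = len"
    and valA: "valA u + ca * B ^ k = VA" and valB: "valB u + cb * B ^ k = VB"
    and ca: "ca \<in> {-1, 0, 1}" and cb: "cb \<in> {-1, 0, 1}"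
    and z: "z = (\<forall>i<k. snd (u ! i) = 0)" and e: "e = (\<forall>i<k. fst (u ! i) = snd (u ! i))"
    using S unfolding swpI_def by blast
  obtain q' y d where tr: "tr (Swp p ca cb app z e) (rd N c) q' y d" and c': "c' = upd N (to_nat q') y d c"
    using stepE[OF st cs] by blast
  have rd2: "rd N c 2 = digit_tape u (int k)" using t h by simp
  from tr have "same_rest c c' \<and> (k < len \<and> swpI p VA VB len (Suc k) c' \<or>
      (\<exists>z e len' kk. retI p z e VA VB len' kk c' \<and> (len' = len \<or> len' = Suc len \<and> p \<noteq> P3 \<and> B ^ len \<le> VA)))"
  proof (cases rule: SwpE)
    case (Dig a b)
    have k: "k < length u" and ab: "u ! k = (a, b)"
      using Dig(4) unfolding rd2 by (auto simp: digit_tape_def prod_eq_iff split: if_splits)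
    define a' b' ca' cb' where "a' = (a + ca) mod B" and "b' = (b + cb) mod B"
      and "ca' = (a + ca) div B" and "cb' = (b + cb) div B"
    have ab01: "0 \<le> a" "a < B" "0 \<le> b" "b < B" using dg ab k nth_mem[OF k] by (auto simp: digits_def)
    let ?u = "u[k := (a', b')]"
    have t': "ctape c' 2 = digit_tape ?u" unfolding c' Dig(2)
      using digit_tape_update[OF k] by (simp add: t h a'_def b'_def)
    have eA: "a' + B * ca' = a + ca" and eB: "b' + B * cb' = b + cb"
      unfolding a'_def b'_def ca'_def cb'_def by auto
    have "valA ?u = valA u + (a' - a) * B ^ k" "valB ?u = valB u + (b' - b) * B ^ k"
      unfolding valA_def valB_def map_update using val_update[of k "map fst u" B a'] val_update[of k "map snd u" B b'] k ab
      by simp_all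
    hence "valA ?u + ca' * B ^ Suc k = valA u + (a' + B * ca' - a) * B ^ k"
      "valB ?u + cb' * B ^ Suc k = valB u + (b' + B * cb' - b) * B ^ k" by (simp_all add: algebra_simps)
    hence v: "valA ?u + ca' * B ^ Suc k = VA" "valB ?u + cb' * B ^ Suc k = VB"
      unfolding eA eB using valA valB by simp_all
    have "digits ?u" using dg B unfolding digits_def a'_def b'_def
      by (auto dest!: set_update_subset_insert[THEN subsetD])
    moreover have "ca' \<in> {-1, 0, 1}" "cb' \<in> {-1, 0, 1}"
      unfolding ca'_def cb'_def using carry_div ab01 ca cb by blast+
    moreover have "(z \<and> b' = 0) = (\<forall>i<Suc k. snd (?u ! i) = 0)"
      "(e \<and> a' = b') = (\<forall>i<Suc k. fst (?u ! i) = snd (?u ! i))"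
      unfolding z e using k by (auto simp: nth_list_update less_Suc_eq)
    moreover have "cstate c' = to_nat (Swp p ca' cb' app (z \<and> b' = 0) (e \<and> a' = b') :: 'a st)"
      unfolding c' Dig(1) a'_def b'_def ca'_def cb'_def by simp
    moreover have "chead c' 2 = int (Suc k)" unfolding c' Dig(3) by (simp add: mv_def h)
    ultimately have "swpI p VA VB len (Suc k) c'" unfolding swpI_def using t' v k len
      by (intro exI[of _ ca'] exI[of _ cb'] exI[of _ app] exI[of _ "z \<and> b' = 0"] exI[of _ "e \<and> a' = b'"] exI[of _ ?u]) simp
    moreover have "same_rest c c'" unfolding c' Dig(2,3) by (rule same_rest_upd) (auto simp: mv_def)
    ultimately show ?thesis using k len by auto
  next
    case End
    have k: "k = length u" using End(4) ku unfolding rd2 by (auto simp: digit_tape_def split: if_splits)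
    have sR: "same_rest c c'" unfolding c' End(2,3) by (rule same_rest_upd) (auto simp: mv_def)
    \<comment> \<open>At the right end a negative carry would make the whole value negative.\<close>
    have ca': "ca \<in> {0, 1}" and cb': "cb \<in> {0, 1}"
      using valA_bounds[OF dg] valB_bounds[OF dg] ca cb valA valB V unfolding k by auto
    have h': "chead c' 2 = int (length u) - 1" unfolding c' End(3) by (simp add: mv_def h k)
    have cs': "cstate c' = to_nat (Ret p (z \<and> cb = 0) (e \<and> ca = cb) :: 'a st)" unfolding c' End(1) by simp
    show ?thesis
    proof (cases "ca \<noteq> 0 \<or> app")
      case True
      let ?u = "u @ [(ca, cb)]"
      have t': "ctape c' 2 = digit_tape ?u" unfolding c' End(2) using digit_tape_append[of u ca cb] True by (simp add: t h k)
      have dg': "digits ?u" using dg ca' cb' B by (auto simp: digits_def)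
      have v: "valA ?u = VA" "valB ?u = VB" using valA valB unfolding k by (auto simp: valA_def valB_def val_append)
      have zf: "(z \<and> cb = 0) = (VB = 0)" unfolding v(2)[symmetric] valB_0_iff[OF dg'] z k
        by (auto simp: nth_append less_Suc_eq)
      have ef: "(e \<and> ca = cb) = (VA = VB)"
        unfolding v[symmetric] valA_eq_valB_iff[OF dg'] e k by (auto simp: nth_append less_Suc_eq)
      have R: "retI p (z \<and> cb = 0) (e \<and> ca = cb) VA VB (Suc (length u)) (length u) c'"
        unfolding retI_def using cs' t' h' dg' v zf ef by (intro conjI exI[of _ ?u]) auto
      have "Suc (length u) = len \<or> Suc (length u) = Suc len \<and> p \<noteq> P3 \<and> B ^ len \<le> VA"
      proof (cases app)
        case False
        hence "ca = 1" using True ca' by auto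
        thus ?thesis using False len End(5) valA valA_bounds[OF dg] k by auto
      qed (use len in auto)
      thus ?thesis using R sR by blast
    next
      case False
      hence c0: "ca = 0" "\<not> app" by auto
      \<comment> \<open>A carry of the second number alone would be lost, as no cell is written;
        \<open>VB \<le> VA\<close> excludes it.\<close>
      have "cb = 0" using cb' valA valB V valA_bounds[OF dg] valB_bounds[OF dg] c0 unfolding k by auto
      have t': "ctape c' 2 = digit_tape u" unfolding c' End(2) using False by (simp add: t h k) (auto simp: digit_tape_def fun_eq_iff)
      have v: "valA u = VA" "valB u = VB" using valA valB c0 \<open>cb = 0\<close> by auto
      have zf: "(z \<and> cb = 0) = (VB = 0)" unfolding v(2)[symmetric] valB_0_iff[OF dg] z k using \<open>cb = 0\<close> by simp
      have ef: "(e \<and> ca = cb) = (VA = VB)" unfolding v[symmetric] valA_eq_valB_iff[OF dg] e k using \<open>cb = 0\<close> c0 by simp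
      have "retI p (z \<and> cb = 0) (e \<and> ca = cb) VA VB len len c'"
        unfolding retI_def using cs' t' h' dg v zf ef len c0 by (intro conjI exI[of _ u]) auto
      thus ?thesis using sR by blast
    qed
  qed
  thus "same_rest c c'"
    and "k < len \<and> swpI p VA VB len (Suc k) c' \<or>
      (\<exists>z e len' kk. retI p z e VA VB len' kk c' \<and> (len' = len \<or> len' = Suc len \<and> p \<noteq> P3 \<and> B ^ len \<le> VA))"
    by blast+
qed

lemma ret_step:
  assumes R: "retI p z e VA VB len kk c" and st: "step sim_ntm c c'"
  shows "same_rest c c'" and "0 < kk \<and> retI p z e VA VB len (kk - 1) c' \<or> kk = 0 \<and> mainI p z e VA VB len c'"
proof -
  obtain u where cs: "cstate c = to_nat (Ret p z e :: 'a st)" and ze: "z = (VB = 0)" "e = (VA = VB)"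
    and t: "ctape c 2 = digit_tape u" and h: "chead c 2 = int kk - 1" and kk: "kk \<le> len"
    and u: "digits u" "length u = len" "valA u = VA" "valB u = VB"
    using R unfolding retI_def by blast
  obtain q' y d where tr: "tr (Ret p z e) (rd N c) q' y d" and c': "c' = upd N (to_nat q') y d c"
    using stepE[OF st cs] by blast
  have rd2: "rd N c 2 = digit_tape u (int kk - 1)" using t h by simp
  have "same_rest c c' \<and> (0 < kk \<and> retI p z e VA VB len (kk - 1) c' \<or> kk = 0 \<and> mainI p z e VA VB len c')"
    using tr
  proof (cases rule: RetE)
    case Dig
    have kk0: "0 < kk" using Dig(4) unfolding rd2 by (auto simp: digit_tape_def split: if_splits)
    moreover have "ctape c' 2 = digit_tape u" unfolding c' Dig(2) by (simp add: t)
    moreover have "same_rest c c'" unfolding c' Dig(2,3) by (rule same_rest_upd) (auto simp: mv_def)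
    ultimately show ?thesis using u kk ze unfolding retI_def
      by (auto simp: c' Dig(1,3) mv_def h intro!: exI[of _ u])
  next
    case End
    have "kk = 0" using End(4) kk u(2) unfolding rd2 by (auto simp: digit_tape_def split: if_splits)
    moreover have "ctape c' 2 = digit_tape u" unfolding c' End(2) by (simp add: t)
    moreover have "same_rest c c'" unfolding c' End(2,3) by (rule same_rest_upd) (auto simp: mv_def)
    ultimately show ?thesis using u kk ze unfolding mainI_def
      by (auto simp: c' End(1,3) mv_def h intro!: exI[of _ u])
  qed
  thus "same_rest c c'" and "0 < kk \<and> retI p z e VA VB len (kk - 1) c' \<or> kk = 0 \<and> mainI p z e VA VB len c'" by blast+
qed

text \<open>\<open>make_ntm\<close> drops transitions that leave \<open>Q\<close> or
  \<open>\<Sigma>\<close>, so every proof of progress needs membership in both.\<close>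

definition valid :: "'a config \<Rightarrow> bool" where
  "valid c \<longleftrightarrow> cstate c \<in> to_nat ` Q \<and> (\<forall>i<N. \<forall>p. ctape c i p \<in> \<Sigma>)"

lemma valid_step: assumes "valid c" "step sim_ntm c c'" shows "valid c'"
proof -
  have "states sim_ntm = to_nat ` Q" "alphabet sim_ntm = \<Sigma>" unfolding sim_ntm_def by simp_all
  thus ?thesis using step_alphabet[OF wf_sim_ntm assms(2)] step_state[OF wf_sim_ntm assms(2)] assms(1)
    unfolding valid_def by simp
qed

lemma validD: "valid c \<Longrightarrow> cstate c = to_nat q \<Longrightarrow> q \<in> Q" "valid c \<Longrightarrow> i < N \<Longrightarrow> reads c i \<in> \<Sigma>"
  "valid c \<Longrightarrow> i < N \<Longrightarrow> rd N c i \<in> \<Sigma>" "valid c \<Longrightarrow> i < N \<Longrightarrow> ctape c i p \<in> \<Sigma>"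
  by (auto simp: valid_def reads_def rd_def)

lemma valid_stepI:
  assumes "valid c" "cstate c = to_nat q" "q' \<in> Q" "tr q (rd N c) q' y d"
    "\<And>i. i < N \<Longrightarrow> y i \<in> \<Sigma>" "\<And>i. i < N \<Longrightarrow> d i \<in> {-1, 0, 1}"
  shows "step sim_ntm c (upd N (to_nat q') y d c)"
  using assms validD(1,2)[OF assms(1)] by (intro stepI) auto

lemma Q_iffs:
  "Main p z e \<in> Q \<longleftrightarrow> p \<in> phases" "Ret p z e \<in> Q \<longleftrightarrow> p \<in> phases"
  "Swp p ca cb app z e \<in> Q \<longleftrightarrow> p \<in> phases \<and> ca \<in> {-1, 0, 1} \<and> cb \<in> {-1, 0, 1}"
  "Skip0 \<in> Q" "Cmp0 \<in> Q" "Acc \<in> Q" "Skip xs \<in> Q \<longleftrightarrow> xs \<in> Rds"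
  "Cmp xs ys ds a b \<in> Q \<longleftrightarrow> xs \<in> Rds \<and> ys \<in> Rds \<and> ds \<in> Dirs \<and> a \<in> Cols \<and> b \<in> Cols"
  "Cmp1 ys ds b \<in> Q \<longleftrightarrow> ys \<in> Rds \<and> ds \<in> Dirs \<and> b \<in> Cols"
  by (auto simp: Q_def image_iff)

lemma \<Sigma>_iffs:
  "Blank \<in> \<Sigma>" "Inp x \<in> \<Sigma>" "W (Col c) \<in> \<Sigma> \<longleftrightarrow> c \<in> Cols" "W (Del q xs) \<in> \<Sigma> \<longleftrightarrow> q \<in> states M \<and> xs \<in> Rds"
  "W (Dig a b) \<in> \<Sigma> \<longleftrightarrow> 0 \<le> a \<and> a < B \<and> 0 \<le> b \<and> b < B" "s \<in> alphabet Mt \<Longrightarrow> emb s \<in> \<Sigma>"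
  by (auto simp: \<Sigma>_def image_iff emb_def split: if_splits)

text \<open>The overflow in phase \<open>P3\<close> is the only way for a sweep to get stuck, and
  the bound on \<open>VA\<close> excludes it.\<close>

lemma swp_progress:
  assumes S: "swpI p VA VB len k c" and V: "0 \<le> VB" "VB \<le> VA" "p = P3 \<Longrightarrow> VA < B ^ len" and v: "valid c"
  shows "\<exists>c'. step sim_ntm c c'"
proof -
  obtain ca cb app z e u where cs: "cstate c = to_nat (Swp p ca cb app z e :: 'a st)" and t: "ctape c 2 = digit_tape u"
    and h: "chead c 2 = int k" and ku: "k \<le> length u" and dg: "digits u" and len: "length u + of_bool app = len"
    and valA: "valA u + ca * B ^ k = VA" and valB: "valB u + cb * B ^ k = VB"
    and ca: "ca \<in> {-1, 0, 1}" and cb: "cb \<in> {-1, 0, 1}"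
    using S unfolding swpI_def by blast
  have rd2: "rd N c 2 = digit_tape u (int k)" using t h by simp
  have p: "p \<in> phases" using validD(1)[OF v cs] by (simp add: Q_iffs)
  show ?thesis
  proof (cases "k < length u")
    case True
    obtain a b where ab: "u ! k = (a, b)" by force
    have ab01: "0 \<le> a" "a < B" "0 \<le> b" "b < B" using dg ab nth_mem[OF True] by (auto simp: digits_def)
    have "rd N c 2 = W (Dig a b)" using rd2 True ab by (simp add: digit_tape_def)
    from valid_stepI[where q' = "Swp p ((a + ca) div B) ((b + cb) div B) app (z \<and> (b + cb) mod B = 0) (e \<and> (a + ca) mod B = (b + cb) mod B)", OF v cs _ Swp_dig[where x = "rd N c", OF this]] show ?thesis
      using p carry_div[of a ca] carry_div[of b cb] ab01 ca cb B validD(3)[OF v]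
      by (force simp: Q_iffs \<Sigma>_iffs mv_def)
  next
    case False
    hence k: "k = length u" using ku by simp
    have ca': "ca \<in> {0, 1}" and cb': "cb \<in> {0, 1}"
      using valA_bounds[OF dg] valB_bounds[OF dg] ca cb valA valB V unfolding k by auto
    have b: "rd N c 2 = Blank" using rd2 k by (simp add: digit_tape_def)
    have ns: "\<not> (p = P3 \<and> ca \<noteq> 0 \<and> \<not> app)"
      using ca' valA V(3) len valA_bounds[OF dg] unfolding k by auto
    from valid_stepI[OF v cs _ Swp_end[where x = "rd N c", OF b ns]] show ?thesis
      using p ca' cb' B validD(3)[OF v] by (force simp: Q_iffs \<Sigma>_iffs mv_def)
  qed
qed

lemma ret_reach:
  assumes "retI p z e VA VB len kk c" "valid c"
  shows "\<exists>c'. (step sim_ntm)\<^sup>*\<^sup>* c c' \<and> valid c' \<and> same_rest c c' \<and> mainI p z e VA VB len c'"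
  using assms
proof (induction kk arbitrary: c)
  case (0 c)
  have cs: "cstate c = to_nat (Ret p z e :: 'a st)" using 0 by (simp add: retI_def)
  have b: "rd N c 2 = Blank" using 0(1) by (auto simp: retI_def digit_tape_def)
  have "step sim_ntm c (upd N (to_nat (Main p z e :: 'a st)) (rd N c) (mv 2 1) c)"
    using validD(1)[OF 0(2) cs] by (intro valid_stepI[OF 0(2) cs _ Ret_end[where x = "rd N c", OF b]])
      (auto simp: Q_iffs mv_def validD(4)[OF 0(2)])
  with ret_step[OF 0(1) this] valid_step[OF 0(2) this] show ?case by blast
next
  case (Suc kk c)
  have cs: "cstate c = to_nat (Ret p z e :: 'a st)" using Suc.prems by (simp add: retI_def)
  have b: "rd N c 2 \<noteq> Blank" using Suc.prems(1) by (auto simp: retI_def digit_tape_def)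
  have st: "step sim_ntm c (upd N (to_nat (Ret p z e :: 'a st)) (rd N c) (mv 2 (-1)) c)" (is "step sim_ntm c ?d")
    using validD(1)[OF Suc.prems(2) cs]
    by (intro valid_stepI[OF Suc.prems(2) cs _ Ret_dig[where x = "rd N c", OF b]])
      (auto simp: Q_iffs mv_def validD(4)[OF Suc.prems(2)])
  have "retI p z e VA VB len kk ?d" using ret_step(2)[OF Suc.prems(1) st] by auto
  from Suc.IH[OF this valid_step[OF Suc.prems(2) st]] ret_step(1)[OF Suc.prems(1) st] st
  show ?case by (meson converse_rtranclp_into_rtranclp same_rest_trans)
qed

lemma swp_reach:
  assumes "swpI p VA VB len k c" "0 \<le> VB" "VB \<le> VA" "p = P3 \<Longrightarrow> VA < B ^ len" "valid c"
  shows "\<exists>c' z e len'. (step sim_ntm)\<^sup>*\<^sup>* c c' \<and> valid c' \<and> same_rest c c' \<and> mainI p z e VA VB len' c' \<and>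
     (len' = len \<or> len' = Suc len \<and> p \<noteq> P3 \<and> B ^ len \<le> VA)"
  using assms
proof (induction "len - k" arbitrary: k c rule: less_induct)
  case less
  obtain d where d: "step sim_ntm c d" using swp_progress[OF less.prems] by blast
  note vd = valid_step[OF less.prems(5) d]
  have R: "same_rest c d" by (rule swp_step(1)[OF less.prems(1-3) d])
  from swp_step(2)[OF less.prems(1-3) d] consider "k < len" "swpI p VA VB len (Suc k) d" |
    z e len' kk where "retI p z e VA VB len' kk d" "len' = len \<or> len' = Suc len \<and> p \<noteq> P3 \<and> B ^ len \<le> VA"
    by blast
  thus ?case
  proof cases
    case 1
    hence "len - Suc k < len - k" by simp
    from less.hyps[OF this 1(2) less.prems(2-4) vd] R d show ?thesis
      by (meson converse_rtranclp_into_rtranclp same_rest_trans)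
  next
    case 2
    obtain c' where "(step sim_ntm)\<^sup>*\<^sup>* d c'" "valid c'" "same_rest d c'" "mainI p z e VA VB len' c'"
      using ret_reach[OF 2(1) vd] by blast
    thus ?thesis using converse_rtranclp_into_rtranclp[of "step sim_ntm", OF d] same_rest_trans[OF R] 2(2) by blast
  qed
qed

lemma swpI_start:
  assumes "mainI p0 z0 e0 VA VB len c" "cstate c' = to_nat (Swp p ca cb app True True :: 'a st)"
    "ctape c' 2 = ctape c 2" "chead c' 2 = chead c 2" "ca \<in> {-1, 0, 1}" "cb \<in> {-1, 0, 1}"
  shows "swpI p (VA + ca) (VB + cb) (len + of_bool app) 0 c'"
proof -
  obtain u where u: "ctape c 2 = digit_tape u" "chead c 2 = 0" "digits u" "length u = len" "valA u = VA" "valB u = VB"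
    using assms(1) unfolding mainI_def by blast
  show ?thesis unfolding swpI_def
    by (rule exI[of _ ca], rule exI[of _ cb], rule exI[of _ app], rule exI[of _ True], rule exI[of _ True],
        rule exI[of _ u]) (use u assms(2-) in auto)
qed

end

section \<open>The constructor and the phases of a run\<close>

text \<open>\<open>f\<close> stands for the constructed value at the length of \<open>w\<close>, and
  \<open>l\<close> is a number of digits that suffices for this length plus 1.\<close>

locale sim_inp = sim +
  fixes w :: "'a list" and \<rho>t :: "unit config list" and f l :: nat
  assumes run: "finite_run Mt (replicate (length w) ()) \<rho>t"
    and hin: "\<forall>c \<in> set \<rho>t. chead c 0 \<in> {- 1..int (length w)}"
    and outw: "ctape (last \<rho>t) 1 = word_tape (replicate f ())"
    and l: "int (length w) + 1 < B ^ l"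
begin

abbreviation n where "n \<equiv> length w"
abbreviation mt where "mt \<equiv> length \<rho>t"
abbreviation ct where "ct j \<equiv> \<rho>t ! j"

section \<open>The run of the space constructor\<close>

lemma mt_pos: "0 < mt" using run by (auto simp: finite_run_def)
lemma ct_0: "ct 0 = init_config Mt (replicate n ())" using run by (auto simp: finite_run_def hd_conv_nth)
lemma ct_last: "last \<rho>t = ct (mt - 1)" using mt_pos by (intro last_conv_nth) auto

lemma ct_step: "Suc j < mt \<Longrightarrow> step Mt (ct j) (ct (Suc j))"
  using run by (auto simp: finite_run_def successively_nth)

lemma ct_alpha: assumes "j < mt" "i < kT" shows "ctape (ct j) i p \<in> alphabet Mt"
  by (rule steps_alphabet[OF wfT partial_run_nth[of Mt \<rho>t j] _ assms(2)])
    (use run assms in \<open>auto simp: finite_run_def init_alphabet[OF wfT]\<close>)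

lemma out_ds:
  assumes "(q, xs, q', ys, ds) \<in> delta Mt"
  shows "ds ! 1 \<in> {0, 1}" "a \<in> alphabet Mt \<Longrightarrow> (q, xs[1 := a], q', ys, ds) \<in> delta Mt"
proof -
  have "ds ! 1 \<in> {-1, 0, 1}" using wf_deltaD(7,8)[OF wfT assms] kT_gt(1)
    by (metis One_nat_def nth_mem subsetD)
  moreover have "0 \<le> ds ! 1" using out assms unfolding output_tape_def by blast
  ultimately show "ds ! 1 \<in> {0, 1}" by auto
  show "a \<in> alphabet Mt \<Longrightarrow> (q, xs[1 := a], q', ys, ds) \<in> delta Mt"
    using out assms unfolding output_tape_def by blast
qed

definition rdx where "rdx j = (map (reads (ct j)) [0..<kT])[1 := Blank]"

text \<open>By \<open>output_tape\<close> a transition for a blank output cell also applies to the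
  true one, and by determinism it is the step of the given run, which therefore has not ended
  yet.\<close>

lemma ct_sim:
  assumes "j < mt" "(cstate (ct j), rdx j, q', ys, ds) \<in> delta Mt"
  shows "Suc j < mt" "ct (Suc j) = upd kT q' ((!) ys) ((!) ds) (ct j)"
proof -
  have "reads (ct j) 1 \<in> alphabet Mt" unfolding reads_def by (rule ct_alpha[OF assms(1)]) simp
  from out_ds(2)[OF assms(2) this]
  have t: "(cstate (ct j), map (reads (ct j)) [0..<kT], q', ys, ds) \<in> delta Mt"
    unfolding rdx_def list_update_overwrite
    by (subst (asm) list_update_same_conv[THEN iffD2]) auto
  have s: "step Mt (ct j) (upd kT q' ((!) ys) ((!) ds) (ct j))" unfolding step_upd using t by blast
  show *: "Suc j < mt"
  proof (rule ccontr)
    assume "\<not> Suc j < mt"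
    hence "ct j = last \<rho>t" using assms(1) ct_last by (metis Suc_lessI diff_Suc_1)
    thus False using s run unfolding finite_run_def final_config_def by metis
  qed
  obtain q1 ys1 ds1 where "(cstate (ct j), map (reads (ct j)) [0..<kT], q1, ys1, ds1) \<in> delta Mt"
    "ct (Suc j) = upd kT q1 ((!) ys1) ((!) ds1) (ct j)"
    using ct_step[OF *] unfolding step_upd by blast
  thus "ct (Suc j) = upd kT q' ((!) ys) ((!) ds) (ct j)"
    using t detT unfolding deterministic_def by metis
qed

text \<open>Conversely, a further step of the given run would supply a transition for the vector
  with the blanked output.\<close>

lemma ct_sim_last:
  assumes "j < mt" "\<nexists>q' ys ds. (cstate (ct j), rdx j, q', ys, ds) \<in> delta Mt"
  shows "Suc j = mt"
proof (rule ccontr)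
  assume "Suc j \<noteq> mt"
  then obtain q1 ys1 ds1 where t: "(cstate (ct j), map (reads (ct j)) [0..<kT], q1, ys1, ds1) \<in> delta Mt"
    using ct_step[of j] assms(1) unfolding step_upd by (metis Suc_lessI)
  have "Blank \<in> alphabet Mt" using wfT by (auto simp: wf_ntm_def)
  from out_ds(2)[OF t this] show False using assms(2) unfolding rdx_def by blast
qed

lemma ct_Suc:
  assumes "Suc j < mt"
  obtains q' ys ds where "(cstate (ct j), map (reads (ct j)) [0..<kT], q', ys, ds) \<in> delta Mt"
    "ct (Suc j) = upd kT q' ((!) ys) ((!) ds) (ct j)"
  using ct_step[OF assms] unfolding step_upd by blast

lemma ct_tape0: "j < mt \<Longrightarrow> ctape (ct j) 0 = word_tape (replicate n ())"
proof (induction j)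
  case 0 thus ?case by (simp add: ct_0 init_config_def)
next
  case (Suc j)
  obtain q' ys ds where d: "(cstate (ct j), map (reads (ct j)) [0..<kT], q', ys, ds) \<in> delta Mt"
    and c: "ct (Suc j) = upd kT q' ((!) ys) ((!) ds) (ct j)" using ct_Suc[OF Suc.prems] by metis
  have "ys ! 0 = map (reads (ct j)) [0..<kT] ! 0" using ro d unfolding read_only_def by blast
  hence "ys ! 0 = reads (ct j) 0" by simp
  thus ?case using Suc unfolding c by (simp add: reads_def)
qed

lemma ct_head0: "j < mt \<Longrightarrow> -1 \<le> chead (ct j) 0 \<and> chead (ct j) 0 \<le> int n"
  using hin nth_mem[of j \<rho>t] by auto

text \<open>Because the head stays within the word and the two adjacent blanks, its position alone
  decides what it reads.\<close>

lemma ct_read0: "j < mt \<Longrightarrow> reads (ct j) 0 = (if chead (ct j) 0 = -1 \<or> chead (ct j) 0 = int n then Blank else Inp ())"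
  using ct_head0[of j] by (auto simp: reads_def ct_tape0 word_tape_def)

lemma ct_out: "j < mt \<Longrightarrow> 0 \<le> chead (ct j) 1 \<and> (\<forall>p > chead (ct j) 1. ctape (ct j) 1 p = Blank)"
proof (induction j)
  case 0 thus ?case by (simp add: ct_0 init_config_def)
next
  case (Suc j)
  obtain q' ys ds where d: "(cstate (ct j), map (reads (ct j)) [0..<kT], q', ys, ds) \<in> delta Mt"
    and c: "ct (Suc j) = upd kT q' ((!) ys) ((!) ds) (ct j)" using ct_Suc[OF Suc.prems] by metis
  show ?case using Suc out_ds(1)[OF d] unfolding c by auto
qed

text \<open>
  Only cells that the output head has left are counted, hence the possible difference of 1 to the
  length of the output in \<open>out_count_last\<close>.
\<close>

definition out_count :: "unit config \<Rightarrow> nat" where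
  "out_count d = card {p. 0 \<le> p \<and> p < chead d 1 \<and> ctape d 1 p = Inp ()}"

lemma finite_bounded_int: "finite {p::int. 0 \<le> p \<and> p < h \<and> P p}"
  by (rule finite_subset[of _ "{0..<h}"]) auto

lemma out_count_upd:
  assumes "0 \<le> chead d 1" "ds 1 \<in> {0, 1}"
  shows "out_count (upd kT q ys ds d) = out_count d + of_bool (ys 1 = Inp () \<and> ds 1 = 1)"
proof -
  let ?h = "chead d 1" let ?S = "{p. 0 \<le> p \<and> p < ?h \<and> ctape d 1 p = Inp ()}"
  have "{p. 0 \<le> p \<and> p < chead (upd kT q ys ds d) 1 \<and> ctape (upd kT q ys ds d) 1 p = Inp ()} =
    ?S \<union> (if ys 1 = Inp () \<and> ds 1 = 1 then {?h} else {})"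
    using assms by (auto split: if_splits)
  moreover have "card (?S \<union> (if ys 1 = Inp () \<and> ds 1 = 1 then {?h} else {})) =
     card ?S + of_bool (ys 1 = Inp () \<and> ds 1 = 1)"
    using finite_bounded_int[of ?h "\<lambda>p. ctape d 1 p = Inp ()"] by auto
  ultimately show ?thesis unfolding out_count_def by simp
qed

lemma out_count_0: "out_count (ct 0) = 0" by (auto simp: out_count_def ct_0 init_config_def)

lemma out_count_Suc: assumes "Suc j < mt" shows "out_count (ct j) \<le> out_count (ct (Suc j))"
proof -
  obtain q' ys ds where d: "(cstate (ct j), map (reads (ct j)) [0..<kT], q', ys, ds) \<in> delta Mt"
    and c: "ct (Suc j) = upd kT q' ((!) ys) ((!) ds) (ct j)" using ct_Suc[OF assms] by metis
  show ?thesis unfolding c using out_count_upd[of "ct j" "(!) ds"] ct_out[of j] assms out_ds(1)[OF d] by simp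
qed

lemma out_count_last: "out_count (ct (mt - 1)) \<le> f" "f \<le> Suc (out_count (ct (mt - 1)))"
proof -
  let ?d = "ct (mt - 1)"
  have t: "ctape ?d 1 p = Inp () \<longleftrightarrow> 0 \<le> p \<and> p < int f" for p
    using outw unfolding ct_last by (auto simp: word_tape_def)
  have eq: "{p. 0 \<le> p \<and> p < chead ?d 1 \<and> ctape ?d 1 p = Inp ()} = {0..<min (chead ?d 1) (int f)}"
    unfolding t by auto
  have h: "0 \<le> chead ?d 1" "\<forall>p > chead ?d 1. ctape ?d 1 p = Blank" using ct_out[of "mt - 1"] mt_pos by auto
  \<comment> \<open>The output starts in cell 0 without gaps and nothing stands right of the head,
    so at most the cell under the head is uncounted.\<close>
  have "int f \<le> chead ?d 1 + 1"
  proof (rule ccontr)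
    assume "\<not> ?thesis"
    hence "ctape ?d 1 (chead ?d 1 + 1) = Inp ()" using t h(1) by auto
    thus False using h(2) by auto
  qed
  moreover have "out_count ?d = nat (min (chead ?d 1) (int f))" unfolding out_count_def eq by simp
  ultimately show "out_count ?d \<le> f" "f \<le> Suc (out_count ?d)" by auto
qed

text \<open>The output head never returns to a counted cell, so the count only grows and its final
  value bounds it at all times. This limits the counter tape during the whole construction.\<close>

lemma out_count_le: "j < mt \<Longrightarrow> out_count (ct j) \<le> f"
proof -
  assume "j < mt"
  hence "j \<le> mt - 1" by simp
  hence "out_count (ct j) \<le> out_count (ct (mt - 1))"
  proof (induction j rule: inc_induct)
    case (step j)
    hence "Suc j < mt" by linarith
    thus ?case using out_count_Suc[of j] step by linarith
  qed simp
  thus ?thesis using out_count_last by simp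
qed

section \<open>Invariants of the forward phases\<close>

definition column :: "'a config \<Rightarrow> int \<Rightarrow> ('a sym \<times> bool) list" where
  "column c p = map (\<lambda>i. (ctape c i p, chead c i = p)) [0..<kM]"

abbreviation c0 where "c0 \<equiv> init_config M w"

definition row0 :: "int \<Rightarrow> int \<Rightarrow> 'a sym" where
  "row0 h p = (if 0 \<le> p \<and> p < h then W (Col (column c0 p)) else Blank)"

lemma column_c0: "column c0 p = col0 (p = 0) (word_tape w p)"
  by (auto simp: column_def col0_def init_config_def)

lemma row0_Suc: "(row0 (int h))(int h := W (Col (col0 (h = 0) (word_tape w (int h))))) = row0 (int (Suc h))"
  by (auto simp: row0_def fun_eq_iff column_c0)

definition works :: "'a config \<Rightarrow> unit config \<Rightarrow> bool" where
  "works c d \<longleftrightarrow> (\<forall>i. 2 \<le> i \<and> i < kT \<longrightarrow> chead c (Suc i) = chead d i \<and> ctape c (Suc i) = (\<lambda>p. emb (ctape d i p)))"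

text \<open>Length of the counter tape: \<open>L\<close> cells forced by the size of
  \<open>n + 1\<close>, one requested by \<open>P1_end\<close> and one per counted output symbol. An
  overflow is absorbed by a new choice of \<open>L\<close>.\<close>

definition lenb :: "nat \<Rightarrow> nat \<Rightarrow> bool" where
  "lenb len m \<longleftrightarrow> (\<exists>L. (L = 0 \<or> B ^ (L - 1) \<le> int n + 1) \<and> len \<le> L + 1 + m)"

definition guess_tape :: "(int \<Rightarrow> 'a sym) \<Rightarrow> int \<Rightarrow> bool" where
  "guess_tape Y h \<longleftrightarrow> (\<forall>p. p < 0 \<or> h \<le> p \<longrightarrow> Y p = Blank) \<and>
     (\<forall>p. 0 \<le> p \<and> p \<le> int n \<longrightarrow> Y p = W (Col (column c0 p))) \<and>
     (\<exists>xs. Y (int n + 1) = W (Del (start M) xs)) \<and>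
     (\<forall>p. int n + 1 < p \<and> p < h \<longrightarrow> isCol (Y p) \<or> isDel (Y p))"

text \<open>At most \<open>l + 1 + f\<close> cells by \<open>lenb_le\<close>, and one more requested
  by \<open>P2_end\<close>.\<close>

definition len_bound :: nat where "len_bound = l + f + 2"

text \<open>
  \<open>VA\<close> and \<open>VB\<close> are the values of the two numbers after the pending sweep, \<open>len\<close> is the number
  of digits and \<open>r\<close> bounds the remaining steps of the phase.
\<close>

fun phase_inv :: "phase \<Rightarrow> int \<Rightarrow> int \<Rightarrow> nat \<Rightarrow> nat \<Rightarrow> 'a config \<Rightarrow> bool" where
  "phase_inv (P1 b) VA VB len r c \<longleftrightarrow> (\<exists>h. h \<le> n \<and> b = (h = 0) \<and> chead c 0 = int h \<and> chead c 1 = int h \<and>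
     ctape c 0 = word_tape w \<and> ctape c 1 = row0 (int h) \<and> works c (ct 0) \<and> VA = int h \<and> VB = 0 \<and>
     (len = 0 \<or> B ^ (len - 1) \<le> VA) \<and> r = n - h)"
| "phase_inv (P2 q) VA VB len r c \<longleftrightarrow> (\<exists>j<mt. cstate (ct j) = q \<and> chead c 0 = int n + 1 \<and> chead c 1 = int n + 1 \<and>
     ctape c 0 = word_tape w \<and> ctape c 1 = row0 (int n + 1) \<and> works c (ct j) \<and> VA = int n + 1 \<and>
     VB = chead (ct j) 0 + 1 \<and> out_count (ct j) + 1 \<le> len \<and> lenb len (out_count (ct j)) \<and> r = mt - j)"
| "phase_inv P3 VA VB len r c \<longleftrightarrow> (\<exists>h. int n + 2 \<le> h \<and> chead c 0 = h \<and> chead c 1 = h \<and> guess_tape (ctape c 1) h \<and>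
     (\<forall>p>int n. ctape c 0 p = ctape c 1 p) \<and> works c (ct (mt - 1)) \<and> f + 1 \<le> len \<and> len \<le> len_bound \<and>
     r = nat (B ^ len - VA))"

lemma phase_inv_cong:
  assumes "same_rest c c'" shows "phase_inv p VA VB len r c' = phase_inv p VA VB len r c"
proof -
  have "chead c' 0 = chead c 0" "chead c' 1 = chead c 1" "ctape c' 0 = ctape c 0" "ctape c' 1 = ctape c 1"
    using assms by (auto simp: same_rest_def)
  moreover have "works c' d = works c d" for d using assms by (simp add: same_rest_def works_def)
  ultimately show ?thesis by (cases p) simp_all
qed

lemma B_pow_le: "B ^ m \<le> int n + 1 \<Longrightarrow> m < l"
  using l B by (metis le_less_trans power_less_imp_less_exp one_less_numeral_iff less_le_trans semiring_norm(76))

lemma lenb_le: "lenb len m \<Longrightarrow> len \<le> l + 1 + m"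
  unfolding lenb_def by (auto dest!: B_pow_le)

lemma phase_inv_len: assumes "phase_inv p VA VB len r c" shows "len \<le> len_bound"
proof (cases p)
  case (P1 b)
  then obtain h where "h \<le> n" "VA = int h" "len = 0 \<or> B ^ (len - 1) \<le> VA" using assms by auto
  hence "len = 0 \<or> B ^ (len - 1) \<le> int n + 1" by auto
  thus ?thesis using B_pow_le[of "len - 1"] by (auto simp: len_bound_def)
next
  case (P2 q)
  then obtain j where "j < mt" "lenb len (out_count (ct j))" using assms by auto
  thus ?thesis using lenb_le[of len "out_count (ct j)"] out_count_le[of j] by (simp add: len_bound_def)
qed (use assms in auto)

lemma phase_inv_Suc_len:
  assumes "phase_inv p VA VB len r c" "p \<noteq> P3" "B ^ len \<le> VA"
  shows "phase_inv p VA VB (Suc len) r c"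
proof (cases p)
  case (P2 q)
  then obtain j where j: "j < mt" "cstate (ct j) = q" "chead c 0 = int n + 1" "chead c 1 = int n + 1"
     "ctape c 0 = word_tape w" "ctape c 1 = row0 (int n + 1)" "works c (ct j)" "VA = int n + 1"
     "VB = chead (ct j) 0 + 1" "out_count (ct j) + 1 \<le> len" "lenb len (out_count (ct j))" "r = mt - j" using assms by auto
  have "lenb (Suc len) (out_count (ct j))" unfolding lenb_def
    by (rule exI[of _ "Suc len"]) (use assms(3) j(8) in auto)
  thus ?thesis using j unfolding P2 phase_inv.simps by (intro exI[of _ j]) auto
qed (use assms in auto)

fun ph :: "phase \<Rightarrow> nat" where "ph (P1 b) = 3" | "ph (P2 q) = 2" | "ph P3 = 1"

definition nextI :: "phase \<Rightarrow> nat \<Rightarrow> 'a config \<Rightarrow> bool" where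
  "nextI p r c' \<longleftrightarrow> (\<exists>p' VA' VB' len' r'. phase_inv p' VA' VB' len' r' c' \<and> 0 \<le> VB' \<and> VB' \<le> VA' \<and>
     swpI p' VA' VB' len' 0 c' \<and> (ph p' < ph p \<or> ph p' = ph p \<and> r' < r))"

lemma nextI_I:
  assumes "phase_inv p' VA' VB' len' r' c'" "swpI p' VA' VB' len' 0 c'" "0 \<le> VB'" "VB' \<le> VA'"
    "ph p' < ph p \<or> ph p' = ph p \<and> r' < r"
  shows "nextI p r c'"
  using assms unfolding nextI_def by blast

lemma works_upd:
  assumes "\<And>i. 3 \<le> i \<Longrightarrow> i < N \<Longrightarrow> y i = rd N c i \<and> d i = 0"
  shows "works (upd N q y d c) D = works c D"
proof -
  have "chead (upd N q y d c) (Suc i) = chead c (Suc i) \<and> ctape (upd N q y d c) (Suc i) = ctape c (Suc i)"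
    if "2 \<le> i" for i using assms[of "Suc i"] that by auto
  thus ?thesis unfolding works_def by (simp del: upd_simps)
qed

lemma P1_step:
  assumes I: "phase_inv (P1 b) VA VB len r c" and m: "mainI (P1 b) z e VA VB len c" and st: "step sim_ntm c c'"
  shows "nextI (P1 b) r c'"
proof -
  obtain h where h: "h \<le> n" "b = (h = 0)" "chead c 0 = int h" "chead c 1 = int h"
     "ctape c 0 = word_tape w" "ctape c 1 = row0 (int h)" "works c (ct 0)" "VA = int h" "VB = 0"
     "len = 0 \<or> B ^ (len - 1) \<le> VA" "r = n - h" using I by auto
  have cs: "cstate c = to_nat (Main (P1 b) z e :: 'a st)" using m by (simp add: mainI_def)
  obtain q' y d where tr: "tr (Main (P1 b) z e) (rd N c) q' y d" and c': "c' = upd N (to_nat q') y d c"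
    using stepE[OF st cs] by blast
  have rd0: "rd N c 0 = word_tape w (int h)" using h by simp
  from tr show ?thesis
  proof (cases rule: MainP1E)
    case (Inp a)
    have hn: "h < n" and a: "Inp a = word_tape w (int h)" using Inp(4) unfolding rd0
      by (auto simp: word_tape_def split: if_splits)
    have S: "swpI (P1 False) (VA + 1) (VB + 0) (len + of_bool False) 0 c'"
      by (rule swpI_start[OF m]) (simp_all add: c' Inp mv2_def)
    have "phase_inv (P1 False) (VA + 1) VB len (n - Suc h) c'"
      unfolding phase_inv.simps
    proof (intro exI[of _ "Suc h"] conjI)
      show "works c' (ct 0)" unfolding c' using h(7) works_upd[of y c d] by (simp add: Inp mv2_def)
      show "ctape c' 1 = row0 (int (Suc h))" using row0_Suc[of h] h a by (simp add: c' Inp mv2_def)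
      show "len = 0 \<or> B ^ (len - 1) \<le> VA + 1" using h by auto
      show "ctape c' 0 = word_tape w" by (simp add: c' Inp(2) h(5)[symmetric])
    qed (use h hn in \<open>auto simp: c' Inp mv2_def\<close>)
    thus ?thesis by (rule nextI_I) (use S h hn in simp_all)
  next
    case End
    have hn: "h = n" using End(4) h(1) unfolding rd0
      by (auto simp: word_tape_def split: if_splits)
    have bl: "word_tape w (int h) = Blank" using hn by (simp add: word_tape_def)
    have S: "swpI (P2 (start Mt)) (VA + 1) (VB + 1) (len + of_bool True) 0 c'"
      by (rule swpI_start[OF m]) (simp_all add: c' End mv2_def)
    have "phase_inv (P2 (start Mt)) (VA + 1) (VB + 1) (len + 1) mt c'"
      unfolding phase_inv.simps
    proof (intro exI[of _ 0] conjI)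
      show "works c' (ct 0)" unfolding c' using h(7) works_upd[of y c d] by (simp add: End mv2_def)
      show "ctape c' 1 = row0 (int n + 1)" using row0_Suc[of h] h hn bl by (simp add: c' End mv2_def add.commute)
      \<comment> \<open>The old length serves as \<open>L\<close>; the requested cell is the
        additional one.\<close>
      show "lenb (len + 1) (out_count (ct 0))" unfolding lenb_def using h by (intro exI[of _ len]) auto
      show "ctape c' 0 = word_tape w" by (simp add: c' End(2) h(5)[symmetric])
    qed (use h hn mt_pos in \<open>auto simp: c' End mv2_def out_count_0\<close>, auto simp: ct_0 init_config_def)
    thus ?thesis by (rule nextI_I) (use S h hn in simp_all)
  qed
qed

lemma rdt_iff:
  assumes j: "j < mt" "works c (ct j)" "VA = int n + 1" "VB = chead (ct j) 0 + 1" "z = (VB = 0)" "e = (VA = VB)"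
  shows "rdt z e (rd N c) xs \<longleftrightarrow> xs = rdx j"
proof -
  have r: "rd N c (Suc i) = emb (reads (ct j) i)" if "2 \<le> i" "i < kT" for i
    using j(2) that by (simp add: works_def reads_def)
  have x: "rdx j ! i = (if i = 1 then Blank else reads (ct j) i)" if "i < kT" for i
    using that by (simp add: rdx_def nth_list_update)
  have len: "length (rdx j) = kT" by (simp add: rdx_def)
  have 0: "(if z \<or> e then Blank else Inp ()) = reads (ct j) 0" unfolding ct_read0[OF j(1)] using j by auto
  show ?thesis
  proof
    assume A: "rdt z e (rd N c) xs"
    show "xs = rdx j"
    proof (rule nth_equalityI)
      show "length xs = length (rdx j)" using A len by (simp add: rdt_def)
      fix i assume "i < length xs"
      hence i: "i < kT" using A by (simp add: rdt_def)
      consider "i = 0" | "i = 1" | "2 \<le> i" by linarith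
      thus "xs ! i = rdx j ! i"
      proof cases
        case 3
        hence "emb (xs ! i) = rd N c (Suc i)" using A i unfolding rdt_def by simp
        hence "xs ! i = reads (ct j) i" unfolding r[OF 3 i] by simp
        thus ?thesis using x[OF i] 3 by simp
      qed (use A x[OF i] 0 in \<open>auto simp: rdt_def\<close>)
    qed
  next
    assume "xs = rdx j"
    thus "rdt z e (rd N c) xs" unfolding rdt_def using len x[of 0] x[of 1] x r 0 by simp
  qed
qed

lemma P2_step:
  assumes I: "phase_inv (P2 q) VA VB len r c" and m: "mainI (P2 q) z e VA VB len c" and st: "step sim_ntm c c'"
    and V: "0 \<le> VB" "VB \<le> VA"
  shows "nextI (P2 q) r c'"
proof -
  obtain j where j: "j < mt" "cstate (ct j) = q" "chead c 0 = int n + 1" "chead c 1 = int n + 1"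
     "ctape c 0 = word_tape w" "ctape c 1 = row0 (int n + 1)" "works c (ct j)" "VA = int n + 1"
     "VB = chead (ct j) 0 + 1" "out_count (ct j) + 1 \<le> len" "lenb len (out_count (ct j))" "r = mt - j" using I by auto
  have cs: "cstate c = to_nat (Main (P2 q) z e :: 'a st)" and ze: "z = (VB = 0)" "e = (VA = VB)"
    using m by (auto simp: mainI_def)
  obtain q' y d where tr: "tr (Main (P2 q) z e) (rd N c) q' y d" and c': "c' = upd N (to_nat q') y d c"
    using stepE[OF st cs] by blast
  note rdt = rdt_iff[OF j(1,7,8,9) ze]
  from tr show ?thesis
  proof (cases rule: MainP2E)
    case (Step xs q1 ys ds)
    hence t: "(cstate (ct j), rdx j, q1, ys, ds) \<in> delta Mt" using rdt j(2) by simp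
    note ctS = ct_sim[OF j(1) t]
    have ds0: "ds ! 0 \<in> {-1, 0, 1}" using wf_deltaD(7,8)[OF wfT t] kT_gt(2)
      by (metis nth_mem subsetD)
    let ?app = "ys ! 1 = Inp () \<and> ds ! 1 = 1"
    have S: "swpI (P2 q1) (VA + 0) (VB + ds ! 0) (len + of_bool ?app) 0 c'"
      by (rule swpI_start[OF m]) (use ds0 in \<open>simp_all add: c' Step\<close>)
    have VB': "VB + ds ! 0 = chead (ct (Suc j)) 0 + 1" unfolding ctS(2) j(9) by simp
    have cnt': "out_count (ct (Suc j)) = out_count (ct j) + of_bool ?app"
      unfolding ctS(2) by (rule out_count_upd) (use ct_out[OF j(1)] out_ds(1)[OF t] in auto)
    have phase_inv: "phase_inv (P2 q1) VA (VB + ds ! 0) (len + of_bool ?app) (mt - Suc j) c'"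
      unfolding phase_inv.simps
    proof (intro exI[of _ "Suc j"] conjI)
      show "works c' (ct (Suc j))" unfolding works_def ctS(2)
        using j(7) by (auto simp: c' Step works_def fun_eq_iff)
      show "lenb (len + of_bool ?app) (out_count (ct (Suc j)))" using j(11) unfolding lenb_def cnt' by auto
      show "cstate (ct (Suc j)) = q1" unfolding ctS(2) by simp
    qed (use j VB' cnt' ctS(1) in \<open>auto simp: c' Step\<close>)
    have "0 \<le> VB + ds ! 0" "VB + ds ! 0 \<le> VA" unfolding VB' using ct_head0[OF ctS(1)] j(8) by auto
    thus ?thesis using S j(12) ctS(1) by (intro nextI_I[OF phase_inv]) simp_all
  next
    case (End xs)
    have last: "Suc j = mt" using End(4) rdt j(2) by (intro ct_sim_last[OF j(1)]) auto
    have mtj: "mt - 1 = j" using last by simp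
    have S: "swpI P3 (VA + 0) (VB + 0) (len + of_bool True) 0 c'"
      by (rule swpI_start[OF m]) (simp_all add: c' End mv2_def)
    have Y: "ctape c' 1 = (row0 (int n + 1))(int n + 1 := W (Del (start M) xs))"
      using j by (simp add: c' End)
    have "phase_inv P3 VA VB (len + 1) (nat (B ^ (len + 1) - VA)) c'"
      unfolding phase_inv.simps
    proof (intro exI[of _ "int n + 2"] conjI)
      show "works c' (ct (mt - 1))" unfolding c' using j(7) works_upd[of y c d] last[symmetric] by (simp add: End mv2_def)
      show "guess_tape (ctape c' 1) (int n + 2)" unfolding Y guess_tape_def row0_def by auto
      show "\<forall>p>int n. ctape c' 0 p = ctape c' 1 p" unfolding Y using j
        by (auto simp: c' End row0_def word_tape_def)
      \<comment> \<open>One output symbol may be uncounted; the spare cell in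
        \<open>out_count (ct j) + 1 \<le> len\<close> makes up for it.\<close>
      show "f + 1 \<le> len + 1" using out_count_last(2) j(10) unfolding mtj by simp
      show "len + 1 \<le> len_bound" using lenb_le[OF j(11)] out_count_le[OF j(1)] by (simp add: len_bound_def)
    qed (use j in \<open>auto simp: c' End mv2_def\<close>)
    thus ?thesis by (rule nextI_I) (use S V in simp_all)
  qed
qed

section \<open>Rows, listed from right to left, and invariants of the backward phase\<close>

definition seg :: "(int \<Rightarrow> 'a sym) \<Rightarrow> int \<Rightarrow> ('a sym \<times> bool) list list \<Rightarrow> bool" where
  "seg Y p R \<longleftrightarrow> (\<forall>i<length R. Y (p - int i) = W (Col (R ! i)))"

definition rowl :: "'a config \<Rightarrow> int \<Rightarrow> nat \<Rightarrow> ('a sym \<times> bool) list list" where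
  "rowl c b m = map (\<lambda>i. column c (b - int i)) [0..<m]"

text \<open>Outside the window every column is \<open>bl\<close>, so the row in the window stands
  for the whole configuration.\<close>

definition inwin :: "'a config \<Rightarrow> int \<Rightarrow> nat \<Rightarrow> bool" where
  "inwin c b m \<longleftrightarrow> (\<forall>i<kM. b - int m < chead c i \<and> chead c i \<le> b \<and>
     (\<forall>p. p \<le> b - int m \<or> b < p \<longrightarrow> ctape c i p = Blank))"

definition acc :: "'a config \<Rightarrow> bool" where
  "acc c \<longleftrightarrow> (\<exists>d. (step M)\<^sup>*\<^sup>* c d \<and> final_config M d \<and> cstate d \<in> accepting M)"

text \<open>
  The rows are checked from the last one to the first one, so the invariant speaks about the future
  of an arbitrary configuration whose row is the one left of the delimiter at \<open>D\<close>.
\<close>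

definition acc_from :: "(int \<Rightarrow> 'a sym) \<Rightarrow> int \<Rightarrow> bool" where
  "acc_from Y D \<longleftrightarrow> (\<forall>c b m xs. Y D = W (Del (cstate c) xs) \<longrightarrow> seg Y (D - 1) (rowl c b m) \<longrightarrow>
     \<not> isCol (Y (D - 1 - int m)) \<longrightarrow> inwin c b m \<longrightarrow> acc c)"

text \<open>
  The successor row, both rows being listed from right to left; \<open>a\<close> and \<open>b\<close> are the two columns
  to the right of the remaining list. A row grows by one cell at each end.
\<close>

fun slide :: "'a sym list \<Rightarrow> int list \<Rightarrow> ('a sym \<times> bool) list \<Rightarrow> ('a sym \<times> bool) list \<Rightarrow>
    ('a sym \<times> bool) list list \<Rightarrow> ('a sym \<times> bool) list list" where
  "slide ys ds a b [] = [nxt ys ds a b bl, nxt ys ds b bl bl]"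
| "slide ys ds a b (c # R) = nxt ys ds a b c # slide ys ds b c R"

text \<open>\<open>D0\<close> and \<open>D1\<close> are the delimiters of the later and the earlier
  row. \<open>F\<close> is all of the later row, \<open>S\<close> the part of it compared so far and
  \<open>R\<close> the part of the earlier row read so far. That the compared columns exhaust
  \<open>F\<close> becomes known only at the end of the comparison.\<close>

definition cmpI where
  "cmpI Y xs ys ds D0 D1 R S \<longleftrightarrow> (\<exists>q q' xs' F. acc_from Y D0 \<and> Y D0 = W (Del q' xs') \<and> Y D1 = W (Del q xs) \<and>
     (q, xs, q', ys, ds) \<in> delta M \<and> seg Y (D0 - 1) F \<and> D1 = D0 - 1 - int (length F) \<and>
     seg Y (D1 - 1) R \<and> seg Y (D0 - 1) S \<and> (\<forall>c \<in> set R. okc xs c))"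

text \<open>In \<open>Cmp0\<close> everything is claimed under the condition that head 0 is on a
  delimiter: if the later row goes on, no rule applies. \<open>rk\<close> orders states between
  which no head moves.\<close>

fun back_inv :: "'a st \<Rightarrow> (int \<Rightarrow> 'a sym) \<Rightarrow> int \<Rightarrow> int \<Rightarrow> nat \<Rightarrow> bool" where
  "back_inv Skip0 Y p0 p1 rk \<longleftrightarrow> rk = 3 \<and> p0 = p1"
| "back_inv (Skip xs) Y p0 p1 rk \<longleftrightarrow> rk = 2 \<and> length xs = kM \<and> (\<exists>q R. q \<in> accepting M \<and> (\<nexists>q' ys ds. (q, xs, q', ys, ds) \<in> delta M) \<and>
     Y p0 = W (Del q xs) \<and> seg Y (p0 - 1) R \<and> p1 = p0 - 1 - int (length R) \<and> (\<forall>c \<in> set R. okc xs c))"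
| "back_inv Cmp0 Y p0 p1 rk \<longleftrightarrow> rk = 1 \<and> (isDel (Y p0) \<longrightarrow> acc_from Y p0 \<and>
     (\<exists>R. seg Y (p0 - 1) R \<and> p1 = p0 - 1 - int (length R) \<and> \<not> isCol (Y p1)))"
| "back_inv (Cmp xs ys ds a b) Y p0 p1 rk \<longleftrightarrow> rk = 1 \<and> (\<exists>D0 D1 R S. cmpI Y xs ys ds D0 D1 R S \<and>
     p1 = D1 - 1 - int (length R) \<and> p0 = D0 - 1 - int (length S) \<and>
     (\<forall>Z. slide ys ds bl bl (R @ Z) = S @ slide ys ds a b Z))"
| "back_inv (Cmp1 ys ds b) Y p0 p1 rk \<longleftrightarrow> rk = 1 \<and> (\<exists>xs D0 D1 R S. cmpI Y xs ys ds D0 D1 R S \<and>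
     p1 = D1 - 1 - int (length R) \<and> p0 = D0 - 1 - int (length S) \<and> \<not> isCol (Y p1) \<and>
     slide ys ds bl bl R = S @ [nxt ys ds b bl bl])"
| "back_inv Acc Y p0 p1 rk \<longleftrightarrow> rk = 0 \<and> acc c0"
| "back_inv _ Y p0 p1 rk \<longleftrightarrow> False"

text \<open>Tape 0 agrees with tape 1 only to the right of cell \<open>n\<close>, hence the lower
  bound for head 0. Both heads only move to the left, so the sum of their positions is a rank; the
  bounds keep it positive.\<close>

definition backward :: "nat \<times> nat \<times> nat \<times> nat \<Rightarrow> 'a config \<Rightarrow> bool" where
  "backward m c \<longleftrightarrow> (\<exists>s h rk. cstate c = to_nat (s :: 'a st) \<and> back_inv s (ctape c 1) (chead c 0) (chead c 1) rk \<and>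
     guess_tape (ctape c 1) h \<and> (\<forall>p>int n. ctape c 0 p = ctape c 1 p) \<and> int n + 1 \<le> chead c 0 \<and> chead c 0 < h \<and>
     -1 \<le> chead c 1 \<and> works c (ct (mt - 1)) \<and> chead c 2 = 0 \<and>
     m = (0, nat (chead c 0 + chead c 1 + 1), rk, 0))"

lemma P3_step:
  assumes I: "phase_inv P3 VA VB len r c" and m: "mainI P3 z e VA VB len c" and st: "step sim_ntm c c'"
    and V: "0 \<le> VB" "VB \<le> VA"
  shows "nextI P3 r c' \<or> (\<exists>x. backward (0, x) c')"
proof -
  obtain h where h: "int n + 2 \<le> h" "chead c 0 = h" "chead c 1 = h" "guess_tape (ctape c 1) h"
     "\<forall>p>int n. ctape c 0 p = ctape c 1 p" "works c (ct (mt - 1))" "f + 1 \<le> len" "len \<le> len_bound"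
     "r = nat (B ^ len - VA)" using I by auto
  have cs: "cstate c = to_nat (Main P3 z e :: 'a st)" and h2: "chead c 2 = 0" using m by (auto simp: mainI_def)
  \<comment> \<open>The current value still fits, so \<open>B ^ len - VA\<close> is positive and the
    increment lowers it; an overflow shows up only in the sweep that follows.\<close>
  have VAB: "VA < B ^ len" using m valA_bounds(2) by (auto simp: mainI_def)
  obtain q' y d where tr: "tr (Main P3 z e) (rd N c) q' y d" and c': "c' = upd N (to_nat q') y d c"
    using stepE[OF st cs] by blast
  from tr show ?thesis
  proof (cases rule: MainP3E)
    case (Guess s)
    have S: "swpI P3 (VA + 1) (VB + 0) (len + of_bool False) 0 c'"
      by (rule swpI_start[OF m]) (simp_all add: c' Guess mv2_def)
    have Y: "ctape c' 1 = (ctape c 1)(h := s)" "ctape c' 0 = (ctape c 0)(h := s)"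
      using h by (simp_all add: c' Guess)
    have "phase_inv P3 (VA + 1) VB len (nat (B ^ len - (VA + 1))) c'"
      unfolding phase_inv.simps
    proof (intro exI[of _ "h + 1"] conjI)
      show "works c' (ct (mt - 1))" unfolding c' using h(6) works_upd[of y c d] by (simp add: Guess mv2_def)
      show "guess_tape (ctape c' 1) (h + 1)" using h(1,4) Guess(4) unfolding Y guess_tape_def by auto
      show "\<forall>p>int n. ctape c' 0 p = ctape c' 1 p" unfolding Y using h by auto
    qed (use h in \<open>auto simp: c' Guess mv2_def\<close>)
    hence "nextI P3 r c'" by (rule nextI_I) (use S V VAB h(9) in simp_all)
    thus ?thesis ..
  next
    case End
    have Y: "ctape c' 1 = ctape c 1" "ctape c' 0 = ctape c 0" by (simp_all add: c' End)
    have "works c' (ct (mt - 1))" unfolding c' using h(6) works_upd[of y c d] by (simp add: End mv2_def)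
    hence "backward (0, nat (chead c' 0 + chead c' 1 + 1), 3, 0) c'" unfolding backward_def
      by (intro exI[of _ Skip0] exI[of _ h] exI[of _ 3]) (use h h2 Y in \<open>auto simp: c' End mv2_def\<close>)
    thus ?thesis by blast
  qed
qed

section \<open>Comparing the rows backwards\<close>

lemma isDel_not_isCol: "isDel x \<Longrightarrow> \<not> isCol x" by (auto simp: isDel_def isCol_def)

lemma seg_append: "seg Y p (R @ [c]) \<longleftrightarrow> seg Y p R \<and> Y (p - int (length R)) = W (Col c)"
  by (auto simp: seg_def nth_append less_Suc_eq)

text \<open>Both lists are the maximal block of columns going left from \<open>p\<close>.\<close>

lemma seg_unique:
  assumes "seg Y p R" "\<not> isCol (Y (p - int (length R)))" "seg Y p S" "\<not> isCol (Y (p - int (length S)))"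
  shows "R = S"
proof -
  have "length R = length S" using assms unfolding seg_def isCol_def by (metis linorder_neqE_nat)
  thus ?thesis
  proof (rule nth_equalityI)
    fix i assume i: "i < length R"
    hence "W (Col (R ! i)) = (W (Col (S ! i)) :: 'a sym)"
      using assms(1,3) \<open>length R = length S\<close> unfolding seg_def by metis
    thus "R ! i = S ! i" by simp
  qed
qed

lemma guess_tape_Blank: "guess_tape Y h \<Longrightarrow> p < 0 \<Longrightarrow> Y p = Blank" by (simp add: guess_tape_def)

lemma guess_tape_nonBlank: assumes "guess_tape Y h" "0 \<le> p" "p < h" shows "Y p \<noteq> Blank"
proof -
  consider "p \<le> int n" | "p = int n + 1" | "int n + 1 < p" by linarith
  thus ?thesis
  proof cases
    case 1
    hence "Y p = W (Col (column c0 p))" using assms unfolding guess_tape_def by blast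
    thus ?thesis by simp
  next
    case 2
    obtain xs where "Y (int n + 1) = W (Del (start M) xs)" using assms unfolding guess_tape_def by blast
    thus ?thesis using 2 by simp
  next
    case 3
    hence "isCol (Y p) \<or> isDel (Y p)" using assms unfolding guess_tape_def by blast
    thus ?thesis by (auto simp: isCol_def isDel_def)
  qed
qed

lemma guess_tape_isDel: assumes "guess_tape Y h" "isDel (Y p)" shows "int n + 1 \<le> p"
proof (rule ccontr)
  assume n: "\<not> ?thesis"
  show False
  proof (cases "p < 0")
    case False
    hence "0 \<le> p" "p \<le> int n" using n by auto
    hence "Y p = W (Col (column c0 p))" using assms(1) unfolding guess_tape_def by blast
    thus ?thesis using assms(2) by (auto simp: isDel_def)
  qed (use guess_tape_Blank[OF assms(1)] assms(2) in \<open>auto simp: isDel_def\<close>)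
qed

lemma guess_tape_isCol: assumes "guess_tape Y h" "isCol (Y p)" shows "p \<noteq> int n + 1 \<and> 0 \<le> p"
proof -
  obtain xs where "Y (int n + 1) = W (Del (start M) xs)" using assms unfolding guess_tape_def by blast
  thus ?thesis using assms guess_tape_Blank[OF assms(1), of p] by (force simp: isCol_def)
qed

text \<open>Heads move by at most one cell, so \<open>nxt\<close> sees every head that can arrive at
  \<open>p\<close>.\<close>

lemma column_step:
  assumes "\<And>i. i < kM \<Longrightarrow> ds ! i \<in> {-1, 0, 1}"
  shows "column (upd kM q ((!) ys) ((!) ds) c) p = nxt ys ds (column c (p + 1)) (column c p) (column c (p - 1))"
  unfolding column_def nxt_def
proof (intro map_cong refl)
  fix i assume "i \<in> set [0..<kM]"
  hence i: "i < kM" by simp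
  thus "(ctape (upd kM q ((!) ys) ((!) ds) c) i p, chead (upd kM q ((!) ys) ((!) ds) c) i = p) =
    (if snd (map (\<lambda>i. (ctape c i p, chead c i = p)) [0..<kM] ! i) then ys ! i
     else fst (map (\<lambda>i. (ctape c i p, chead c i = p)) [0..<kM] ! i),
     snd (map (\<lambda>i. (ctape c i (p + 1), chead c i = p + 1)) [0..<kM] ! i) \<and> ds ! i = -1 \<or>
     snd (map (\<lambda>i. (ctape c i p, chead c i = p)) [0..<kM] ! i) \<and> ds ! i = 0 \<or>
     snd (map (\<lambda>i. (ctape c i (p - 1), chead c i = p - 1)) [0..<kM] ! i) \<and> ds ! i = 1)"
    using assms[OF i] by auto
qed

lemma column_bl: "inwin c b m \<Longrightarrow> p \<le> b - int m \<or> b < p \<Longrightarrow> column c p = bl"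
  unfolding column_def bl_def inwin_def by (auto intro!: nth_equalityI)

lemma rowl_Suc: "rowl c p (Suc m) = column c p # rowl c (p - 1) m"
  unfolding rowl_def by (auto simp: upt_conv_Cons map_Suc_upt[symmetric] algebra_simps simp del: upt_Suc)

lemma rowl_length [simp]: "length (rowl c b m) = m" by (simp add: rowl_def)

lemma slide_rowl:
  assumes ds: "\<And>i. i < kM \<Longrightarrow> ds ! i \<in> {-1, 0, 1}"
    and "column c (p - int m) = bl" "column c (p - int m - 1) = bl"
  shows "slide ys ds (column c (p + 2)) (column c (p + 1)) (rowl c p m) =
    rowl (upd kM q ((!) ys) ((!) ds) c) (p + 1) (m + 2)"
proof -
  have cs: "column (upd kM q ((!) ys) ((!) ds) c) x = nxt ys ds (column c (x + 1)) (column c x) (column c (x - 1))" for x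
    by (rule column_step) (rule ds)
  show ?thesis using assms(2,3)
proof (induction m arbitrary: p)
  case 0
  have "rowl (upd kM q ((!) ys) ((!) ds) c) (p + 1) 2 =
    [column (upd kM q ((!) ys) ((!) ds) c) (p + 1), column (upd kM q ((!) ys) ((!) ds) c) p]"
    by (simp add: numeral_2_eq_2 rowl_Suc) (simp add: rowl_def)
  also have "\<dots> = [nxt ys ds (column c (p + 2)) (column c (p + 1)) bl, nxt ys ds (column c (p + 1)) bl bl]"
    unfolding cs using 0 by (simp add: add.commute)
  moreover have "rowl c p 0 = []" by (simp add: rowl_def)
  ultimately show ?case by (simp add: numeral_2_eq_2)
next
  case (Suc m)
  have "slide ys ds (column c (p - 1 + 2)) (column c (p - 1 + 1)) (rowl c (p - 1) m) =
    rowl (upd kM q ((!) ys) ((!) ds) c) (p - 1 + 1) (m + 2)"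
    by (rule Suc.IH) (use Suc.prems in \<open>simp_all add: algebra_simps\<close>)
  moreover have "rowl (upd kM q ((!) ys) ((!) ds) c) (p + 1) (Suc m + 2) =
      nxt ys ds (column c (p + 2)) (column c (p + 1)) (column c p) # rowl (upd kM q ((!) ys) ((!) ds) c) p (m + 2)"
    using cs[of "p + 1"] by (simp add: rowl_Suc add.commute)
  ultimately show ?case by (simp add: rowl_Suc add.commute)
qed
qed

text \<open>One more cell at each end is as far as a head can get in one step.\<close>

lemma slide_inwin:
  assumes ds: "\<And>i. i < kM \<Longrightarrow> ds ! i \<in> {-1, 0, 1}" and w: "inwin c b m"
  shows "slide ys ds bl bl (rowl c b m) = rowl (upd kM q ((!) ys) ((!) ds) c) (b + 1) (m + 2)"
    "inwin (upd kM q ((!) ys) ((!) ds) c) (b + 1) (m + 2)"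
proof -
  have "column c (b + 2) = bl" "column c (b + 1) = bl" "column c (b - int m) = bl" "column c (b - int m - 1) = bl"
    using column_bl[OF w] by auto
  with slide_rowl[of ds c b m ys q] ds
  show "slide ys ds bl bl (rowl c b m) = rowl (upd kM q ((!) ys) ((!) ds) c) (b + 1) (m + 2)" by simp
  show "inwin (upd kM q ((!) ys) ((!) ds) c) (b + 1) (m + 2)"
    unfolding inwin_def
  proof (intro allI impI)
    fix i assume i: "i < kM"
    show "b + 1 - int (m + 2) < chead (upd kM q ((!) ys) ((!) ds) c) i \<and>
         chead (upd kM q ((!) ys) ((!) ds) c) i \<le> b + 1 \<and>
         (\<forall>p. p \<le> b + 1 - int (m + 2) \<or> b + 1 < p \<longrightarrow> ctape (upd kM q ((!) ys) ((!) ds) c) i p = Blank)"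
      using ds[OF i] i w unfolding inwin_def by auto
  qed
qed

text \<open>All heads lie in the window, so each tape has a flagged column there, which pins down
  its entry of \<open>xs\<close>.\<close>

lemma okc_reads:
  assumes w: "inwin c b m" and xs: "length xs = kM"
  shows "(\<forall>x \<in> set (rowl c b m). okc xs x) \<longleftrightarrow> xs = map (reads c) [0..<kM]"
proof
  assume A: "\<forall>x \<in> set (rowl c b m). okc xs x"
  show "xs = map (reads c) [0..<kM]"
  proof (rule nth_equalityI)
    fix i assume "i < length xs"
    hence i: "i < kM" using xs by simp
    let ?p = "nat (b - chead c i)"
    have "?p < m" "chead c i = b - int ?p" using w i unfolding inwin_def by auto
    hence "column c (chead c i) \<in> set (rowl c b m)" unfolding rowl_def by (metis (no_types, lifting) atLeastLessThan_iff image_eqI le0 list.set_map set_upt)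
    hence "okc xs (column c (chead c i))" using A by blast
    thus "xs ! i = map (reads c) [0..<kM] ! i" using i by (simp add: okc_def column_def reads_def)
  qed (use xs in simp)
next
  assume "xs = map (reads c) [0..<kM]"
  thus "\<forall>x \<in> set (rowl c b m). okc xs x"
    by (auto simp: rowl_def okc_def column_def reads_def)
qed

lemma acc_from_final:
  assumes q: "q \<in> accepting M" "\<nexists>q' ys ds. (q, xs, q', ys, ds) \<in> delta M" "length xs = kM"
    and Y: "Y D = W (Del q xs)" "seg Y (D - 1) R" "\<not> isCol (Y (D - 1 - int (length R)))" "\<forall>c \<in> set R. okc xs c"
  shows "acc_from Y D"
  unfolding acc_from_def
proof (intro allI impI)
  fix c b m xs1
  assume A: "Y D = W (Del (cstate c) xs1)" "seg Y (D - 1) (rowl c b m)" "\<not> isCol (Y (D - 1 - int m))" "inwin c b m"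
  have R: "R = rowl c b m" by (rule seg_unique[OF Y(2,3) A(2)]) (use A(3) in simp)
  hence "xs = map (reads c) [0..<kM]" using okc_reads[OF A(4) q(3)] Y(4) by simp
  moreover have "cstate c = q" using A(1) Y(1) by simp
  ultimately show "acc c" unfolding acc_def final_config_def step_upd using q by blast
qed

text \<open>If the earlier row encodes some \<open>c\<close>, then the confirmed \<open>xs\<close>
  is what \<open>c\<close> reads, the transition applies, and \<open>slide\<close> makes the later
  row the encoding of the successor, to which \<open>acc_from Y D0\<close> applies. If it encodes no
  configuration, nothing is claimed, so malformed guesses cause no extra case.\<close>

lemma acc_from_step:
  assumes D0: "acc_from Y D0" "Y D0 = W (Del q' xs')" and D1: "Y D1 = W (Del q xs)"
    and t: "(q, xs, q', ys, ds) \<in> delta M" and F: "seg Y (D0 - 1) F" "D1 = D0 - 1 - int (length F)"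
    and R: "seg Y (D1 - 1) R" "\<not> isCol (Y (D1 - 1 - int (length R)))" "\<forall>c \<in> set R. okc xs c"
    and FS: "F = slide ys ds bl bl R"
  shows "acc_from Y D1"
  unfolding acc_from_def
proof (intro allI impI)
  fix c b m xs1
  assume A: "Y D1 = W (Del (cstate c) xs1)" "seg Y (D1 - 1) (rowl c b m)" "\<not> isCol (Y (D1 - 1 - int m))" "inwin c b m"
  have Rr: "R = rowl c b m" by (rule seg_unique[OF R(1,2) A(2)]) (use A(3) in simp)
  note wfd = wf_deltaD[OF wfM t]
  have xs: "xs = map (reads c) [0..<kM]" using okc_reads[OF A(4) wfd(3)] R(3) Rr by simp
  have cs: "cstate c = q" using A(1) D1 by simp
  let ?c = "upd kM q' ((!) ys) ((!) ds) c"
  have ds: "ds ! i \<in> {-1, 0, 1}" if "i < kM" for i using wfd(7,8) that by (metis nth_mem subsetD)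
  have st: "step M c ?c" using t unfolding step_upd xs[symmetric] cs by blast
  have Fr: "F = rowl ?c (b + 1) (m + 2)" unfolding FS Rr by (rule slide_inwin(1)[OF ds A(4)])
  have "acc ?c"
  proof (rule D0(1)[unfolded acc_from_def, rule_format])
    show "Y D0 = W (Del (cstate ?c) xs')" using D0(2) by simp
    show "seg Y (D0 - 1) (rowl ?c (b + 1) (m + 2))" using F(1) Fr by simp
    have "D0 - 1 - int (m + 2) = D1" using F(2) Fr by simp
    thus "\<not> isCol (Y (D0 - 1 - int (m + 2)))" using D1 by (simp add: isCol_def)
    show "inwin ?c (b + 1) (m + 2)" by (rule slide_inwin(2)[OF ds A(4)])
  qed
  thus "acc c" unfolding acc_def using converse_rtranclp_into_rtranclp[of "step M", OF st] by blast
qed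

text \<open>The first row was copied and not guessed, so here the universal claim meets an actual
  configuration.\<close>

lemma acc_from_init:
  assumes "acc_from Y (int n + 1)" "guess_tape Y h"
  shows "acc c0"
proof -
  obtain xs where xs: "Y (int n + 1) = W (Del (start M) xs)" using assms(2) by (auto simp: guess_tape_def)
  show ?thesis
  proof (rule assms(1)[unfolded acc_from_def, rule_format])
    show "Y (int n + 1) = W (Del (cstate c0) xs)" using xs by (simp add: init_config_def)
    show "seg Y (int n + 1 - 1) (rowl c0 (int n) (n + 1))"
      using assms(2) unfolding guess_tape_def by (auto simp: seg_def rowl_def simp del: upt_Suc)
    show "\<not> isCol (Y (int n + 1 - 1 - int (n + 1)))"
      using guess_tape_Blank[OF assms(2), of "-1"] by (simp add: isCol_def)
    show "inwin c0 (int n) (n + 1)" by (auto simp: inwin_def init_config_def word_tape_def)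
  qed
qed

text \<open>Bookkeeping shared by all rules of the backward phase, none of which changes a
  tape.\<close>

lemma backward_upd:
  assumes Y: "guess_tape (ctape c 1) h" and eq: "\<forall>p>int n. ctape c 0 p = ctape c 1 p"
    and work_sym: "works c (ct (mt - 1))" and h2: "chead c 2 = 0"
    and d: "\<And>i. 2 \<le> i \<Longrightarrow> d i = 0"
    and back_inv: "back_inv s' (ctape c 1) (chead c 0 + d 0) (chead c 1 + d 1) rk'"
    and p: "int n + 1 \<le> chead c 0 + d 0" "chead c 0 + d 0 < h" "-1 \<le> chead c 1 + d 1"
    and lt: "0 < nat (chead c 0 + chead c 1 + 1)" "d 0 + d 1 < 0 \<or> d 0 + d 1 = 0 \<and> rk' < rk"
  shows "\<exists>m'. backward m' (upd N (to_nat (s' :: 'a st)) (rd N c) d c) \<and>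
    (m', (0, nat (chead c 0 + chead c 1 + 1), rk, 0)) \<in> less_than <*lex*> less_than <*lex*> less_than <*lex*> less_than"
proof -
  let ?c = "upd N (to_nat s') (rd N c) d c"
  have T: "ctape ?c 1 = ctape c 1" "ctape ?c 0 = ctape c 0" by simp_all
  have H: "chead ?c 0 = chead c 0 + d 0" "chead ?c 1 = chead c 1 + d 1" "chead ?c 2 = 0" using h2 d by simp_all
  have "works ?c (ct (mt - 1))" using work_sym works_upd[of "rd N c" c d] d by simp
  hence "backward (0, nat (chead ?c 0 + chead ?c 1 + 1), rk', 0) ?c"
    unfolding backward_def T H using back_inv Y eq p by (intro exI[of _ s'] exI[of _ h] exI[of _ rk']) simp
  moreover have "((0, nat (chead ?c 0 + chead ?c 1 + 1), rk', 0), (0, nat (chead c 0 + chead c 1 + 1), rk, 0))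
      \<in> less_than <*lex*> less_than <*lex*> less_than <*lex*> less_than"
    unfolding H using lt by auto
  ultimately show ?thesis by blast
qed

lemma backward_step:
  assumes b: "backward m c" and st: "step sim_ntm c c'"
  shows "\<exists>m'. backward m' c' \<and> (m', m) \<in> less_than <*lex*> less_than <*lex*> less_than <*lex*> less_than"
proof -
  obtain s h rk where cs: "cstate c = to_nat (s :: 'a st)" and back_inv: "back_inv s (ctape c 1) (chead c 0) (chead c 1) rk"
    and Y: "guess_tape (ctape c 1) h" and eq: "\<forall>p>int n. ctape c 0 p = ctape c 1 p"
    and p: "int n + 1 \<le> chead c 0" "chead c 0 < h" "-1 \<le> chead c 1"
    and work_sym: "works c (ct (mt - 1))" and h2: "chead c 2 = 0"
    and m: "m = (0, nat (chead c 0 + chead c 1 + 1), rk, 0)" using b unfolding backward_def by blast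
  let ?Y = "ctape c 1"
  obtain q' y d where tr: "tr s (rd N c) q' y d" and c': "c' = upd N (to_nat q') y d c"
    using stepE[OF st cs] by blast
  have rd0: "rd N c 0 = ?Y (chead c 0)" and rd1: "rd N c 1 = ?Y (chead c 1)" using eq p by simp_all
  have lt: "0 < nat (chead c 0 + chead c 1 + 1)" using p by simp
  note U = backward_upd[OF Y eq work_sym h2]
  have p1: "0 \<le> chead c 1" if "?Y (chead c 1) \<noteq> Blank" using guess_tape_Blank[OF Y] that by force
  show ?thesis
  proof (cases s)
    case (Main ph z e) thus ?thesis using back_inv by simp
  next
    case (Swp ph ca cb app z e) thus ?thesis using back_inv by simp
  next
    case (Ret ph z e) thus ?thesis using back_inv by simp
  next
    case Skip0
    from tr[unfolded Skip0] show ?thesis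
    proof (cases rule: Skip0E)
      case (Del q xs)
      have BS': "back_inv (Skip xs) ?Y (chead c 0 + mv (Suc 0) (-1) 0) (chead c 1 + mv (Suc 0) (-1) 1) 2"
        using back_inv Del rd1 Skip0 by (auto simp: mv_def seg_def intro!: exI[of _ "[]"])
      show ?thesis unfolding c' m Del(1-3)
        by (rule U[where d = "mv (Suc 0) (-1)", OF _ BS']) (use back_inv Skip0 p lt in \<open>auto simp: mv_def\<close>)
    qed
  next
    case (Skip xs)
    then obtain q R where R: "rk = 2" "length xs = kM" "q \<in> accepting M" "\<nexists>q' ys ds. (q, xs, q', ys, ds) \<in> delta M"
      "?Y (chead c 0) = W (Del q xs)" "seg ?Y (chead c 0 - 1) R" "chead c 1 = chead c 0 - 1 - int (length R)"
      "\<forall>c \<in> set R. okc xs c" using back_inv by auto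
    from tr[unfolded Skip] show ?thesis
    proof (cases rule: SkipE)
      case (Col x)
      have x: "?Y (chead c 1) = W (Col x)" using Col rd1 by simp
      have BS': "back_inv (Skip xs) ?Y (chead c 0 + mv (Suc 0) (-1) 0) (chead c 1 + mv (Suc 0) (-1) 1) 2"
        using R x Col(5) by (auto simp: mv_def seg_append intro!: exI[of _ q] exI[of _ "R @ [x]"])
      show ?thesis unfolding c' m Col(1-3)
        by (rule U[where d = "mv (Suc 0) (-1)", OF _ BS']) (use p lt p1 x in \<open>auto simp: mv_def\<close>)
    next
      case End
      have nc: "\<not> isCol (?Y (chead c 1))" using End rd1 by simp
      have "acc_from ?Y (chead c 0)"
        by (rule acc_from_final[OF R(3,4,2,5,6)]) (use R nc in auto)
      hence BS': "back_inv Cmp0 ?Y (chead c 0 + 0) (chead c 1 + 0) 1" using R nc by auto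
      show ?thesis unfolding c' m End(1-3) by (rule U[where d = "\<lambda>_. 0", OF _ BS']) (use p lt R(1) in auto)
    qed
  next
    case Cmp0
    have C: "acc_from ?Y (chead c 0)" "\<exists>R. seg ?Y (chead c 0 - 1) R \<and> chead c 1 = chead c 0 - 1 - int (length R) \<and> \<not> isCol (?Y (chead c 1))"
      if "isDel (?Y (chead c 0))" using back_inv that unfolding Cmp0 by auto
    have rk: "rk = 1" using back_inv Cmp0 by simp
    from tr[unfolded Cmp0] show ?thesis
    proof (cases rule: Cmp0E)
      case (Start q2 xs2 q1 xs1 ys ds)
      have y0: "?Y (chead c 0) = W (Del q2 xs2)" and y1: "?Y (chead c 1) = W (Del q1 xs1)"
        using Start(4,5) rd0 rd1 by simp_all
      have "isDel (?Y (chead c 0))" "isDel (?Y (chead c 1))" using y0 y1 by (auto simp: isDel_def)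
      note C = C[OF this(1)] and D1 = guess_tape_isDel[OF Y this(2)]
      from C(2) obtain F where F: "seg ?Y (chead c 0 - 1) F" "chead c 1 = chead c 0 - 1 - int (length F)" by blast
      have "cmpI ?Y xs1 ys ds (chead c 0) (chead c 1) [] []"
        unfolding cmpI_def using C(1) y0 y1 Start(6) F by (auto simp: seg_def)
      hence BS': "back_inv (Cmp xs1 ys ds bl bl) ?Y (chead c 0 + mv2 (-1) 0) (chead c 1 + mv2 (-1) 1) 1"
        unfolding back_inv.simps by (intro conjI exI[of _ "chead c 0"] exI[of _ "chead c 1"] exI[of _ "[]"]) (auto simp: mv2_def)
      show ?thesis unfolding c' m Start(1-3)
        by (rule U[where d = "mv2 (-1)", OF _ BS']) (use p lt D1 F in \<open>auto simp: mv2_def\<close>)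
    next
      case Acc
      have "isDel (?Y (chead c 0))" "?Y (chead c 1) = Blank" using Acc(4,5) rd0 rd1 by simp_all
      note C = C[OF this(1)] and D0 = guess_tape_isDel[OF Y this(1)]
      from C(2) obtain F where F: "seg ?Y (chead c 0 - 1) F" "chead c 1 = chead c 0 - 1 - int (length F)" by blast
      \<comment> \<open>The written part has no gaps, so a blank under head 1 can only be cell
        \<open>- 1\<close>.\<close>
      have "chead c 1 = -1" using guess_tape_nonBlank[OF Y, of "chead c 1"] \<open>?Y (chead c 1) = Blank\<close> F(2) p by force
      \<comment> \<open>Otherwise the block of columns between the two heads would cover the
        delimiter in cell \<open>n + 1\<close>.\<close>
      have "chead c 0 = int n + 1"
      proof (rule ccontr)
        assume "chead c 0 \<noteq> int n + 1"
        hence lt: "int n + 1 < chead c 0" using p by simp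
        let ?i = "nat (chead c 0 - 1 - (int n + 1))"
        have "?i < length F" "chead c 0 - 1 - int ?i = int n + 1" using lt F(2) \<open>chead c 1 = -1\<close> by auto
        hence "isCol (?Y (int n + 1))" using F(1) unfolding seg_def isCol_def by metis
        thus False using guess_tape_isCol[OF Y] by blast
      qed
      hence "acc c0" using acc_from_init[OF _ Y] C(1) by simp
      hence BS': "back_inv Acc ?Y (chead c 0 + 0) (chead c 1 + 0) 0" by simp
      show ?thesis unfolding c' m Acc(1-3) by (rule U[where d = "\<lambda>_. 0", OF _ BS']) (use p lt rk in auto)
    qed
  next
    case (Cmp xs ys ds a b)
    then obtain D0 D1 R S where I: "cmpI ?Y xs ys ds D0 D1 R S" "chead c 1 = D1 - 1 - int (length R)"
      "chead c 0 = D0 - 1 - int (length S)" "\<And>Z. slide ys ds bl bl (R @ Z) = S @ slide ys ds a b Z"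
      using back_inv by auto
    have rk: "rk = 1" using back_inv Cmp by simp
    from tr[unfolded Cmp] show ?thesis
    proof (cases rule: CmpE)
      case (Col x)
      have y0: "?Y (chead c 0) = W (Col (nxt ys ds a b x))" and y1: "?Y (chead c 1) = W (Col x)"
        using Col(4,5) rd0 rd1 by simp_all
      have "cmpI ?Y xs ys ds D0 D1 (R @ [x]) (S @ [nxt ys ds a b x])"
        using I(1) y0 y1 Col(6) unfolding cmpI_def seg_append I(2,3) by auto
      moreover have "slide ys ds bl bl ((R @ [x]) @ Z) = (S @ [nxt ys ds a b x]) @ slide ys ds b x Z" for Z
        using I(4)[of "x # Z"] by simp
      ultimately have BS': "back_inv (Cmp xs ys ds b x) ?Y (chead c 0 + mv2 (-1) 0) (chead c 1 + mv2 (-1) 1) 1"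
        unfolding back_inv.simps using I(2,3)
        by (intro conjI exI[of _ D0] exI[of _ D1] exI[of _ "R @ [x]"] exI[of _ "S @ [nxt ys ds a b x]"]) (auto simp: mv2_def)
      have ne: "chead c 0 \<noteq> int n + 1" using guess_tape_isCol[OF Y, of "chead c 0"] y0 by (auto simp: isCol_def)
      show ?thesis unfolding c' m Col(1-3)
        by (rule U[where d = "mv2 (-1)", OF _ BS']) (use ne p lt p1 y1 in \<open>auto simp: mv2_def\<close>)
    next
      case End
      have y0: "?Y (chead c 0) = W (Col (nxt ys ds a b bl))" and y1: "\<not> isCol (?Y (chead c 1))"
        using End(4,5) rd0 rd1 by simp_all
      have "cmpI ?Y xs ys ds D0 D1 R (S @ [nxt ys ds a b bl])"
        using I(1) y0 y1 unfolding cmpI_def seg_append I(2,3) by auto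
      moreover have "slide ys ds bl bl R = (S @ [nxt ys ds a b bl]) @ [nxt ys ds b bl bl]"
        using I(4)[of "[]"] by simp
      ultimately have BS': "back_inv (Cmp1 ys ds b) ?Y (chead c 0 + mv 0 (-1) 0) (chead c 1 + mv 0 (-1) 1) 1"
        unfolding back_inv.simps using I(2,3) y1
        by (intro conjI exI[of _ xs] exI[of _ D0] exI[of _ D1] exI[of _ R] exI[of _ "S @ [nxt ys ds a b bl]"]) (auto simp: mv_def)
      have ne: "chead c 0 \<noteq> int n + 1" using guess_tape_isCol[OF Y, of "chead c 0"] y0 by (auto simp: isCol_def)
      show ?thesis unfolding c' m End(1-3)
        by (rule U[where d = "mv 0 (-1)", OF _ BS']) (use ne p lt rk in \<open>auto simp: mv_def\<close>)
    qed
  next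
    case (Cmp1 ys ds b)
    then obtain xs D0 D1 R S where I: "cmpI ?Y xs ys ds D0 D1 R S" "chead c 1 = D1 - 1 - int (length R)"
      "chead c 0 = D0 - 1 - int (length S)" "\<not> isCol (?Y (chead c 1))" "slide ys ds bl bl R = S @ [nxt ys ds b bl bl]"
      using back_inv by auto
    have rk: "rk = 1" using back_inv Cmp1 by simp
    from tr[unfolded Cmp1] show ?thesis
    proof (cases rule: Cmp1E)
      case Col
      have y0: "?Y (chead c 0) = W (Col (nxt ys ds b bl bl))" using Col(4) rd0 by simp
      obtain q q2 xs2 F where F: "acc_from ?Y D0" "?Y D0 = W (Del q2 xs2)" "?Y D1 = W (Del q xs)"
        "(q, xs, q2, ys, ds) \<in> delta M" "seg ?Y (D0 - 1) F" "D1 = D0 - 1 - int (length F)"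
        "seg ?Y (D1 - 1) R" "seg ?Y (D0 - 1) S" "\<forall>c \<in> set R. okc xs c" using I(1) unfolding cmpI_def by blast
      let ?S = "slide ys ds bl bl R"
      have S: "seg ?Y (D0 - 1) ?S" using F(8) y0 unfolding I(5) seg_append I(3) by simp
      have P0: "chead c 0 - 1 = D0 - 1 - int (length ?S)" using I(3,5) by simp
      have BS1: "back_inv Cmp0 ?Y (chead c 0 - 1) (chead c 1) 1"
        unfolding back_inv.simps
      proof (intro conjI impI refl)
        assume "isDel (?Y (chead c 0 - 1))"
        hence "\<not> isCol (?Y (D0 - 1 - int (length ?S)))" using P0 isDel_not_isCol by simp
        \<comment> \<open>Only now is it known that the compared columns exhaust the later
          row.\<close>
        hence FS: "F = ?S" using F(3,6) by (intro seg_unique[OF F(5) _ S]) (auto simp: isCol_def)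
        hence D1: "D1 = chead c 0 - 1" using F(6) P0 by simp
        have "acc_from ?Y D1" by (rule acc_from_step[OF F(1-7) _ F(9) FS]) (use I(2,4) in simp)
        thus "acc_from ?Y (chead c 0 - 1)" using D1 by simp
        show "\<exists>R. seg ?Y (chead c 0 - 1 - 1) R \<and> chead c 1 = chead c 0 - 1 - 1 - int (length R) \<and> \<not> isCol (?Y (chead c 1))"
          using F(7) I(2,4) D1 by auto
      qed
      have BS': "back_inv Cmp0 ?Y (chead c 0 + mv 0 (-1) 0) (chead c 1 + mv 0 (-1) 1) 1" using BS1 by (simp add: mv_def)
      have ne: "chead c 0 \<noteq> int n + 1" using guess_tape_isCol[OF Y, of "chead c 0"] y0 by (auto simp: isCol_def)
      show ?thesis unfolding c' m Col(1-3)
        by (rule U[where d = "mv 0 (-1)", OF _ BS']) (use ne p lt rk in \<open>auto simp: mv_def\<close>)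
    qed
  next
    case Acc
    from tr[unfolded Acc] show ?thesis by (cases rule: AccE)
  qed
qed

section \<open>Termination, resources and soundness\<close>

text \<open>The rank compares the phase, the remaining steps of \<open>Main\<close>, the stage of
  the sweep (2 running, 1 returning, 0 done) and the distance to go, in this order. The backward
  phase has number 0 and uses the middle entries for the head positions and
  \<open>rk\<close>.\<close>

definition Inv :: "nat \<times> nat \<times> nat \<times> nat \<Rightarrow> 'a config \<Rightarrow> bool" where
  "Inv m c \<longleftrightarrow> (\<exists>p VA VB len r. phase_inv p VA VB len r c \<and> 0 \<le> VB \<and> VB \<le> VA \<and>
     ((\<exists>z e. mainI p z e VA VB len c \<and> m = (ph p, r, 0, 0)) \<or>
      (\<exists>z e kk. retI p z e VA VB len kk c \<and> m = (ph p, r, 1, kk)) \<or>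
      (\<exists>kk. swpI p VA VB len kk c \<and> m = (ph p, r, 2, len - kk)))) \<or> backward m c"

abbreviation lex4 where "lex4 \<equiv> less_than <*lex*> less_than <*lex*> less_than <*lex*> less_than"

lemma Inv_mainI: "phase_inv p VA VB len r c \<Longrightarrow> 0 \<le> VB \<Longrightarrow> VB \<le> VA \<Longrightarrow> mainI p z e VA VB len c \<Longrightarrow> Inv (ph p, r, 0, 0) c"
  and Inv_retI: "phase_inv p VA VB len r c \<Longrightarrow> 0 \<le> VB \<Longrightarrow> VB \<le> VA \<Longrightarrow> retI p z e VA VB len kk c \<Longrightarrow> Inv (ph p, r, 1, kk) c"
  and Inv_swpI: "phase_inv p VA VB len r c \<Longrightarrow> 0 \<le> VB \<Longrightarrow> VB \<le> VA \<Longrightarrow> swpI p VA VB len kk c \<Longrightarrow> Inv (ph p, r, 2, len - kk) c"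
  unfolding Inv_def by blast+

lemma mainI_init: "mainI (P1 True) True True 0 0 0 (init_config sim_ntm w)"
  unfolding mainI_def by (auto simp: init_config_def digit_tape_Nil digits_def valA_def valB_def intro!: exI[of _ "[]"])

lemma phase_inv_init: "phase_inv (P1 True) 0 0 0 n (init_config sim_ntm w)"
  by (auto simp: init_config_def works_def ct_0 row0_def fun_eq_iff)

lemma Inv_init: "Inv (3, n, 0, 0) (init_config sim_ntm w)"
  using Inv_mainI[OF phase_inv_init _ _ mainI_init] by simp

lemma nextI_Inv:
  assumes "nextI p r c'"
  shows "\<exists>m'. Inv m' c' \<and> (m', (ph p, r, 0, 0)) \<in> lex4"
proof -
  obtain p' VA' VB' len' r' where *: "phase_inv p' VA' VB' len' r' c'" "0 \<le> VB'" "VB' \<le> VA'"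
     "swpI p' VA' VB' len' 0 c'" "ph p' < ph p \<or> ph p' = ph p \<and> r' < r"
    using assms unfolding nextI_def by blast
  have "((ph p', r', 2, len' - 0), (ph p, r, 0, 0)) \<in> lex4" using *(5) by auto
  thus ?thesis using Inv_swpI[OF *(1-4)] by blast
qed

lemma Inv_step:
  assumes I: "Inv m c" and st: "step sim_ntm c c'"
  shows "\<exists>m'. Inv m' c' \<and> (m', m) \<in> lex4"
  using I[unfolded Inv_def]
proof (elim disjE exE conjE)
  assume "backward m c"
  from backward_step[OF this st] show ?thesis unfolding Inv_def by blast
next
  fix p VA VB len r z e
  assume A: "phase_inv p VA VB len r c" "0 \<le> VB" "VB \<le> VA" "mainI p z e VA VB len c" "m = (ph p, r, 0, 0)"
  show ?thesis
  proof (cases p)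
    case (P1 b)
    from nextI_Inv[OF P1_step[OF A(1,4)[unfolded P1] st]] show ?thesis unfolding A(5) P1 .
  next
    case (P2 q)
    from nextI_Inv[OF P2_step[OF A(1,4)[unfolded P2] st A(2,3)]] show ?thesis unfolding A(5) P2 .
  next
    case P3
    from P3_step[OF A(1,4)[unfolded P3] st A(2,3)] show ?thesis
    proof
      assume "nextI P3 r c'"
      from nextI_Inv[OF this] show ?thesis unfolding A(5) P3 .
    next
      assume "\<exists>x. backward (0, x) c'"
      then obtain x where "backward (0, x) c'" ..
      hence "Inv (0, x) c'" unfolding Inv_def by blast
      moreover have "((0, x), m) \<in> lex4" unfolding A(5) P3 by simp
      ultimately show ?thesis by blast
    qed
  qed
next
  fix p VA VB len r z e kk
  assume A: "phase_inv p VA VB len r c" "0 \<le> VB" "VB \<le> VA" "retI p z e VA VB len kk c" "m = (ph p, r, 1, kk)"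
  have I': "phase_inv p VA VB len r c'" using phase_inv_cong[OF ret_step(1)[OF A(4) st]] A(1) by simp
  from ret_step(2)[OF A(4) st] show ?thesis
  proof
    assume "0 < kk \<and> retI p z e VA VB len (kk - 1) c'"
    hence "Inv (ph p, r, 1, kk - 1) c'" "((ph p, r, 1, kk - 1), m) \<in> lex4"
      using Inv_retI[OF I' A(2,3)] A(5) by auto
    thus ?thesis by blast
  next
    assume "kk = 0 \<and> mainI p z e VA VB len c'"
    hence "Inv (ph p, r, 0, 0) c'" "((ph p, r, 0, 0), m) \<in> lex4"
      using Inv_mainI[OF I' A(2,3)] A(5) by auto
    thus ?thesis by blast
  qed
next
  fix p VA VB len r kk
  assume A: "phase_inv p VA VB len r c" "0 \<le> VB" "VB \<le> VA" "swpI p VA VB len kk c" "m = (ph p, r, 2, len - kk)"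
  have I': "phase_inv p VA VB len r c'" using phase_inv_cong[OF swp_step(1)[OF A(4,2,3) st]] A(1) by simp
  from swp_step(2)[OF A(4,2,3) st] show ?thesis
  proof
    assume "kk < len \<and> swpI p VA VB len (Suc kk) c'"
    hence "Inv (ph p, r, 2, len - Suc kk) c'" "((ph p, r, 2, len - Suc kk), m) \<in> lex4"
      using Inv_swpI[OF I' A(2,3)] A(5) by auto
    thus ?thesis by blast
  next
    assume "\<exists>z e len' kk'. retI p z e VA VB len' kk' c' \<and> (len' = len \<or> len' = Suc len \<and> p \<noteq> P3 \<and> B ^ len \<le> VA)"
    then obtain z e len' kk' where R: "retI p z e VA VB len' kk' c'"
      "len' = len \<or> len' = Suc len \<and> p \<noteq> P3 \<and> B ^ len \<le> VA" by blast
    have "phase_inv p VA VB len' r c'" using R(2) I' phase_inv_Suc_len[OF I'] by auto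
    hence "Inv (ph p, r, 1, kk') c'" "((ph p, r, 1, kk'), m) \<in> lex4"
      using Inv_retI[OF _ A(2,3) R(1)] A(5) by auto
    thus ?thesis by blast
  qed
qed

lemma sim_ntm_no_infinite_run: "\<not> infinite_run sim_ntm w \<rho>"
  by (rule no_infinite_run[where Inv = Inv and r = lex4, OF _ Inv_init Inv_step]) auto

lemma sim_ntm_run_Inv: "finite_run sim_ntm w \<rho> \<Longrightarrow> c \<in> set \<rho> \<Longrightarrow> \<exists>m. Inv m c"
  by (rule finite_run_inv[where Inv = Inv, OF _ Inv_init]) (use Inv_step in blast)+

section \<open>Space, reversals and soundness\<close>

lemma phase_inv_works: "phase_inv p VA VB len r c \<Longrightarrow> \<exists>j<mt. works c (ct j)"
  using mt_pos by (cases p) (auto intro: exI[of _ 0] exI[of _ "mt - Suc 0"])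

lemma Inv_works: assumes "Inv m c" shows "\<exists>j<mt. works c (ct j)"
proof (cases "backward m c")
  case True
  thus ?thesis using mt_pos unfolding backward_def by (intro exI[of _ "mt - 1"]) auto
next
  case False
  thus ?thesis using assms phase_inv_works unfolding Inv_def by blast
qed

lemma Inv_head2: assumes "Inv m c" shows "chead c 2 \<in> {-1..int len_bound}"
  using assms unfolding Inv_def
proof (elim disjE exE conjE)
  assume "backward m c" thus ?thesis by (auto simp: backward_def)
next
  fix p VA VB len r z e kk assume A: "phase_inv p VA VB len r c" "retI p z e VA VB len kk c"
  thus ?thesis using phase_inv_len[OF A(1)] by (auto simp: retI_def)
next
  fix p VA VB len r kk assume A: "phase_inv p VA VB len r c" "swpI p VA VB len kk c"
  thus ?thesis using phase_inv_len[OF A(1)] by (auto simp: swpI_def)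
qed (auto simp: mainI_def)

text \<open>The counter head stays between \<open>- 1\<close> and \<open>len_bound\<close>, and each
  simulated work head visits only cells that the constructor visits as well.\<close>

lemma sim_ntm_space:
  assumes r: "finite_run sim_ntm w \<rho>"
  shows "(\<Sum>i=2..<N. space \<rho> i) \<le> len_bound + 2 + (\<Sum>i=2..<kT. space \<rho>t i)"
proof -
  have "(\<lambda>c. chead c 2) ` set \<rho> \<subseteq> {-1..int len_bound}"
    using sim_ntm_run_Inv[OF r] Inv_head2 by blast
  hence "card ((\<lambda>c. chead c 2) ` set \<rho>) \<le> card {-1..int len_bound}" by (rule card_mono[rotated]) simp
  hence 2: "space \<rho> 2 \<le> len_bound + 2" unfolding space_def by simp
  have i: "space \<rho> (Suc i) \<le> space \<rho>t i" if "2 \<le> i" "i < kT" for i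
  proof -
    have "(\<lambda>c. chead c (Suc i)) ` set \<rho> \<subseteq> (\<lambda>c. chead c i) ` set \<rho>t"
    proof
      fix x assume "x \<in> (\<lambda>c. chead c (Suc i)) ` set \<rho>"
      then obtain c where c: "c \<in> set \<rho>" "x = chead c (Suc i)" by blast
      then obtain j where "j < mt" "works c (ct j)" using sim_ntm_run_Inv[OF r] Inv_works by blast
      thus "x \<in> (\<lambda>c. chead c i) ` set \<rho>t" using c(2) that unfolding works_def by (metis image_eqI nth_mem)
    qed
    thus ?thesis unfolding space_def by (rule card_mono[rotated]) simp
  qed
  have "(\<Sum>i=2..<N. space \<rho> i) = space \<rho> 2 + (\<Sum>i=3..<N. space \<rho> i)"
    by (subst sum.atLeast_Suc_lessThan) (auto simp: numeral_3_eq_3 numeral_2_eq_2)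
  also have "(\<Sum>i=3..<N. space \<rho> i) = (\<Sum>i=2..<kT. space \<rho> (Suc i))"
    using sum.shift_bounds_Suc_ivl[of "space \<rho>" 2 kT] by simp
  also have "\<dots> \<le> (\<Sum>i=2..<kT. space \<rho>t i)" by (rule sum_mono) (use i in auto)
  finally show ?thesis using 2 by simp
qed

fun isF :: "'a st \<Rightarrow> bool" where
  "isF (Main p z e) = True" | "isF (Swp p ca cb app z e) = True" | "isF (Ret p z e) = True" | "isF _ = False"

text \<open>The direction goes with the target state, because \<open>P3_end\<close> leaves a forward
  state with a move to the left.\<close>

lemma tr_dir:
  assumes "tr s x q y d" "i < 2"
  shows "(isF q \<longrightarrow> d i \<in> {0, 1}) \<and> (\<not> isF q \<longrightarrow> d i \<in> {0, -1}) \<and> (\<not> isF s \<longrightarrow> \<not> isF q)"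
  using assms by (cases rule: tr.cases) (auto simp: mv_def mv2_def)

lemma sim_ntm_rev_count:
  assumes r: "finite_run sim_ntm w \<rho>" and i: "i < 2"
  shows "rev_count \<rho> i \<le> 1"
proof -
  define F where "F c \<longleftrightarrow> (\<exists>s :: 'a st. cstate c = to_nat s \<and> isF s)" for c :: "'a config"
  have st: "(F (\<rho> ! Suc j) \<longrightarrow> chead (\<rho> ! Suc j) i - chead (\<rho> ! j) i \<in> {0, 1}) \<and>
      (\<not> F (\<rho> ! Suc j) \<longrightarrow> chead (\<rho> ! Suc j) i - chead (\<rho> ! j) i \<in> {0, -1}) \<and> (\<not> F (\<rho> ! j) \<longrightarrow> \<not> F (\<rho> ! Suc j))"
    if "Suc j < length \<rho>" for j
  proof -
    have s: "step sim_ntm (\<rho> ! j) (\<rho> ! Suc j)" using r that unfolding finite_run_def successively_nth by blast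
    then obtain q where q: "cstate (\<rho> ! j) = to_nat (q :: 'a st)" unfolding sim_ntm_def step_make_ntm by blast
    obtain q' y d where t: "tr q (rd N (\<rho> ! j)) q' y d" "\<rho> ! Suc j = upd N (to_nat q') y d (\<rho> ! j)"
      using stepE[OF s q] by blast
    have "chead (\<rho> ! Suc j) i - chead (\<rho> ! j) i = d i" using t(2) i less_le_trans[OF i kT_gt(3)] by simp
    moreover have "F (\<rho> ! Suc j) = isF q'" "F (\<rho> ! j) = isF q" unfolding F_def q t(2) by auto
    ultimately show ?thesis using tr_dir[OF t(1) i] by simp
  qed
  show ?thesis
    \<comment> \<open>Step \<open>j\<close> is judged by its target; the conjunct on the length
      covers the missing target after the last configuration.\<close>
    by (rule rev_count_le_1[where G = "\<lambda>j. Suc j < length \<rho> \<and> F (\<rho> ! Suc j)"]) (use st in auto)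
qed

lemma sim_ntm_sound:
  assumes r: "finite_run sim_ntm w \<rho>" and a: "cstate (last \<rho>) = to_nat (Acc :: 'a st)"
  shows "acc c0"
proof -
  have "last \<rho> \<in> set \<rho>" using r by (auto simp: finite_run_def)
  then obtain m where "Inv m (last \<rho>)" using sim_ntm_run_Inv[OF r] by blast
  hence "backward m (last \<rho>)" using a unfolding Inv_def mainI_def retI_def swpI_def by auto
  thus ?thesis using a unfolding backward_def by auto
qed

section \<open>Completeness\<close>

lemma P1_progress:
  assumes I: "phase_inv (P1 b) VA VB len r c" and m: "mainI (P1 b) z e VA VB len c" and v: "valid c"
  shows "\<exists>p ca cb app c'. p \<noteq> P3 \<and> step sim_ntm c c' \<and> cstate c' = to_nat (Swp p ca cb app True True :: 'a st)"
proof -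
  obtain h where h: "h \<le> n" "b = (h = 0)" "chead c 0 = int h" "ctape c 0 = word_tape w" using I by auto
  have cs: "cstate c = to_nat (Main (P1 b) z e :: 'a st)" using m by (simp add: mainI_def)
  have rd0: "rd N c 0 = word_tape w (int h)" using h by simp
  have k: "0 < kM" using wfM by (auto simp: wf_ntm_def)
  have cols: "col0 f s \<in> Cols" if "s \<in> alphabet M" for f s
    using that wfM by (auto simp: col0_def Cols_def wf_ntm_def)
  have al: "Inp a \<in> alphabet M" "Blank \<in> alphabet M" for a using wfM by (auto simp: wf_ntm_def)
  have ph: "P1 False \<in> phases" "P2 (start Mt) \<in> phases" using wfT by (auto simp: phases_def wf_ntm_def)
  show ?thesis
  proof (cases "h < n")
    case True
    hence "rd N c 0 = Inp (w ! h)" using rd0 by (simp add: word_tape_def)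
    note t = P1_inp[where x = "rd N c", OF this, of b z e]
    have "step sim_ntm c (upd N (to_nat (Swp (P1 False) 1 0 False True True :: 'a st))
       ((rd N c)(1 := W (Col (col0 b (Inp (w ! h)))))) (mv2 1) c)"
      by (rule valid_stepI[OF v cs _ t]) (use ph cols al validD(4)[OF v] in \<open>auto simp: Q_iffs \<Sigma>_iffs mv2_def\<close>)
    thus ?thesis using upd_simps(1) by blast
  next
    case False
    hence "rd N c 0 = Blank" using rd0 h by (simp add: word_tape_def)
    note t = P1_end[where x = "rd N c", OF this, of b z e]
    have "step sim_ntm c (upd N (to_nat (Swp (P2 (start Mt)) 1 1 True True True :: 'a st))
       ((rd N c)(1 := W (Col (col0 b Blank)))) (mv2 1) c)"
      by (rule valid_stepI[OF v cs _ t]) (use ph cols al validD(4)[OF v] in \<open>auto simp: Q_iffs \<Sigma>_iffs mv2_def\<close>)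
    thus ?thesis using upd_simps(1) by blast
  qed
qed

lemma P2_progress:
  assumes m: "mainI (P2 q) z e VA VB len c" and v: "valid c"
    and t: "rdt z e (rd N c) xs" "(q, xs, q', ys, ds) \<in> delta Mt"
  shows "\<exists>p ca cb app c'. p \<noteq> P3 \<and> step sim_ntm c c' \<and> cstate c' = to_nat (Swp p ca cb app True True :: 'a st)"
proof -
  have cs: "cstate c = to_nat (Main (P2 q) z e :: 'a st)" using m by (simp add: mainI_def)
  note wd = wf_deltaD[OF wfT t(2)]
  have ds: "ds ! i \<in> {-1, 0, 1}" "ys ! i \<in> alphabet Mt" if "i < kT" for i
    using wd(5-8) that by (metis nth_mem subsetD)+
  have ph: "P2 q' \<in> phases" using wd(2) by (auto simp: phases_def)
  have "step sim_ntm c (upd N (to_nat (Swp (P2 q') 0 (ds ! 0) (ys ! 1 = Inp () \<and> ds ! 1 = 1) True True :: 'a st))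
     (\<lambda>i. if 3 \<le> i then emb (ys ! (i - 1)) else rd N c i) (\<lambda>i. if 3 \<le> i then ds ! (i - 1) else 0) c)"
  proof (rule valid_stepI[OF v cs _ tr.P2_step[OF t]])
    show "Swp (P2 q') 0 (ds ! 0) (ys ! 1 = Inp () \<and> ds ! 1 = 1) True True \<in> Q"
      using ph ds(1)[of 0] by (simp add: Q_iffs)
    fix i assume i: "i < N"
    show "(if 3 \<le> i then emb (ys ! (i - 1)) else rd N c i) \<in> \<Sigma>"
      using ds(2)[of "i - 1"] i \<Sigma>_iffs(6) validD(3)[OF v i] by auto
    show "(if 3 \<le> i then ds ! (i - 1) else 0) \<in> {-1, 0, 1}" using ds(1)[of "i - 1"] i by auto
  qed
  thus ?thesis using upd_simps(1) by blast
qed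

text \<open>Each round lowers \<open>(ph p, r)\<close>. The induction stops when \<open>Main\<close>
  cannot enter a sweep of a phase other than \<open>P3\<close>, which means that the constructor has
  halted.\<close>

lemma reach_P2_end:
  assumes "p \<noteq> P3" "phase_inv p VA VB len r c" "0 \<le> VB" "VB \<le> VA" "mainI p z e VA VB len c" "valid c"
  shows "\<exists>d q z e VA VB len r. (step sim_ntm)\<^sup>*\<^sup>* c d \<and> valid d \<and> phase_inv (P2 q) VA VB len r d \<and> 0 \<le> VB \<and> VB \<le> VA \<and>
    mainI (P2 q) z e VA VB len d \<and> (\<nexists>xs q' ys ds. rdt z e (rd N d) xs \<and> (q, xs, q', ys, ds) \<in> delta Mt)"
proof -
  have "wf (less_than <*lex*> less_than)" by auto
  thus ?thesis using assms
  proof (induction "(ph p, r)" arbitrary: p r c VA VB len z e rule: wf_induct_rule)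
    case less
    note P = less.prems
    show ?case
    proof (cases "\<exists>p1 ca cb app c'. p1 \<noteq> P3 \<and> step sim_ntm c c' \<and> cstate c' = to_nat (Swp p1 ca cb app True True :: 'a st)")
      case True
      then obtain p1 ca cb app c' where c': "p1 \<noteq> P3" "step sim_ntm c c'"
        "cstate c' = to_nat (Swp p1 ca cb app True True :: 'a st)" by blast
      have "nextI p r c'"
      proof (cases p)
        case (P1 b) thus ?thesis using P1_step[OF P(2,5)[unfolded P1] c'(2)] by simp
      next
        case (P2 q) thus ?thesis using P2_step[OF P(2,5)[unfolded P2] c'(2) P(3,4)] by simp
      qed (use P(1) in simp)
      then obtain p' VA' VB' len' r' where nx: "phase_inv p' VA' VB' len' r' c'" "0 \<le> VB'" "VB' \<le> VA'"
        "swpI p' VA' VB' len' 0 c'" "ph p' < ph p \<or> ph p' = ph p \<and> r' < r" unfolding nextI_def by blast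
      have p': "p' = p1" using nx(4) c'(3) unfolding swpI_def by auto
      hence p3: "p' \<noteq> P3" using c'(1) by simp
      obtain c'' z' e' len'' where s: "(step sim_ntm)\<^sup>*\<^sup>* c' c''" "valid c''" "same_rest c' c''" "mainI p' z' e' VA' VB' len'' c''"
         "len'' = len' \<or> len'' = Suc len' \<and> p' \<noteq> P3 \<and> B ^ len' \<le> VA'"
        using swp_reach[OF nx(4,2,3) _ valid_step[OF P(6) c'(2)]] p3 by metis
      have "phase_inv p' VA' VB' len'' r' c'" using nx(1) s(5) phase_inv_Suc_len by auto
      hence I'': "phase_inv p' VA' VB' len'' r' c''" using phase_inv_cong[OF s(3)] by simp
      have "((ph p', r'), (ph p, r)) \<in> less_than <*lex*> less_than" using nx(5) by auto
      from less.hyps[OF this p3 I'' nx(2,3) s(4,2)]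
      obtain d q z e VA VB len r where d: "(step sim_ntm)\<^sup>*\<^sup>* c'' d" "valid d" "phase_inv (P2 q) VA VB len r d" "0 \<le> VB" "VB \<le> VA"
        "mainI (P2 q) z e VA VB len d" "\<nexists>xs q' ys ds. rdt z e (rd N d) xs \<and> (q, xs, q', ys, ds) \<in> delta Mt" by blast
      have "(step sim_ntm)\<^sup>*\<^sup>* c d" using c'(2) s(1) d(1) by (meson converse_rtranclp_into_rtranclp rtranclp_trans)
      thus ?thesis using d(2-7) by blast
    next
      case False
      obtain q where q: "p = P2 q"
        using P1_progress P(1,2,5,6) False by (cases p) blast+
      hence "\<nexists>xs q' ys ds. rdt z e (rd N c) xs \<and> (q, xs, q', ys, ds) \<in> delta Mt"
        using P2_progress P(5,6) False by blast
      thus ?thesis using P(2-6) unfolding q by blast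
    qed
  qed
qed

text \<open>\<open>Y\<close> is the tape to be produced, finished left of \<open>h\<close>. The
  counter holds \<open>h - 1\<close>: it stays at \<open>n + 1\<close> when the first delimiter is
  written, which leaves the heads at \<open>n + 2\<close>.\<close>

definition guess_inv :: "(int \<Rightarrow> 'a sym) \<Rightarrow> int \<Rightarrow> 'a config \<Rightarrow> bool" where
  "guess_inv Y h c \<longleftrightarrow> valid c \<and> chead c 0 = h \<and> chead c 1 = h \<and> ctape c 1 = (\<lambda>p. if p < h then Y p else Blank) \<and>
     (\<forall>p>int n. ctape c 0 p = ctape c 1 p) \<and>
     (\<exists>z e VB len. mainI P3 z e (h - 1) VB len c \<and> 0 \<le> VB \<and> VB \<le> h - 1 \<and> f + 1 \<le> len)"

lemma valid_init: "valid (init_config sim_ntm w)"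
proof -
  have "ctape (init_config sim_ntm w) i p \<in> \<Sigma>" for i p
    using init_alphabet[OF wf_sim_ntm, of w i p] unfolding sim_ntm_def by simp
  moreover have "cstate (init_config sim_ntm w) \<in> to_nat ` Q" by (simp add: init_config_def phases_def Q_iffs)
  ultimately show ?thesis unfolding valid_def by blast
qed

lemma reach_guess_inv:
  assumes Y: "\<And>p. p < 0 \<Longrightarrow> Y p = Blank" "seg Y (int n) (rowl c0 (int n) (n + 1))"
    "Y (int n + 1) = W (Del (start M) xs)" and xs: "xs \<in> Rds"
  shows "\<exists>c. (step sim_ntm)\<^sup>*\<^sup>* (init_config sim_ntm w) c \<and> guess_inv Y (int n + 2) c"
proof -
  have "P1 True \<noteq> P3" by simp
  from reach_P2_end[OF this phase_inv_init order_refl order_refl mainI_init valid_init]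
  obtain d q z e VA VB len r where d: "(step sim_ntm)\<^sup>*\<^sup>* (init_config sim_ntm w) d" "valid d" "phase_inv (P2 q) VA VB len r d" "0 \<le> VB" "VB \<le> VA"
    "mainI (P2 q) z e VA VB len d" "\<nexists>xs q' ys ds. rdt z e (rd N d) xs \<and> (q, xs, q', ys, ds) \<in> delta Mt" by blast
  obtain j where j: "j < mt" "cstate (ct j) = q" "chead d 0 = int n + 1" "chead d 1 = int n + 1"
     "ctape d 0 = word_tape w" "ctape d 1 = row0 (int n + 1)" "works d (ct j)" "VA = int n + 1"
     "VB = chead (ct j) 0 + 1" "out_count (ct j) + 1 \<le> len" using d(3) by auto
  have cs: "cstate d = to_nat (Main (P2 q) z e :: 'a st)" and ze: "z = (VB = 0)" "e = (VA = VB)"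
    using d(6) by (auto simp: mainI_def)
  have "Suc j = mt" using d(7) rdt_iff[OF j(1,7,8,9) ze] j(2) by (intro ct_sim_last[OF j(1)]) auto
  hence "mt - 1 = j" by simp
  hence flen: "f \<le> len" using out_count_last(2) j(10) by simp
  let ?y = "(rd N d)(0 := W (Del (start M) xs), 1 := W (Del (start M) xs))"
  let ?d = "upd N (to_nat (Swp P3 0 0 True True True :: 'a st)) ?y (mv2 1) d"
  have "start M \<in> states M" using wfM by (simp add: wf_ntm_def)
  hence st: "step sim_ntm d ?d"
    by (intro valid_stepI[OF d(2) cs _ P2_end[OF d(7)]])
      (auto simp: Q_iffs \<Sigma>_iffs mv2_def phases_def xs validD(4)[OF d(2)])
  have S: "swpI P3 (VA + 0) (VB + 0) (len + of_bool True) 0 ?d"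
    by (rule swpI_start[OF d(6)]) (simp_all add: mv2_def)
  have "VA < B ^ len" using d(6) valA_bounds(2) by (auto simp: mainI_def)
  also have "B ^ len \<le> B ^ (len + 1)" using B by (intro power_increasing) auto
  finally have "VA < B ^ (len + 1)" .
  then obtain c z' e' len' where c: "(step sim_ntm)\<^sup>*\<^sup>* ?d c" "valid c" "same_rest ?d c" "mainI P3 z' e' VA VB len' c" "len' = len + 1"
    using swp_reach[OF S _ _ _ valid_step[OF d(2) st]] d(4,5) by auto
  have T: "ctape c 1 = (row0 (int n + 1))(int n + 1 := W (Del (start M) xs))"
    "ctape c 0 = (word_tape w)(int n + 1 := W (Del (start M) xs))" "chead c 0 = int n + 2" "chead c 1 = int n + 2"
    using c(3) j by (simp_all add: same_rest_def mv2_def)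
  have yr: "Y p = W (Col (column c0 p))" if "0 \<le> p" "p \<le> int n" for p
  proof -
    have "nat (int n - p) < n + 1" using that by auto
    hence "Y (int n - int (nat (int n - p))) = W (Col (rowl c0 (int n) (n + 1) ! nat (int n - p)))"
      using Y(2) unfolding seg_def rowl_length by blast
    thus ?thesis using that by (simp add: rowl_def nth_append del: upt_Suc)
  qed
  have "(row0 (int n + 1))(int n + 1 := W (Del (start M) xs)) = (\<lambda>p. if p < int n + 2 then Y p else Blank)"
    using Y(1,3) yr by (auto simp: row0_def fun_eq_iff)
  moreover have "\<forall>p>int n. ctape c 0 p = ctape c 1 p" unfolding T by (auto simp: row0_def word_tape_def)
  moreover have "\<exists>z e VB len. mainI P3 z e (int n + 2 - 1) VB len c \<and> 0 \<le> VB \<and> VB \<le> int n + 2 - 1 \<and> f + 1 \<le> len"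
  proof (intro exI conjI)
    show "mainI P3 z' e' (int n + 2 - 1) VB len' c" using c(4) j(8) by (simp add: add.commute)
  qed (use c(5) d(4,5) j(8) flen in auto)
  ultimately have "guess_inv Y (int n + 2) c" unfolding guess_inv_def using c(2) T by simp
  moreover have "(step sim_ntm)\<^sup>*\<^sup>* (init_config sim_ntm w) c"
    using d(1) st c(1) by (meson converse_rtranclp_into_rtranclp rtranclp_trans)
  ultimately show ?thesis by blast
qed

text \<open>The counter has at least \<open>f + 1\<close> digits, so it cannot overflow below
  \<open>B ^ (f + 1)\<close>.\<close>

lemma guess_inv_step:
  assumes K: "guess_inv Y h c" and h: "int n + 2 \<le> h" "h < B ^ (f + 1)" and Y: "Y h \<in> \<Sigma>" "isCol (Y h) \<or> isDel (Y h)"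
  shows "\<exists>c'. (step sim_ntm)\<^sup>*\<^sup>* c c' \<and> guess_inv Y (h + 1) c'"
proof -
  obtain z e VB len where k: "valid c" "chead c 0 = h" "chead c 1 = h" "ctape c 1 = (\<lambda>p. if p < h then Y p else Blank)"
     "\<forall>p>int n. ctape c 0 p = ctape c 1 p"
     "mainI P3 z e (h - 1) VB len c" "0 \<le> VB" "VB \<le> h - 1" "f + 1 \<le> len" using K unfolding guess_inv_def by blast
  have cs: "cstate c = to_nat (Main P3 z e :: 'a st)" using k(6) by (auto simp: mainI_def)
  let ?d = "upd N (to_nat (Swp P3 1 0 False True True :: 'a st)) ((rd N c)(0 := Y h, 1 := Y h)) (mv2 1) c"
  have st: "step sim_ntm c ?d"
    by (intro valid_stepI[OF k(1) cs _ P3_guess[OF Y(2)]])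
      (auto simp: Q_iffs mv2_def phases_def Y(1) validD(4)[OF k(1)])
  have S: "swpI P3 (h - 1 + 1) (VB + 0) (len + of_bool False) 0 ?d"
    by (rule swpI_start[OF k(6)]) (simp_all add: mv2_def)
  have "B ^ (f + 1) \<le> B ^ len" using B k(9) by (intro power_increasing) auto
  hence "h < B ^ len" using h(2) by simp
  then obtain c' z' e' len' where c: "(step sim_ntm)\<^sup>*\<^sup>* ?d c'" "valid c'" "same_rest ?d c'" "mainI P3 z' e' h VB len' c'" "len' = len"
    using swp_reach[OF S _ _ _ valid_step[OF k(1) st]] k(7,8) by auto
  have T: "ctape c' 1 = (ctape c 1)(h := Y h)"
    "ctape c' 0 = (ctape c 0)(h := Y h)" "chead c' 0 = h + 1" "chead c' 1 = h + 1"
    using c(3) k by (simp_all add: same_rest_def mv2_def)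
  have "\<exists>z e VB len. mainI P3 z e (h + 1 - 1) VB len c' \<and> 0 \<le> VB \<and> VB \<le> h + 1 - 1 \<and> f + 1 \<le> len"
    using c(4,5) k(7-9) by (intro exI[of _ z'] exI[of _ e'] exI[of _ VB] exI[of _ len']) simp
  moreover have "ctape c' 1 = (\<lambda>p. if p < h + 1 then Y p else Blank)" unfolding T k(4) by auto
  moreover have "\<forall>p>int n. ctape c' 0 p = ctape c' 1 p" unfolding T using k(5) by auto
  ultimately have "guess_inv Y (h + 1) c'" unfolding guess_inv_def using c(2) T(3,4) by blast
  moreover have "(step sim_ntm)\<^sup>*\<^sup>* c c'" using st c(1) by (meson converse_rtranclp_into_rtranclp)
  ultimately show ?thesis by blast
qed

section \<open>The backward phase on a correct tape\<close>

definition back_config :: "(int \<Rightarrow> 'a sym) \<Rightarrow> 'a st \<Rightarrow> int \<Rightarrow> int \<Rightarrow> 'a config \<Rightarrow> bool" where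
  "back_config Y s p0 p1 c \<longleftrightarrow> valid c \<and> cstate c = to_nat s \<and> chead c 0 = p0 \<and> chead c 1 = p1 \<and> ctape c 1 = Y \<and>
     (\<forall>p>int n. ctape c 0 p = Y p)"

text \<open>The rule is required for all \<open>x\<close> with the right symbols on tapes 0 and 1,
  because the backward rules never look at an internal tape.\<close>

lemma back_config_step:
  assumes b: "back_config Y s p0 p1 c" and p: "int n < p0" and t: "\<And>x. x 0 = Y p0 \<Longrightarrow> x 1 = Y p1 \<Longrightarrow> tr s x s' x d"
    and q: "s' \<in> Q" and d: "\<And>i. d i \<in> {-1, 0, 1}"
  shows "\<exists>c'. step sim_ntm c c' \<and> back_config Y s' (p0 + d 0) (p1 + d 1) c'"
proof -
  have v: "valid c" and cs: "cstate c = to_nat s" using b by (auto simp: back_config_def)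
  have "tr s (rd N c) s' (rd N c) d" by (rule t) (use b p in \<open>auto simp: back_config_def\<close>)
  hence st: "step sim_ntm c (upd N (to_nat s') (rd N c) d c)"
    by (intro valid_stepI[OF v cs q]) (use d validD(3)[OF v] in auto)
  moreover have "back_config Y s' (p0 + d 0) (p1 + d 1) (upd N (to_nat s') (rd N c) d c)"
    using b valid_step[OF v st] by (simp add: back_config_def)
  ultimately show ?thesis by blast
qed

lemma Cols_of: "\<forall>i<kM. fst (x ! i) \<in> alphabet M \<Longrightarrow> length x = kM \<Longrightarrow> x \<in> Cols"
  by (force simp: Cols_def in_set_conv_nth)

lemma bl_Cols: "bl \<in> Cols" using wfM by (auto simp: bl_def Cols_def wf_ntm_def)

lemma mv_range: "mv j (-1) i \<in> {-1, 0, 1}" "mv2 (-1) i \<in> {-1, 0, 1}" "(0::int) \<in> {-1, 0, 1}"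
  by (auto simp: mv_def mv2_def)

text \<open>Induction along the earlier row; the two surplus columns of the later row are checked in
  the base case.\<close>

lemma compare_rows:
  assumes "back_config Y (Cmp xs ys ds a b) p0 p1 c" "seg Y p1 Z" "\<not> isCol (Y (p1 - int (length Z)))"
    "seg Y p0 (slide ys ds a b Z)" "int n < p0 - int (length Z) - 2" "\<forall>x \<in> set Z. okc xs x \<and> x \<in> Cols"
    "xs \<in> Rds" "ys \<in> Rds" "ds \<in> Dirs" "a \<in> Cols" "b \<in> Cols"
  shows "\<exists>c'. (step sim_ntm)\<^sup>*\<^sup>* c c' \<and> back_config Y Cmp0 (p0 - int (length Z) - 2) (p1 - int (length Z)) c'"
  using assms
proof (induction Z arbitrary: a b p0 p1 c)
  case Nil
  have y: "Y p0 = W (Col (nxt ys ds a b bl))" "Y (p0 - 1) = W (Col (nxt ys ds b bl bl))"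
    using Nil.prems(4) by (force simp: seg_def)+
  have t: "tr (Cmp xs ys ds a b) x (Cmp1 ys ds b) x (mv 0 (-1))" if "x 0 = Y p0" "x 1 = Y p1" for x
    by (rule Cmp_e1) (use that y Nil.prems(3) in auto)
  have n0: "int n < p0" using Nil.prems(5) by simp
  obtain c1 where c1: "step sim_ntm c c1" "back_config Y (Cmp1 ys ds b) (p0 + mv 0 (-1) 0) (p1 + mv 0 (-1) 1) c1"
    using back_config_step[OF Nil.prems(1) n0 t _ mv_range(1)] Nil.prems by (auto simp: Q_iffs)
  have c1': "back_config Y (Cmp1 ys ds b) (p0 - 1) p1 c1" using c1(2) by (simp add: mv_def)
  have t: "tr (Cmp1 ys ds b) x Cmp0 x (mv 0 (-1))" if "x 0 = Y (p0 - 1)" "x 1 = Y p1" for x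
    by (rule Cmp_e2) (use that y in auto)
  have n1: "int n < p0 - 1" using Nil.prems(5) by simp
  obtain c2 where c2: "step sim_ntm c1 c2" "back_config Y Cmp0 (p0 - 1 + mv 0 (-1) 0) (p1 + mv 0 (-1) 1) c2"
    using back_config_step[OF c1' n1 t _ mv_range(1)] by (auto simp: Q_iffs)
  have "back_config Y Cmp0 (p0 - 2) p1 c2" using c2(2) by (simp add: mv_def)
  moreover have "(step sim_ntm)\<^sup>*\<^sup>* c c2" using c1(1) c2(1) by (meson r_into_rtranclp rtranclp_trans)
  ultimately show ?case by auto
next
  case (Cons z Z)
  have y: "Y p0 = W (Col (nxt ys ds a b z))" "Y p1 = W (Col z)"
    using Cons.prems(2,4) by (force simp: seg_def)+
  have sh: "seg Y (p - 1) R" if "seg Y p (x # R)" for p x R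
    unfolding seg_def
  proof (intro allI impI)
    fix i assume "i < length R"
    hence "Y (p - int (Suc i)) = W (Col ((x # R) ! Suc i))" using that unfolding seg_def by (metis Suc_less_eq length_Cons)
    thus "Y (p - 1 - int i) = W (Col (R ! i))" by (simp add: algebra_simps)
  qed
  have t: "tr (Cmp xs ys ds a b) x (Cmp xs ys ds b z) x (mv2 (-1))" if "x 0 = Y p0" "x 1 = Y p1" for x
    by (rule Cmp_col) (use that y Cons.prems(6) in auto)
  have n0: "int n < p0" using Cons.prems(5) by simp
  obtain c1 where c1: "step sim_ntm c c1" "back_config Y (Cmp xs ys ds b z) (p0 + mv2 (-1) 0) (p1 + mv2 (-1) 1) c1"
    using back_config_step[OF Cons.prems(1) n0 t _ mv_range(2)] Cons.prems by (auto simp: Q_iffs)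
  have c1': "back_config Y (Cmp xs ys ds b z) (p0 - 1) (p1 - 1) c1" using c1(2) by (simp add: mv2_def)
  have "\<exists>c'. (step sim_ntm)\<^sup>*\<^sup>* c1 c' \<and> back_config Y Cmp0 (p0 - 1 - int (length Z) - 2) (p1 - 1 - int (length Z)) c'"
  proof (rule Cons.IH[OF c1'])
    show "seg Y (p1 - 1) Z" by (rule sh[OF Cons.prems(2)])
    show "\<not> isCol (Y (p1 - 1 - int (length Z)))" using Cons.prems(3) by (simp add: algebra_simps)
    show "seg Y (p0 - 1) (slide ys ds b z Z)" using sh[of p0] Cons.prems(4) by simp
  qed (use Cons.prems in auto)
  then obtain c' where "(step sim_ntm)\<^sup>*\<^sup>* c1 c'" "back_config Y Cmp0 (p0 - int (length (z # Z)) - 2) (p1 - int (length (z # Z))) c'"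
    by (auto simp: algebra_simps)
  thus ?case using c1(1) by (meson converse_rtranclp_into_rtranclp)
qed

lemma skip_row:
  assumes "back_config Y (Skip xs) p0 p1 c" "seg Y p1 Z" "\<not> isCol (Y (p1 - int (length Z)))" "int n < p0"
    "\<forall>x \<in> set Z. okc xs x" "xs \<in> Rds"
  shows "\<exists>c'. (step sim_ntm)\<^sup>*\<^sup>* c c' \<and> back_config Y Cmp0 p0 (p1 - int (length Z)) c'"
  using assms
proof (induction Z arbitrary: p1 c)
  case Nil
  have t: "tr (Skip xs) x Cmp0 x (\<lambda>_. 0)" if "x 0 = Y p0" "x 1 = Y p1" for x
    by (rule Skip_end) (use that Nil.prems(3) in auto)
  obtain c1 where c1: "step sim_ntm c c1" "back_config Y Cmp0 (p0 + 0) (p1 + 0) c1"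
    using back_config_step[OF Nil.prems(1,4) t _ mv_range(3)] by (auto simp: Q_iffs)
  thus ?case by auto
next
  case (Cons z Z)
  have y: "Y p1 = W (Col z)" using Cons.prems(2) by (force simp: seg_def)
  have t: "tr (Skip xs) x (Skip xs) x (mv 1 (-1))" if "x 0 = Y p0" "x 1 = Y p1" for x
    by (rule Skip_col) (use that y Cons.prems(5) in auto)
  obtain c1 where c1: "step sim_ntm c c1" "back_config Y (Skip xs) (p0 + mv 1 (-1) 0) (p1 + mv 1 (-1) 1) c1"
    using back_config_step[OF Cons.prems(1,4) t _ mv_range(1)] Cons.prems(6) by (auto simp: Q_iffs)
  have c1': "back_config Y (Skip xs) p0 (p1 - 1) c1" using c1(2) by (simp add: mv_def)
  have sh: "seg Y (p1 - 1) Z"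
    unfolding seg_def
  proof (intro allI impI)
    fix i assume "i < length Z"
    hence "Y (p1 - int (Suc i)) = W (Col ((z # Z) ! Suc i))"
      using Cons.prems(2) unfolding seg_def by (metis Suc_less_eq length_Cons)
    thus "Y (p1 - 1 - int i) = W (Col (Z ! i))" by (simp add: algebra_simps)
  qed
  have "\<exists>c'. (step sim_ntm)\<^sup>*\<^sup>* c1 c' \<and> back_config Y Cmp0 p0 (p1 - 1 - int (length Z)) c'"
    by (rule Cons.IH[OF c1' sh]) (use Cons.prems in \<open>auto simp: algebra_simps\<close>)
  then obtain c' where "(step sim_ntm)\<^sup>*\<^sup>* c1 c'" "back_config Y Cmp0 p0 (p1 - int (length (z # Z))) c'"
    by (auto simp: algebra_simps)
  thus ?case using c1(1) by (meson converse_rtranclp_into_rtranclp)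
qed

section \<open>The tape of a given run, row \<open>j\<close> covering the cells
  \<open>- int j\<close> to \<open>int n + int j\<close>\<close>

definition rowlen :: "nat \<Rightarrow> nat" where "rowlen j = n + 1 + 2 * j"

definition delim :: "'a config \<Rightarrow> 'a sym" where
  "delim c = W (Del (cstate c) (map (reads c) [0..<kM]))"

definition rowlist :: "(nat \<Rightarrow> 'a config) \<Rightarrow> nat \<Rightarrow> 'a sym list" where
  "rowlist g j = rev (map (\<lambda>x. W (Col x)) (rowl (g j) (int n + int j) (rowlen j))) @ [delim (g j)]"

fun tape :: "(nat \<Rightarrow> 'a config) \<Rightarrow> nat \<Rightarrow> 'a sym list" where
  "tape g 0 = rowlist g 0"
| "tape g (Suc j) = tape g j @ rowlist g (Suc j)"

text \<open>The cell of the delimiter of row \<open>j\<close>.\<close>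

fun row_end :: "nat \<Rightarrow> nat" where "row_end 0 = n + 1" | "row_end (Suc j) = row_end j + rowlen (Suc j) + 1"

definition list_tape :: "'a sym list \<Rightarrow> int \<Rightarrow> 'a sym" where
  "list_tape xs p = (if 0 \<le> p \<and> p < int (length xs) then xs ! nat p else Blank)"

lemma rowlist_length [simp]: "length (rowlist g j) = Suc (rowlen j)" by (simp add: rowlist_def)

lemma tape_length: "length (tape g j) = Suc (row_end j)"
  by (induction j) (auto simp: rowlen_def)

lemma list_tape_append: "p < int (length xs) \<Longrightarrow> list_tape (xs @ ys) p = list_tape xs p"
  by (auto simp: list_tape_def nth_append)

lemma list_tape_append_right: "i < length ys \<Longrightarrow> list_tape (xs @ ys) (int (length xs) + int i) = ys ! i"
  by (auto simp: list_tape_def nth_append nat_add_distrib)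

lemma rowlist_nth:
  "i < rowlen j \<Longrightarrow> rowlist g j ! (rowlen j - 1 - i) = W (Col (rowl (g j) (int n + int j) (rowlen j) ! i))"
  "rowlist g j ! rowlen j = delim (g j)"
  by (auto simp: rowlist_def nth_append rev_nth)

lemma rowlen_le_row_end: "rowlen j \<le> row_end j" by (cases j) (auto simp: rowlen_def)

lemma tape_last:
  "list_tape (tape g j) (int (row_end j)) = delim (g j)"
  "seg (list_tape (tape g j)) (int (row_end j) - 1) (rowl (g j) (int n + int j) (rowlen j))"
proof -
  obtain pre where pre: "tape g j = pre @ rowlist g j" "length pre = row_end j - rowlen j"
  proof (cases j)
    case 0 thus ?thesis using that[of "[]"] by (simp add: rowlen_def)
  next
    case (Suc i) thus ?thesis using that[of "tape g i"] tape_length[of g i] by simp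
  qed
  have Dj: "int (row_end j) = int (length pre) + int (rowlen j)" using pre(2) rowlen_le_row_end[of j] by simp
  show "list_tape (tape g j) (int (row_end j)) = delim (g j)"
    unfolding pre(1) Dj by (subst list_tape_append_right) (auto simp: rowlist_nth)
  show "seg (list_tape (tape g j)) (int (row_end j) - 1) (rowl (g j) (int n + int j) (rowlen j))"
    unfolding seg_def
  proof (intro allI impI)
    fix i assume "i < length (rowl (g j) (int n + int j) (rowlen j))"
    hence i: "i < rowlen j" by simp
    have "int (row_end j) - 1 - int i = int (length pre) + int (rowlen j - 1 - i)" unfolding Dj using i by auto
    thus "list_tape (tape g j) (int (row_end j) - 1 - int i) = W (Col (rowl (g j) (int n + int j) (rowlen j) ! i))"
      unfolding pre(1) using list_tape_append_right[of "rowlen j - 1 - i" "rowlist g j" pre] rowlist_nth(1)[OF i] by simp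
  qed
qed

lemma tape_prefix: "j \<le> m \<Longrightarrow> p \<le> int (row_end j) \<Longrightarrow> list_tape (tape g m) p = list_tape (tape g j) p"
proof (induction m)
  case (Suc m)
  show ?case
  proof (cases "j = Suc m")
    case False
    hence jm: "j \<le> m" using Suc.prems(1) by simp
    have "row_end j \<le> row_end m" by (rule lift_Suc_mono_le[OF _ jm]) simp
    hence "p < int (length (tape g m))" using Suc.prems(2) tape_length[of g m] by simp
    hence "list_tape (tape g (Suc m)) p = list_tape (tape g m) p" unfolding tape.simps by (rule list_tape_append)
    thus ?thesis using Suc.IH[OF jm Suc.prems(2)] by simp
  qed simp
qed simp

lemma tape_row:
  assumes "j \<le> m"
  shows "list_tape (tape g m) (int (row_end j)) = delim (g j)"
    "seg (list_tape (tape g m)) (int (row_end j) - 1) (rowl (g j) (int n + int j) (rowlen j))"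
  using tape_prefix[OF assms, of "int (row_end j)" g] tape_last[of g j] tape_prefix[OF assms, of _ g]
  by (auto simp: seg_def)

lemma tape_set: "x \<in> set (tape g m) \<Longrightarrow> \<exists>j\<le>m. x = delim (g j) \<or> (\<exists>p. x = W (Col (column (g j) p)))"
proof (induction m)
  case (Suc m)
  thus ?case by (fastforce simp: rowlist_def rowl_def le_Suc_eq)
qed (auto simp: rowlist_def rowl_def)

text \<open>The simulator guesses exactly \<open>tape g m\<close>. The bound on
  \<open>row_end m\<close> prevents an overflow, and every comparison succeeds because consecutive
  rows are related by \<open>slide\<close>.\<close>

lemma sim_ntm_complete:
  fixes g :: "nat \<Rightarrow> 'a config"
  assumes g0: "g 0 = c0" and gs: "\<And>j. j < m \<Longrightarrow> step M (g j) (g (Suc j))"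
    and fin: "final_config M (g m)" "cstate (g m) \<in> accepting M"
    and len: "int (row_end m) + 1 < B ^ (f + 1)"
  shows "\<exists>c. (step sim_ntm)\<^sup>*\<^sup>* (init_config sim_ntm w) c \<and> final_config sim_ntm c \<and> cstate c = to_nat (Acc :: 'a st)"
proof -
  let ?Y = "list_tape (tape g m)"
  have reach: "j \<le> m \<Longrightarrow> (step M)\<^sup>*\<^sup>* c0 (g j)" for j
  proof (induction j)
    case (Suc j) thus ?case using gs[of j] by (meson Suc_leD Suc_le_eq rtranclp.rtrancl_into_rtrancl)
  qed (simp add: g0)
  have alph: "ctape (g j) i p \<in> alphabet M" if "j \<le> m" "i < kM" for i j p
    by (rule steps_alphabet[OF wfM reach[OF that(1)] _ that(2)]) (rule init_alphabet[OF wfM])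
  have cst: "cstate (g j) \<in> states M" if "j \<le> m" for j
  proof (cases j)
    case 0 thus ?thesis using wfM by (simp add: g0 init_config_def wf_ntm_def)
  next
    case (Suc i) thus ?thesis using step_state[OF wfM gs[of i]] that by simp
  qed
  have cols: "column (g j) p \<in> Cols" if "j \<le> m" for j p
    by (rule Cols_of) (use alph[OF that] in \<open>auto simp: column_def\<close>)
  have rds: "map (reads (g j)) [0..<kM] \<in> Rds" if "j \<le> m" for j
    using alph[OF that] by (auto simp: Rds_def reads_def)
  have sym: "x \<in> \<Sigma> \<and> (isCol x \<or> isDel x)" if "x \<in> set (tape g m)" for x
    using tape_set[OF that] cols cst rds by (auto simp: delim_def \<Sigma>_iffs isCol_def isDel_def)
  have row0: "seg ?Y (int n) (rowl c0 (int n) (n + 1))"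
    using tape_row(2)[of 0 m g] by (simp add: g0 rowlen_def)
  have del0: "?Y (int n + 1) = W (Del (start M) (map (reads c0) [0..<kM]))"
    using tape_row(1)[of 0 m g] by (simp add: g0 delim_def init_config_def add.commute)
  have neg: "?Y p = Blank" if "p < 0" for p using that by (simp add: list_tape_def)
  obtain k0 where k0: "(step sim_ntm)\<^sup>*\<^sup>* (init_config sim_ntm w) k0" "guess_inv ?Y (int n + 2) k0"
    using reach_guess_inv[of ?Y, OF neg row0 del0] rds[of 0] g0 by auto
  have D0: "n + 1 \<le> row_end j" for j by (induction j) auto
  have kg: "\<exists>c. (step sim_ntm)\<^sup>*\<^sup>* (init_config sim_ntm w) c \<and> guess_inv ?Y (int n + 2 + int i) c" if "n + 2 + i \<le> row_end m + 1" for i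
    using that
  proof (induction i)
    case 0 thus ?case using k0 by auto
  next
    case (Suc i)
    then obtain c where c: "(step sim_ntm)\<^sup>*\<^sup>* (init_config sim_ntm w) c" "guess_inv ?Y (int n + 2 + int i) c" by auto
    have "?Y (int n + 2 + int i) \<in> set (tape g m)"
      using Suc.prems tape_length[of g m] by (simp add: list_tape_def)
    from sym[OF this] have "\<exists>c'. (step sim_ntm)\<^sup>*\<^sup>* c c' \<and> guess_inv ?Y (int n + 2 + int i + 1) c'"
      using Suc.prems len by (intro guess_inv_step[OF c(2)]) auto
    moreover have "int n + 2 + int (Suc i) = int n + 2 + int i + 1" by simp
    ultimately show ?case using c(1) by (metis rtranclp_trans)
  qed
  have "n + 2 + (row_end m - (n + 1)) \<le> row_end m + 1" using D0[of m] by simp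
  moreover have "int n + 2 + int (row_end m - (n + 1)) = int (row_end m) + 1" using D0[of m] by simp
  ultimately obtain c where c: "(step sim_ntm)\<^sup>*\<^sup>* (init_config sim_ntm w) c" "guess_inv ?Y (int (row_end m) + 1) c"
    using kg by metis
  have Yend: "(\<lambda>p. if p < int (row_end m) + 1 then ?Y p else Blank) = ?Y"
    using tape_length[of g m] by (auto simp: list_tape_def fun_eq_iff)
  obtain z e VB le where k: "valid c" "chead c 0 = int (row_end m) + 1" "chead c 1 = int (row_end m) + 1" "ctape c 1 = ?Y"
     "\<forall>p>int n. ctape c 0 p = ?Y p" "mainI P3 z e (int (row_end m)) VB le c"
    using c(2) unfolding guess_inv_def Yend by auto
  have b0: "back_config ?Y (Main P3 z e) (int (row_end m) + 1) (int (row_end m) + 1) c"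
    using k by (auto simp: back_config_def mainI_def)
  let ?row_end = "\<lambda>j. int (row_end j)"
  \<comment> \<open>The first cell left of row \<open>j\<close>: the delimiter of row
    \<open>j - 1\<close>, or cell \<open>- 1\<close> for the first row.\<close>
  let ?E = "\<lambda>j. int (row_end j) - 1 - int (rowlen j)"
  have nD: "int n < ?row_end j" for j using D0[of j] by simp
  obtain c1 where c1: "step sim_ntm c c1" "back_config ?Y Skip0 (?row_end m + 1 + mv2 (-1) 0) (?row_end m + 1 + mv2 (-1) 1) c1"
    using back_config_step[OF b0 _ P3_end _ mv_range(2)] nD[of m] by (auto simp: Q_iffs)
  have b1: "back_config ?Y Skip0 (?row_end m) (?row_end m) c1" using c1(2) by (simp add: mv2_def)
  let ?xs = "\<lambda>j. map (reads (g j)) [0..<kM]"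
  have delm: "?Y (?row_end j) = W (Del (cstate (g j)) (?xs j))" if "j \<le> m" for j
    using tape_row(1)[OF that, of g] by (simp add: delim_def)
  have nodelta: "\<nexists>q' ys ds. (cstate (g m), ?xs m, q', ys, ds) \<in> delta M"
    using fin(1) unfolding final_config_def step_upd by blast
  have t2: "tr Skip0 x (Skip (?xs m)) x (mv 1 (-1))" if "x 0 = ?Y (?row_end m)" "x 1 = ?Y (?row_end m)" for x
    by (rule Skip0[OF _ _ fin(2) nodelta]) (use that delm[of m] in auto)
  obtain c2 where c2: "step sim_ntm c1 c2" "back_config ?Y (Skip (?xs m)) (?row_end m + mv 1 (-1) 0) (?row_end m + mv 1 (-1) 1) c2"
    using back_config_step[OF b1 nD t2 _ mv_range(1)] rds[of m] by (auto simp: Q_iffs)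
  have b2: "back_config ?Y (Skip (?xs m)) (?row_end m) (?row_end m - 1) c2" using c2(2) by (simp add: mv_def)
  have win: "inwin (g j) (int n + int j) (rowlen j)" if "j \<le> m" for j
    using that
  proof (induction j)
    case 0
    show ?case by (auto simp: inwin_def g0 init_config_def word_tape_def rowlen_def)
  next
    case (Suc j)
    then obtain q' ys ds where t: "(cstate (g j), ?xs j, q', ys, ds) \<in> delta M"
      "g (Suc j) = upd kM q' ((!) ys) ((!) ds) (g j)" using gs[of j] unfolding step_upd by auto
    have ds: "ds ! i \<in> {-1, 0, 1}" if "i < kM" for i using wf_deltaD(7,8)[OF wfM t(1)] that by (metis nth_mem subsetD)
    have "inwin (g (Suc j)) (int n + int j + 1) (rowlen j + 2)"
      unfolding t(2) by (rule slide_inwin(2)[OF ds]) (use Suc in auto)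
    thus ?case by (simp add: rowlen_def algebra_simps)
  qed
  have okr: "\<forall>x \<in> set (rowl (g j) (int n + int j) (rowlen j)). okc (?xs j) x \<and> x \<in> Cols" if "j \<le> m" for j
    using okc_reads[OF win[OF that], of "?xs j"] cols[OF that] by (auto simp: rowl_def)
  have E: "?E (Suc j) = ?row_end j" for j by simp
  have nc: "\<not> isCol (?Y (?E j))" if "j \<le> m" for j
  proof (cases j)
    case 0 thus ?thesis using neg[of "-1"] by (simp add: rowlen_def isCol_def)
  next
    case (Suc i) thus ?thesis using delm[of i] that E[of i] by (simp add: isCol_def)
  qed
  obtain c3 where c3: "(step sim_ntm)\<^sup>*\<^sup>* c2 c3" "back_config ?Y Cmp0 (?row_end m) (?E m) c3"
    using skip_row[OF b2 tape_row(2)[OF order_refl] _ nD] nc[of m] okr[of m] rds[of m] by auto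
  have "(step sim_ntm)\<^sup>*\<^sup>* c c3" using c1(1) c2(1) c3(1) by (meson converse_rtranclp_into_rtranclp)
  hence r3: "(step sim_ntm)\<^sup>*\<^sup>* (init_config sim_ntm w) c3" using c(1) by (meson rtranclp_trans)
  have rows: "i \<le> m \<Longrightarrow> \<exists>d. (step sim_ntm)\<^sup>*\<^sup>* (init_config sim_ntm w) d \<and> back_config ?Y Cmp0 (?row_end i) (?E i) d" for i
  proof (induction i rule: inc_induct)
    case base thus ?case using r3 c3(2) by blast
  next
    case (step i)
    then obtain d where d: "(step sim_ntm)\<^sup>*\<^sup>* (init_config sim_ntm w) d" "back_config ?Y Cmp0 (?row_end (Suc i)) (?row_end i) d" using E by auto
    have im: "i \<le> m" "Suc i \<le> m" using step.hyps by auto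
    obtain q' ys ds where t: "(cstate (g i), ?xs i, q', ys, ds) \<in> delta M"
      "g (Suc i) = upd kM q' ((!) ys) ((!) ds) (g i)" using gs[of i] step.hyps unfolding step_upd by auto
    note wd = wf_deltaD[OF wfM t(1)]
    have ds: "ds ! l \<in> {-1, 0, 1}" if "l < kM" for l using wd(7,8) that by (metis nth_mem subsetD)
    have Qs: "?xs i \<in> Rds" "ys \<in> Rds" "ds \<in> Dirs" using wd rds[OF im(1)] by (auto simp: Rds_def Dirs_def)
    have q': "cstate (g (Suc i)) = q'" using t(2) by simp
    have t1: "tr Cmp0 x (Cmp (?xs i) ys ds bl bl) x (mv2 (-1))" if "x 0 = ?Y (?row_end (Suc i))" "x 1 = ?Y (?row_end i)" for x
      by (rule Cmp_start) (use that delm[OF im(1)] delm[OF im(2)] t(1) q' in auto)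
    obtain d1 where d1: "step sim_ntm d d1"
      "back_config ?Y (Cmp (?xs i) ys ds bl bl) (?row_end (Suc i) + mv2 (-1) 0) (?row_end i + mv2 (-1) 1) d1"
      using back_config_step[OF d(2) nD t1 _ mv_range(2)] Qs bl_Cols by (auto simp: Q_iffs)
    have b: "back_config ?Y (Cmp (?xs i) ys ds bl bl) (?row_end (Suc i) - 1) (?row_end i - 1) d1" using d1(2) by (simp add: mv2_def)
    have rl: "rowlen (Suc i) = rowlen i + 2" by (simp add: rowlen_def)
    have sl: "slide ys ds bl bl (rowl (g i) (int n + int i) (rowlen i)) = rowl (g (Suc i)) (int n + int (Suc i)) (rowlen (Suc i))"
      using slide_inwin(1)[OF ds win[OF im(1)], of ys q'] unfolding rl t(2) by (simp add: add.commute add.left_commute)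
    have "\<exists>c'. (step sim_ntm)\<^sup>*\<^sup>* d1 c' \<and> back_config ?Y Cmp0 (?row_end (Suc i) - 1 - int (length (rowl (g i) (int n + int i) (rowlen i))) - 2)
        (?row_end i - 1 - int (length (rowl (g i) (int n + int i) (rowlen i)))) c'"
      by (rule compare_rows[OF b tape_row(2)[OF im(1)]])
        (use nc[OF im(1)] tape_row(2)[OF im(2), of g] okr[OF im(1)] Qs bl_Cols nD[of i] rl in \<open>auto simp: sl\<close>)
    then obtain d2 where "(step sim_ntm)\<^sup>*\<^sup>* d1 d2" "back_config ?Y Cmp0 (?row_end i) (?E i) d2" using rl by auto
    thus ?case using d(1) d1(1) by (meson converse_rtranclp_into_rtranclp rtranclp_trans)
  qed
  then obtain d where d: "(step sim_ntm)\<^sup>*\<^sup>* (init_config sim_ntm w) d" "back_config ?Y Cmp0 (?row_end 0) (?E 0) d" by blast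
  have "isDel (?Y (?row_end 0))" using delm[of 0] by (auto simp: isDel_def)
  moreover have "?Y (?E 0) = Blank" by (rule neg) (simp add: rowlen_def)
  ultimately have t0: "tr Cmp0 x Acc x (\<lambda>_. 0)" if "x 0 = ?Y (?row_end 0)" "x 1 = ?Y (?E 0)" for x
    by (intro Cmp_acc) (use that in simp_all)
  obtain d1 where d1: "step sim_ntm d d1" "back_config ?Y Acc (?row_end 0 + 0) (?E 0 + 0) d1"
    using back_config_step[OF d(2) nD t0 _ mv_range(3)] by (auto simp: Q_iffs simp del: row_end.simps)
  have cs: "cstate d1 = to_nat (Acc :: 'a st)" using d1(2) by (simp add: back_config_def)
  have "final_config sim_ntm d1" unfolding final_config_def
  proof
    assume "\<exists>c'. step sim_ntm d1 c'"
    then obtain c' q' y dd where "tr Acc (rd N d1) q' y dd" using stepE[OF _ cs] by metis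
    thus False by (cases rule: AccE)
  qed
  moreover have "(step sim_ntm)\<^sup>*\<^sup>* (init_config sim_ntm w) d1" using d(1) d1(1) by (meson rtranclp.rtrancl_into_rtrancl)
  ultimately show ?thesis using cs by blast
qed

end

section \<open>The simulation theorem\<close>

text \<open>Row \<open>j\<close> with its delimiter takes \<open>n + 2 + 2 * j\<close> cells; the
  sum is the quadratic length up to which the counter must reach.\<close>

lemma (in sim_inp) row_end_eq: "row_end m = n + 1 + m * (n + m + 3)"
  by (induction m) (auto simp: rowlen_def algebra_simps)

lemma bigo_bound:
  assumes "T \<in> nat_bigo (\<lambda>n. 2 ^ t n)"
  obtains C where "1 \<le> C" "\<And>n. T n \<le> C * 2 ^ t n"
proof -
  from assms obtain c where c: "c > 0" "eventually (\<lambda>n. norm (real (T n)) \<le> c * norm (real (2 ^ t n))) at_top"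
    unfolding nat_bigo_def by (auto elim: landau_o.bigE)
  then obtain N where N: "\<And>n. N \<le> n \<Longrightarrow> real (T n) \<le> c * 2 ^ t n"
    by (auto simp: eventually_at_top_linorder)
  \<comment> \<open>As \<open>2 ^ t n\<close> is at least 1, adding the sum of the finitely many
    exceptional values absorbs them into the constant.\<close>
  define C where "C = nat \<lceil>c\<rceil> + (\<Sum>i<N. T i) + 1"
  have "T n \<le> C * 2 ^ t n" for n
  proof (cases "N \<le> n")
    case True
    have "nat \<lceil>c\<rceil> \<le> C" unfolding C_def by linarith
    hence "c \<le> real C" using real_nat_ceiling_ge[of c] by linarith
    have "real (T n) \<le> c * 2 ^ t n" by (rule N[OF True])
    also have "\<dots> \<le> real C * 2 ^ t n" using \<open>c \<le> real C\<close> by (intro mult_right_mono) auto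
    finally have "real (T n) \<le> real (C * 2 ^ t n)" by simp
    thus ?thesis by (simp only: of_nat_le_iff)
  next
    case False
    hence "T n \<le> (\<Sum>i<N. T i)" by (intro member_le_sum) auto
    also have "\<dots> \<le> C * 1" by (simp add: C_def)
    also have "\<dots> \<le> C * 2 ^ t n" by (intro mult_left_mono) auto
    finally show ?thesis .
  qed
  moreover have "1 \<le> C" by (simp add: C_def)
  ultimately show ?thesis using that by blast
qed

text \<open>The additive constant lies in \<open>O(t)\<close> because \<open>t\<close> is eventually
  positive: \<open>t n = 0\<close> forces \<open>n \<le> C\<close>. Where \<open>t\<close> is
  positive, \<open>2 * t n + 5\<close> is at most \<open>7 * t n\<close>.\<close>

lemma bigo_affine:
  assumes S: "S \<in> nat_bigo t" and n: "\<And>n. n \<le> C * 2 ^ t n"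
  shows "(\<lambda>n. S n + 2 * t n + 5) \<in> nat_bigo t"
proof -
  have "1 \<le> t m" if "C < m" for m
    using n[of m] that by (cases "t m") auto
  hence "eventually (\<lambda>m. norm (real (2 * t m + 5)) \<le> 7 * norm (real (t m))) at_top"
    by (intro eventually_mono[OF eventually_gt_at_top[of C]]) force
  hence "(\<lambda>m. real (2 * t m + 5)) \<in> O(\<lambda>m. real (t m))" by (rule landau_o.bigI[rotated]) simp
  hence "(\<lambda>m. real (S m) + real (2 * t m + 5)) \<in> O(\<lambda>m. real (t m))"
    using S unfolding nat_bigo_def by (intro sum_in_bigo) auto
  thus ?thesis unfolding nat_bigo_def by (simp add: algebra_simps)
qed

lemma simulation_in_NST:
  fixes L :: "'a::finite list set" and Mt :: "unit ntm"
  assumes wfM: "wf_ntm M" and dec: "decides M L"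
    and T: "\<And>w \<rho>. finite_run M w \<rho> \<Longrightarrow> time \<rho> \<le> T (length w)"
    and C: "1 \<le> C" "\<And>n. T n \<le> C * 2 ^ t n" and nT: "\<And>n. n \<le> T n"
    and Mt: "wf_ntm Mt" "deterministic Mt" "2 \<le> ntapes Mt" "read_only Mt 0" "output_tape Mt 1"
    and run: "\<And>n. \<exists>\<rho>. finite_run Mt (replicate n ()) \<rho> \<and>
               (\<forall>c \<in> set \<rho>. chead c 0 \<in> {- 1..int n}) \<and>
               ctape (last \<rho>) 1 = word_tape (replicate (t n) ()) \<and>
               (\<Sum>i=2..<ntapes Mt. space \<rho> i) \<le> S n"
  shows "L \<in> NST (\<lambda>_. 3) (\<lambda>n. S n + 2 * t n + 5) 2"
proof -
  \<comment> \<open>One digit pays for the factor \<open>8 * C ^ 2\<close>, and each of the other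
    \<open>t n\<close> digits for a factor 4 of the squared \<open>2 ^ t n\<close>.\<close>
  define B where "B = 8 * int C ^ 2 + 1"
  have C1: "1 \<le> int C ^ 2" using C(1) by simp
  have B_ge: "8 * int C ^ 2 < B" "4 \<le> B" "2 \<le> B" unfolding B_def using C1 by simp_all
  interpret sim M Mt B by unfold_locales (use wfM Mt B_ge in auto)
  have pow: "8 * (int C * 2 ^ m) ^ 2 < B ^ (m + 1)" for m
  proof -
    have "8 * (int C * 2 ^ m) ^ 2 = 8 * int C ^ 2 * 4 ^ m"
      by (simp add: power_mult_distrib power_mult[symmetric] mult.commute[of m 2] power_mult)
    also have "\<dots> < B * 4 ^ m" using B_ge by simp
    also have "\<dots> \<le> B * B ^ m" using B_ge by (intro mult_left_mono power_mono) auto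
    finally show ?thesis by simp
  qed
  have inst: "\<exists>\<rho>t. sim_inp M Mt B w \<rho>t (t (length w)) (t (length w) + 1) \<and>
     (\<Sum>i=2..<ntapes Mt. space \<rho>t i) \<le> S (length w)" for w :: "'a list"
  proof -
    let ?n = "length w" let ?X = "int C * 2 ^ t ?n"
    obtain \<rho> where \<rho>: "finite_run Mt (replicate ?n ()) \<rho>" "\<forall>c \<in> set \<rho>. chead c 0 \<in> {- 1..int ?n}"
       "ctape (last \<rho>) 1 = word_tape (replicate (t ?n) ())" "(\<Sum>i=2..<ntapes Mt. space \<rho> i) \<le> S ?n"
      using run by blast
    have "?n \<le> C * 2 ^ t ?n" using nT[of ?n] C(2)[of ?n] by linarith
    hence "int ?n \<le> ?X" by (metis of_nat_le_iff of_nat_mult of_nat_numeral of_nat_power)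
    moreover have X1: "1 \<le> ?X" using C(1) mult_mono[of 1 "int C" 1 "2 ^ t ?n"] by simp
    moreover have "?X * 1 \<le> ?X * ?X" by (rule mult_left_mono) (use X1 in auto)
    ultimately have "int ?n + 1 < B ^ (t ?n + 1)" using pow[of "t ?n"] by (simp add: power2_eq_square)
    thus ?thesis using \<rho> by (intro exI[of _ \<rho>] conjI) (unfold_locales, auto)
  qed
  have noinf: "\<not> infinite_run sim_ntm w \<rho>" for w \<rho>
    using inst[of w] sim_inp.sim_ntm_no_infinite_run by blast
  have accL: "w \<in> L \<longleftrightarrow> (\<exists>c. (step M)\<^sup>*\<^sup>* (init_config M w) c \<and> final_config M c \<and> cstate c \<in> accepting M)" for w
    using dec finite_run_reach[of M w "\<lambda>c. cstate c \<in> accepting M"] unfolding decides_def by blast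
  have "decides sim_ntm L"
    unfolding decides_def
  proof (intro conjI allI)
    show "\<nexists>\<rho>. infinite_run sim_ntm w \<rho>" for w using noinf by blast
    fix w
    obtain \<rho>t where si: "sim_inp M Mt B w \<rho>t (t (length w)) (t (length w) + 1)" using inst by blast
    interpret I: sim_inp M Mt B w \<rho>t "t (length w)" "t (length w) + 1" by (rule si)
    show "w \<in> L \<longleftrightarrow> (\<exists>\<rho>. finite_run sim_ntm w \<rho> \<and> cstate (last \<rho>) \<in> accepting sim_ntm)"
    proof
      assume "\<exists>\<rho>. finite_run sim_ntm w \<rho> \<and> cstate (last \<rho>) \<in> accepting sim_ntm"
      hence "I.acc (init_config M w)" using I.sim_ntm_sound by auto
      thus "w \<in> L" unfolding accL I.acc_def .
    next
      assume "w \<in> L"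
      then obtain \<rho> where \<rho>: "finite_run M w \<rho>" "cstate (last \<rho>) \<in> accepting M"
        using dec unfolding decides_def by blast
      let ?n = "length w" let ?X = "int C * 2 ^ t ?n" let ?m = "time \<rho>"
      have ne: "\<rho> \<noteq> []" using \<rho>(1) by (simp add: finite_run_def)
      have m: "?m \<le> T ?n" by (rule T[OF \<rho>(1)])
      have "T ?n \<le> C * 2 ^ t ?n" by (rule C(2))
      hence TX: "int (T ?n) \<le> ?X" by (metis of_nat_le_iff of_nat_mult of_nat_numeral of_nat_power)
      have mX: "int ?m \<le> ?X" "int ?n \<le> ?X" using m nT[of ?n] TX by linarith+
      have X1: "1 \<le> ?X" using C(1) mult_mono[of 1 "int C" 1 "2 ^ t ?n"] by simp
      \<comment> \<open>As \<open>1 \<le> ?X\<close>, the second factor is at most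
        \<open>5 * ?X\<close>; the remaining \<open>n + 2\<close> adds at most
        \<open>3 * ?X ^ 2\<close>, which gives the 8.\<close>
      have "int ?m * (int ?n + int ?m + 3) \<le> ?X * (5 * ?X)"
        using mX X1 by (intro mult_mono) auto
      moreover have "?X * 1 \<le> ?X * ?X" by (rule mult_left_mono) (use X1 in auto)
      ultimately have "int (I.row_end ?m) + 1 \<le> 8 * ?X ^ 2"
        using mX X1 unfolding I.row_end_eq by (simp add: power2_eq_square)
      hence len: "int (I.row_end ?m) + 1 < B ^ (t ?n + 1)" using pow[of "t ?n"] by linarith
      have "\<exists>c. (step sim_ntm)\<^sup>*\<^sup>* (init_config sim_ntm w) c \<and> final_config sim_ntm c \<and> cstate c = to_nat (Acc :: 'a st)"
      proof (rule I.sim_ntm_complete[where g = "\<lambda>j. \<rho> ! j" and m = ?m, OF _ _ _ _ len])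
        show "\<rho> ! 0 = init_config M w" using \<rho>(1) ne by (auto simp: finite_run_def hd_conv_nth)
        show "step M (\<rho> ! j) (\<rho> ! Suc j)" if "j < ?m" for j
          using \<rho>(1) that unfolding finite_run_def successively_nth time_def by auto
        show "final_config M (\<rho> ! ?m)" "cstate (\<rho> ! ?m) \<in> accepting M"
          using \<rho> ne by (auto simp: finite_run_def time_def last_conv_nth)
      qed
      thus "\<exists>\<rho>. finite_run sim_ntm w \<rho> \<and> cstate (last \<rho>) \<in> accepting sim_ntm"
        using finite_run_reach[of sim_ntm w "\<lambda>c. cstate c \<in> accepting sim_ntm"] by auto
    qed
  qed
  moreover have "rst_bounded (\<lambda>_. 3) (\<lambda>n. S n + 2 * t n + 5) 2 sim_ntm"
    unfolding rst_bounded_def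
  proof (intro conjI allI impI)
    show "2 \<le> ntapes sim_ntm" using Mt(3) unfolding sim_ntm_simps(1) by linarith
    show "\<nexists>\<rho>. infinite_run sim_ntm w \<rho>" for w using noinf by blast
    fix w \<rho> assume r: "finite_run sim_ntm w \<rho>"
    obtain \<rho>t where si: "sim_inp M Mt B w \<rho>t (t (length w)) (t (length w) + 1)"
      and S: "(\<Sum>i=2..<ntapes Mt. space \<rho>t i) \<le> S (length w)" using inst by blast
    interpret I: sim_inp M Mt B w \<rho>t "t (length w)" "t (length w) + 1" by (rule si)
    show "1 + (\<Sum>i<2. rev_count \<rho> i) \<le> 3" using I.sim_ntm_rev_count[OF r, of 0] I.sim_ntm_rev_count[OF r, of 1]
      by (simp add: numeral_2_eq_2)
    \<comment> \<open>This is \<open>len_bound + 2\<close> for \<open>f = t n\<close> and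
      \<open>l = t n + 1\<close>, plus the work space of the constructor.\<close>
    show "(\<Sum>i=2..<ntapes sim_ntm. space \<rho> i) \<le> S (length w) + 2 * t (length w) + 5"
      using I.sim_ntm_space[OF r] S unfolding I.len_bound_def sim_ntm_simps(1) by linarith
  qed
  ultimately show ?thesis using wf_sim_ntm unfolding NST_def by blast
qed

theorem theorem3:
  fixes t :: "nat \<Rightarrow> nat"
  assumes "space_constructible t"
  shows "(NTIME (\<lambda>n. 2 ^ t n) :: 'a::finite list set set) \<subseteq> NST_class (\<lambda>_. 3) (nat_bigo t) 2"
proof
  fix L :: "'a list set" assume "L \<in> NTIME (\<lambda>n. 2 ^ t n)"
  then obtain M T where M: "wf_ntm M" "decides M L" "T \<in> nat_bigo (\<lambda>n. 2 ^ t n)"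
    "\<And>w \<rho>. finite_run M w \<rho> \<Longrightarrow> time \<rho> \<le> T (length w)" unfolding NTIME_def by blast
  show "L \<in> NST_class (\<lambda>_. 3) (nat_bigo t) 2"
  proof (cases "\<exists>n. T n < n")
    case True
    then obtain n where "T n < n" ..
    from prefix_in_NST[OF short_time_prefix[OF M(1,2,4) this]]
    have "L \<in> NST (\<lambda>_. 3) (\<lambda>_. 0) 2" by blast
    \<comment> \<open>Space 0 is admissible even if \<open>t\<close> vanishes.\<close>
    moreover have "(\<lambda>_. 0) \<in> nat_bigo t" by (simp add: nat_bigo_def)
    ultimately show ?thesis unfolding NST_class_def by blast
  next
    case False
    hence nT: "n \<le> T n" for n by (simp add: not_less)
    obtain C where C: "1 \<le> C" "\<And>n. T n \<le> C * 2 ^ t n" by (rule bigo_bound[OF M(3)]) blast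
    obtain Mt S where Mt: "wf_ntm Mt" "deterministic Mt" "2 \<le> ntapes Mt" "read_only Mt 0" "output_tape Mt 1"
      and S: "S \<in> nat_bigo t"
      and run: "\<And>n. \<exists>\<rho>. finite_run (Mt :: unit ntm) (replicate n ()) \<rho> \<and>
               (\<forall>c \<in> set \<rho>. chead c 0 \<in> {- 1..int n}) \<and>
               ctape (last \<rho>) 1 = word_tape (replicate (t n) ()) \<and>
               (\<Sum>i=2..<ntapes Mt. space \<rho> i) \<le> S n"
      using assms unfolding space_constructible_def by blast
    have "L \<in> NST (\<lambda>_. 3) (\<lambda>n. S n + 2 * t n + 5) 2"
      by (rule simulation_in_NST[OF M(1,2,4) C nT Mt run])
    moreover have "(\<lambda>n. S n + 2 * t n + 5) \<in> nat_bigo t"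
      by (rule bigo_affine[OF S, of C]) (use nT C(2) le_trans in blast)
    ultimately show ?thesis unfolding NST_class_def by blast
  qed
qed

end
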